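(* Let $\Omega\subset\mathbb{R}^n$ be a bounded Lipschitz domain, let $r\ge 1$ be an integer and $1\le p<\infty$. Let $\mathrm{Ind}_{\rm used}$ be a finite set of multi-indices with $\mathrm{Ind}_{r-1}\subseteq \mathrm{Ind}_{\rm used}$ and $\mathrm{Ind}_r\not\subseteq\mathrm{Ind}_{\rm used}$, with associated polynomial space $\mathcal{P}_{\rm used}$ and $\mathrm{Ind}_{r,\rm rest}=\mathrm{Ind}_r\setminus\mathrm{Ind}_{\rm used}$. For $j=1,\dots,J$ let $f_j:W^{r+1,p}(\Omega)\to\mathbb{R}$ be semi-norms on $W^{r+1,p}(\Omega)$ satisfying the following two conditions: (i) there is a constant $C$ such that $0\le f_j(v)\le C\|v\|_{r+1,p,\Omega}$ for all $v\in W^{r+1,p}(\Omega)$ and $1\le j\le J$; (ii) if $v\in\mathcal{P}_{\rm used}$ and $f_j(v)=0$ for all $1\le j\le J$, then $v=0$. Then each of the quantities $$\|v\|=\sum_{\gamma\in \mathrm{Ind}_{r,\rm rest}}\|D^{\gamma}v\|_{0,p,\Omega}+\sum_{j=1}^J f_j(v)+\sum_{|\gamma|=r+1}\|D^{\gamma}v\|_{0,p,\Omega}$$ and $$\|v\|=\Big(\sum_{\gamma\in \mathrm{Ind}_{r,\rm rest}}\|D^{\gamma}v\|_{0,p,\Omega}^p+\sum_{j=1}^J f_j(v)^p+\sum_{|\gamma|=r+1}\|D^{\gamma}v\|_{0,p,\Omega}^p\Big)^{1/p}$$ defines a norm on $W^{r+1,p}(\Omega)$ which is equivalent to the norm $\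|v\|_{r+1,p,\Omega}$.
   Context: A multi-index $\alpha=(\alpha_1,\dots,\alpha_n)$ is an $n$-tuple of non-negative integers with length $|\alpha|=\sum_i\alpha_i$, and $D^\alpha$ is the corresponding partial derivative. $\mathrm{Ind}_k=\{\alpha: |\alpha|\le k\}$. For the set $\mathrm{Ind}_{\rm used}$ of multi-indices, $\mathcal{P}_{\rm used}=\{v: v=\sum_{\alpha\in\mathrm{Ind}_{\rm used}}C_\alpha x^\alpha\}$ with real coefficients $C_\alpha$. $W^{k,p}(\Omega)$ is the usual Sobolev space with norm $\|\cdot\|_{k,p,\Omega}$; in particular $\|\cdot\|_{0,p,\Omega}$ is the $L^p(\Omega)$ norm. *)

theory Defs
  imports "HOL-Analysis.Analysis"
begin

text \<open>The dimension \<open>n\<close> is the cardinality of the index type \<open>'n\<close>; a multi-index is a function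
  \<open>'n \<Rightarrow> nat\<close>.\<close>

definition mi_length :: "('n::finite \<Rightarrow> nat) \<Rightarrow> nat" where
  "mi_length \<alpha> = (\<Sum>i\<in>UNIV. \<alpha> i)"

definition Ind :: "nat \<Rightarrow> ('n::finite \<Rightarrow> nat) set" where
  "Ind k = {\<alpha>. mi_length \<alpha> \<le> k}"

text \<open>The sums over \<^term>\<open>Ind k\<close> and over \<open>{\<gamma>. mi_length \<gamma> = k}\<close> below are genuine finite sums.\<close>

lemma finite_Ind: "finite (Ind k :: ('n::finite \<Rightarrow> nat) set)"
proof (rule finite_subset)
  show "(Ind k :: ('n \<Rightarrow> nat) set) \<subseteq> PiE UNIV (\<lambda>_. {..k})"
  proof
    fix \<alpha> :: "'n \<Rightarrow> nat" assume "\<alpha> \<in> Ind k"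
    moreover have "\<alpha> i \<le> (\<Sum>i\<in>UNIV. \<alpha> i)" for i
      by (rule member_le_sum) auto
    ultimately show "\<alpha> \<in> PiE UNIV (\<lambda>_. {..k})"
      by (auto simp: Ind_def mi_length_def intro: order_trans)
  qed
  show "finite (PiE (UNIV :: 'n set) (\<lambda>_. {..k}))"
    by (intro finite_PiE) auto
qed

lemma finite_mi_length_eq: "finite {\<gamma> :: 'n::finite \<Rightarrow> nat. mi_length \<gamma> = k}"
  by (rule finite_subset[OF _ finite_Ind[of k]]) (auto simp: Ind_def)

definition partial :: "'n::finite \<Rightarrow> (real^'n \<Rightarrow> real) \<Rightarrow> real^'n \<Rightarrow> real" where
  "partial i f x = deriv (\<lambda>t. f (x + t *\<^sub>R axis i 1)) 0"

text \<open>\<open>mi_partial \<alpha>\<close> applies each \<open>\<partial>\<^sub>i\<close> exactly \<open>\<alpha> i\<close> times, in the order given by an arbitrary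
  enumeration of the coordinates. It is only used for smooth functions, where the order is
  irrelevant.\<close>

definition coord_list :: "'n::finite list" where
  "coord_list = (SOME is. distinct is \<and> set is = UNIV)"

definition mi_partial :: "('n::finite \<Rightarrow> nat) \<Rightarrow> (real^'n \<Rightarrow> real) \<Rightarrow> real^'n \<Rightarrow> real" where
  "mi_partial \<alpha> f = foldr (\<lambda>i. partial i ^^ \<alpha> i) coord_list f"

primrec C_k :: "nat \<Rightarrow> (real^'n::finite \<Rightarrow> real) \<Rightarrow> bool" where
  "C_k 0 f \<longleftrightarrow> continuous_on UNIV f"
| "C_k (Suc k) f \<longleftrightarrow> (\<forall>x. f differentiable (at x)) \<and> (\<forall>i. C_k k (partial i f))"

definition test_function :: "(real^'n::finite) set \<Rightarrow> (real^'n \<Rightarrow> real) \<Rightarrow> bool" where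
  "test_function \<Omega> \<phi> \<longleftrightarrow> (\<forall>k. C_k k \<phi>) \<and>
     compact (closure {x. \<phi> x \<noteq> 0}) \<and> closure {x. \<phi> x \<noteq> 0} \<subseteq> \<Omega>"

definition polynomials :: "('n::finite \<Rightarrow> nat) set \<Rightarrow> (real^'n \<Rightarrow> real) set" where
  "polynomials A = {v. \<exists>C. v = (\<lambda>x. \<Sum>\<alpha>\<in>A. C \<alpha> * (\<Prod>i\<in>UNIV. (x $ i) ^ \<alpha> i))}"

text \<open>Near each boundary point the domain is the strict epigraph of a Lipschitz function over a
  hyperplane. A rotated coordinate system is encoded by the unit vector \<open>e\<close> of its last axis: the
  last coordinate of \<open>y\<close> is \<open>y \<bullet> e\<close>, and the remaining ones are represented by the projection
  \<open>y - (y \<bullet> e) e\<close> onto the hyperplane orthogonal to \<open>e\<close>.\<close>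

definition bounded_lipschitz_domain :: "(real^'n::finite) set \<Rightarrow> bool" where
  "bounded_lipschitz_domain \<Omega> \<longleftrightarrow>
     open \<Omega> \<and> connected \<Omega> \<and> \<Omega> \<noteq> {} \<and> bounded \<Omega> \<and>
     (\<forall>x\<in>frontier \<Omega>. \<exists>U e L g. open U \<and> x \<in> U \<and> norm e = 1 \<and>
        lipschitz_on L {z. z \<bullet> e = 0} (g :: real^'n \<Rightarrow> real) \<and>
        \<Omega> \<inter> U = {y \<in> U. g (y - (y \<bullet> e) *\<^sub>R e) < y \<bullet> e})"

text \<open>Elements of \<open>L\<^sup>p(\<Omega>)\<close> and \<open>W\<^sup>k\<^sup>,\<^sup>p(\<Omega>)\<close> are represented by functions on the whole space, of
  which only the values on \<open>\<Omega>\<close> matter; equality of elements is equality almost everywhere on \<open>\<Omega>\<close>.\<close>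

definition Lp_space :: "(real^'n::finite) set \<Rightarrow> real \<Rightarrow> (real^'n \<Rightarrow> real) set" where
  "Lp_space \<Omega> p = {u. u \<in> borel_measurable (lebesgue_on \<Omega>) \<and>
     integrable (lebesgue_on \<Omega>) (\<lambda>x. \<bar>u x\<bar> powr p)}"

definition Lp_norm :: "(real^'n::finite) set \<Rightarrow> real \<Rightarrow> (real^'n \<Rightarrow> real) \<Rightarrow> real" where
  "Lp_norm \<Omega> p u = (LINT x|lebesgue_on \<Omega>. \<bar>u x\<bar> powr p) powr (1 / p)"

definition locally_integrable :: "(real^'n::finite) set \<Rightarrow> (real^'n \<Rightarrow> real) \<Rightarrow> bool" where
  "locally_integrable \<Omega> u \<longleftrightarrow> (\<forall>K. compact K \<and> K \<subseteq> \<Omega> \<longrightarrow> integrable (lebesgue_on K) u)"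

definition has_weak_deriv ::
  "(real^'n::finite) set \<Rightarrow> ('n \<Rightarrow> nat) \<Rightarrow> (real^'n \<Rightarrow> real) \<Rightarrow> (real^'n \<Rightarrow> real) \<Rightarrow> bool" where
  "has_weak_deriv \<Omega> \<alpha> u w \<longleftrightarrow> locally_integrable \<Omega> u \<and> locally_integrable \<Omega> w \<and>
     (\<forall>\<phi>. test_function \<Omega> \<phi> \<longrightarrow>
        (LINT x|lebesgue_on \<Omega>. u x * mi_partial \<alpha> \<phi> x) =
        (-1) ^ mi_length \<alpha> * (LINT x|lebesgue_on \<Omega>. w x * \<phi> x))"

text \<open>A weak derivative on an open set is unique up to a null set, so the choice is immaterial for
  \<open>L\<^sup>p\<close> norms.\<close>

definition weak_deriv ::
  "(real^'n::finite) set \<Rightarrow> ('n \<Rightarrow> nat) \<Rightarrow> (real^'n \<Rightarrow> real) \<Rightarrow> real^'n \<Rightarrow> real" where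
  "weak_deriv \<Omega> \<alpha> u = (SOME w. has_weak_deriv \<Omega> \<alpha> u w)"

definition sobolev_space :: "(real^'n::finite) set \<Rightarrow> nat \<Rightarrow> real \<Rightarrow> (real^'n \<Rightarrow> real) set" where
  "sobolev_space \<Omega> k p = {u. u \<in> Lp_space \<Omega> p \<and>
     (\<forall>\<alpha>\<in>Ind k. \<exists>w\<in>Lp_space \<Omega> p. has_weak_deriv \<Omega> \<alpha> u w)}"

definition sobolev_norm ::
  "(real^'n::finite) set \<Rightarrow> nat \<Rightarrow> real \<Rightarrow> (real^'n \<Rightarrow> real) \<Rightarrow> real" where
  "sobolev_norm \<Omega> k p u = (\<Sum>\<alpha>\<in>Ind k. Lp_norm \<Omega> p (weak_deriv \<Omega> \<alpha> u) powr p) powr (1 / p)"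

definition seminorm_on :: "('a \<Rightarrow> real) set \<Rightarrow> (('a \<Rightarrow> real) \<Rightarrow> real) \<Rightarrow> bool" where
  "seminorm_on W f \<longleftrightarrow>
     (\<forall>u\<in>W. 0 \<le> f u) \<and>
     (\<forall>u\<in>W. \<forall>c. f (\<lambda>x. c * u x) = \<bar>c\<bar> * f u) \<and>
     (\<forall>u\<in>W. \<forall>v\<in>W. f (\<lambda>x. u x + v x) \<le> f u + f v)"

text \<open>A norm on a space of functions modulo equality almost everywhere on \<open>\<Omega>\<close>: it is well defined on
  equivalence classes, and vanishes exactly on the zero class.\<close>

definition norm_on ::
  "(real^'n::finite) set \<Rightarrow> (real^'n \<Rightarrow> real) set \<Rightarrow> ((real^'n \<Rightarrow> real) \<Rightarrow> real) \<Rightarrow> bool" where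
  "norm_on \<Omega> W N \<longleftrightarrow>
     seminorm_on W N \<and>
     (\<forall>u\<in>W. \<forall>v\<in>W. (AE x in lebesgue_on \<Omega>. u x = v x) \<longrightarrow> N u = N v) \<and>
     (\<forall>u\<in>W. N u = 0 \<longleftrightarrow> (AE x in lebesgue_on \<Omega>. u x = 0))"

definition equivalent_on ::
  "'v set \<Rightarrow> ('v \<Rightarrow> real) \<Rightarrow> ('v \<Rightarrow> real) \<Rightarrow> bool" where
  "equivalent_on W N M \<longleftrightarrow>
     (\<exists>c C. 0 < c \<and> 0 < C \<and> (\<forall>v\<in>W. c * M v \<le> N v \<and> N v \<le> C * M v))"

end

theory Submission
  imports Defs "HOL-Probability.Probability_Measure"
begin

text \<open>Both quantities are seminorms by Minkowski's inequality in \<open>L\<^sup>p\<close> and in \<open>\<ell>\<^sup>p\<close>, they differ at most by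
  a factor depending on the number of summands, and hypothesis (i) bounds them by a multiple of the
  Sobolev norm. What carries the theorem is the reverse bound \<open>\<parallel>v\<parallel> \<le> D N(v)\<close> for the first of them, \<open>N\<close>
  (lemma \<open>sobolev_norm_le_seminorm\<close>).

  The function \<open>v\<close> is split into a polynomial \<open>q\<close> of degree at most \<open>r\<close> and a remainder \<open>w\<close> whose
  derivatives of all orders up to \<open>r + 1\<close> are controlled by the derivatives of \<open>v\<close> of order \<open>r + 1\<close>,
  hence by \<open>N(v)\<close> (lemma \<open>bramble_hilbert\<close>). On polynomials of degree at most \<open>r\<close> the seminorm \<open>N\<close> is
  definite: if \<open>N(q) = 0\<close>, the constant derivatives of order \<open>r\<close> with index outside \<open>Ind_used\<close> vanish,
  so \<open>q\<close> lies in the polynomial space of hypothesis (ii), all \<open>f\<^sub>j(q)\<close> vanish, and \<open>q = 0\<close>. By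
  compactness of the unit sphere in the space of coefficients, \<open>\<parallel>q\<parallel> \<le> K N(q)\<close>. As
  \<open>N(q) \<le> N(v) + N(w)\<close>, both parts of \<open>v\<close> are bounded by \<open>N(v)\<close>.

  The splitting comes from the Poincare inequality \<open>\<parallel>u - c\<parallel> \<le> K \<parallel>\<nabla>u\<parallel>\<close>, applied to the derivatives of
  \<open>v\<close> from order \<open>r\<close> downwards. It is obtained directly, without a compact embedding. If every segment
  from a point of an open set \<open>A\<close> to a point of a ball \<open>B\<close> stays in \<open>\<Omega>\<close>, the increments of \<open>u\<close> along
  these segments are integrals of the gradient, and averaging them over \<open>A \<times> B\<close> gives the inequality
  on \<open>A\<close> (lemma \<open>poincare_on_visible\<close>). In a Lipschitz domain each point of the closure has a
  neighbourhood whose points in \<open>\<Omega>\<close> all see such a common ball; finitely many of these neighbourhoods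
  cover the domain, and two overlapping ones can be merged, so connectedness yields the inequality on
  all of \<open>\<Omega>\<close> (lemma \<open>poincare_on_lipschitz_domain\<close>).

  A Sobolev function is known only through its pairing with test functions. The formula for its
  increments along a segment (lemma \<open>translation_identity\<close>) is therefore first derived after pairing
  with a test function, by Fubini and a translation, and then holds almost everywhere by the
  fundamental lemma of the calculus of variations.\<close>

section \<open>Calculus of smooth functions\<close>

definition smooth :: "(real^'n::finite \<Rightarrow> real) \<Rightarrow> bool" where
  "smooth f \<longleftrightarrow> (\<forall>k. C_k k f)"

lemma partial_eqI:
  fixes f :: "real^'n::finite \<Rightarrow> real"
  assumes "(f has_derivative f') (at x)"
  shows "partial i f x = f' (axis i 1)"
    and "((\<lambda>t. f (x + t *\<^sub>R axis i 1)) has_real_derivative f' (axis i 1)) (at 0)"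
proof -
  have l: "linear f'" using assms has_derivative_linear by blast
  have "((\<lambda>t::real. x + t *\<^sub>R axis i 1) has_derivative (\<lambda>t. t *\<^sub>R axis i 1)) (at 0)"
    by (auto intro!: derivative_eq_intros)
  moreover have "(f has_derivative f') (at (x + 0 *\<^sub>R axis i 1))" using assms by simp
  ultimately have "((\<lambda>t. f (x + t *\<^sub>R axis i 1)) has_derivative (\<lambda>t. f' (t *\<^sub>R axis i 1))) (at 0)"
    using has_derivative_compose[of "\<lambda>t::real. x + t *\<^sub>R axis i 1" "\<lambda>t. t *\<^sub>R axis i 1" 0 UNIV f f'] by simp
  moreover have "(\<lambda>t. f' (t *\<^sub>R axis i 1)) = (\<lambda>t. t * f' (axis i 1))"
    using linear_scale[OF l] by auto
  ultimately show d: "((\<lambda>t. f (x + t *\<^sub>R axis i 1)) has_real_derivative f' (axis i 1)) (at 0)"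
    by (simp add: has_field_derivative_def mult_commute_abs)
  show "partial i f x = f' (axis i 1)"
    unfolding partial_def using d by (rule DERIV_imp_deriv)
qed

lemma has_derivative_partial:
  fixes f :: "real^'n::finite \<Rightarrow> real"
  assumes "f differentiable at x"
  shows "(f has_derivative (\<lambda>v. \<Sum>i\<in>UNIV. v $ i * partial i f x)) (at x)"
proof -
  obtain f' where f': "(f has_derivative f') (at x)" using assms differentiable_def by blast
  then have l: "linear f'" using has_derivative_linear by blast
  have "f' v = (\<Sum>i\<in>UNIV. v $ i * partial i f x)" for v
  proof -
    have "f' v = f' (\<Sum>i\<in>UNIV. v $ i *\<^sub>R axis i 1)"
      using basis_expansion[of v] by (simp add: scalar_mult_eq_scaleR)
    also have "\<dots> = (\<Sum>i\<in>UNIV. v $ i * f' (axis i 1))"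
      using l by (simp add: linear_sum linear_scale)
    finally show ?thesis using partial_eqI(1)[OF f'] by simp
  qed
  then show ?thesis using f' by (metis (no_types, lifting) ext)
qed

lemma DERIV_along_line:
  fixes f :: "real^'n::finite \<Rightarrow> real"
  assumes "f differentiable at (x + t *\<^sub>R h)"
  shows "((\<lambda>t. f (x + t *\<^sub>R h)) has_real_derivative (\<Sum>i\<in>UNIV. h $ i * partial i f (x + t *\<^sub>R h))) (at t)"
proof -
  have "((\<lambda>t::real. x + t *\<^sub>R h) has_derivative (\<lambda>t. t *\<^sub>R h)) (at t)"
    by (auto intro!: derivative_eq_intros)
  from has_derivative_compose[OF this has_derivative_partial[OF assms]]
  have "((\<lambda>t. f (x + t *\<^sub>R h)) has_derivative
      (\<lambda>s. \<Sum>i\<in>UNIV. (s *\<^sub>R h) $ i * partial i f (x + t *\<^sub>R h))) (at t)" .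
  moreover have "(\<lambda>s. \<Sum>i\<in>UNIV. (s *\<^sub>R h) $ i * partial i f (x + t *\<^sub>R h))
      = (*) (\<Sum>i\<in>UNIV. h $ i * partial i f (x + t *\<^sub>R h))"
    by (rule ext) (simp add: sum_distrib_left sum_distrib_right mult_ac)
  ultimately show ?thesis by (simp add: has_field_derivative_def)
qed

lemma partial_const: "partial i (\<lambda>x. c) = (\<lambda>x. 0)"
  using partial_eqI(1)[OF has_derivative_const] by fastforce

lemma partial_add:
  assumes "\<And>x. f differentiable at x" "\<And>x. g differentiable at x"
  shows "partial i (\<lambda>x. f x + g x) = (\<lambda>x. partial i f x + partial i g x)"
proof
  fix x
  from has_derivative_add[OF has_derivative_partial[OF assms(1)] has_derivative_partial[OF assms(2)]]
  show "partial i (\<lambda>x. f x + g x) x = partial i f x + partial i g x"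
    by (subst partial_eqI(1), assumption)
       (simp add: axis_def if_distrib[of "\<lambda>z. z * _"] cong: if_cong)
qed

lemma partial_mult:
  assumes "\<And>x. f differentiable at x" "\<And>x. g differentiable at x"
  shows "partial i (\<lambda>x. f x * g x) = (\<lambda>x. partial i f x * g x + f x * partial i g x)"
proof
  fix x
  from has_derivative_mult[OF has_derivative_partial[OF assms(1)] has_derivative_partial[OF assms(2)]]
  show "partial i (\<lambda>x. f x * g x) x = partial i f x * g x + f x * partial i g x"
    by (subst partial_eqI(1), assumption)
       (simp add: axis_def if_distrib[of "\<lambda>z. z * _"] cong: if_cong)
qed

lemma has_derivative_chain:
  assumes "f differentiable at x" "(G has_real_derivative G') (at (f x))"
  shows "((\<lambda>x. G (f x)) has_derivative (\<lambda>v. (\<Sum>i\<in>UNIV. v $ i * partial i f x) * G')) (at x)"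
  using has_derivative_compose[OF has_derivative_partial[OF assms(1)], of G] assms(2)
  by (simp add: has_field_derivative_def mult.commute)

lemma partial_compose:
  assumes "\<And>x. f differentiable at x" "\<And>t. (G has_real_derivative G' t) (at t)"
  shows "partial i (\<lambda>x. G (f x)) = (\<lambda>x. G' (f x) * partial i f x)"
proof
  fix x
  show "partial i (\<lambda>x. G (f x)) x = G' (f x) * partial i f x"
    by (subst partial_eqI(1)[OF has_derivative_chain[OF assms]])
       (simp add: axis_def if_distrib[of "\<lambda>z. z * _"] cong: if_cong)
qed

lemma partial_translate: "partial i (\<lambda>x. f (x + a)) = (\<lambda>x. partial i f (x + a))"
  by (rule ext) (simp add: partial_def algebra_simps)

lemma partial_nth: "partial j (\<lambda>x. x $ i) = (\<lambda>x. if i = j then 1 else 0)"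
proof
  fix x :: "real^'a"
  have "((\<lambda>x. x $ i) has_derivative (\<lambda>x. x $ i)) (at x)"
    by (rule bounded_linear.has_derivative[OF bounded_linear_vec_nth has_derivative_ident])
  from partial_eqI(1)[OF this] show "partial j (\<lambda>x. x $ i) x = (if i = j then 1 else 0)"
    by (simp add: axis_def)
qed

lemma C_k_Suc_D: "C_k (Suc k) f \<Longrightarrow> C_k k f"
proof (induction k arbitrary: f)
  case 0
  then show ?case
    by (auto simp: continuous_on_eq_continuous_at intro: differentiable_imp_continuous_within)
next
  case (Suc k)
  then show ?case by simp
qed

lemma C_k_const: "C_k k (\<lambda>x. c)"
  by (induction k arbitrary: c) (auto simp: partial_const)

lemma C_k_nth: "C_k k (\<lambda>x :: real^'n::finite. x $ i)"
proof (cases k)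
  case (Suc l)
  have "(\<lambda>x. x $ i) differentiable at x" for x :: "real^'n"
    using bounded_linear.has_derivative[OF bounded_linear_vec_nth[of i] has_derivative_ident]
      differentiable_def by blast
  then show ?thesis using Suc by (simp add: partial_nth C_k_const)
qed (auto intro!: continuous_intros)

lemma C_k_add: "C_k k f \<Longrightarrow> C_k k g \<Longrightarrow> C_k k (\<lambda>x. f x + g x)"
  by (induction k arbitrary: f g) (auto intro!: continuous_intros simp: partial_add)

lemma C_k_mult: "C_k k f \<Longrightarrow> C_k k g \<Longrightarrow> C_k k (\<lambda>x. f x * g x)"
proof (induction k arbitrary: f g)
  case (Suc k)
  then have "C_k k f" "C_k k g" using C_k_Suc_D by blast+
  then show ?case using Suc by (auto simp: partial_mult intro!: C_k_add)
qed (auto intro!: continuous_intros)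

lemma C_k_compose:
  assumes G: "\<And>n t. (G n has_real_derivative G (Suc n) t) (at t)"
  shows "C_k k f \<Longrightarrow> C_k k (\<lambda>x. G n (f x))"
proof (induction k arbitrary: n f)
  case 0
  have "continuous_on UNIV (G n)"
    using G by (meson DERIV_continuous_on has_field_derivative_at_within)
  then show ?case using 0 by (auto intro: continuous_on_compose2)
next
  case (Suc k)
  then have f: "C_k k f" "\<And>x. f differentiable at x" using C_k_Suc_D by auto
  have "(\<lambda>x. G n (f x)) differentiable at x" for x
    using has_derivative_chain[OF f(2) G] differentiable_def by blast
  moreover have "C_k k (partial i (\<lambda>x. G n (f x)))" for i
    using Suc f by (subst partial_compose[OF f(2) G]) (auto intro!: C_k_mult)
  ultimately show ?case by simp
qed

lemma C_k_translate: "C_k k f \<Longrightarrow> C_k k (\<lambda>x. f (x + a))"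
proof (induction k arbitrary: f)
  case 0
  then show ?case by (auto intro!: continuous_intros intro: continuous_on_compose2)
next
  case (Suc k)
  have "(\<lambda>x. f (x + a)) differentiable at x" for x
    using differentiable_chain_at[of "\<lambda>x. x + a" x f] Suc.prems by (auto simp: o_def)
  then show ?case using Suc by (auto simp: partial_translate)
qed

lemma smooth_differentiable: "smooth f \<Longrightarrow> f differentiable at x"
  unfolding smooth_def by (metis C_k.simps(2))
lemma smooth_partial: "smooth f \<Longrightarrow> smooth (partial i f)"
  unfolding smooth_def by (metis C_k.simps(2))
lemma smooth_continuous: "smooth f \<Longrightarrow> continuous_on S f"
  unfolding smooth_def by (metis C_k.simps(1) continuous_on_subset top_greatest)
lemma smooth_const: "smooth (\<lambda>x. c)" by (simp add: smooth_def C_k_const)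
lemma smooth_nth: "smooth (\<lambda>x. x $ i)" by (simp add: smooth_def C_k_nth)
lemma smooth_add: "smooth f \<Longrightarrow> smooth g \<Longrightarrow> smooth (\<lambda>x. f x + g x)" by (simp add: smooth_def C_k_add)
lemma smooth_mult: "smooth f \<Longrightarrow> smooth g \<Longrightarrow> smooth (\<lambda>x. f x * g x)" by (simp add: smooth_def C_k_mult)
lemma smooth_translate: "smooth f \<Longrightarrow> smooth (\<lambda>x. f (x + a))" by (simp add: smooth_def C_k_translate)
lemma smooth_compose:
  assumes "\<And>n t. (G n has_real_derivative G (Suc n) t) (at t)" "smooth f"
  shows "smooth (\<lambda>x. G n (f x))"
  unfolding smooth_def
proof
  fix k show "C_k k (\<lambda>x. G n (f x))"
    using C_k_compose[of G k f n, OF assms(1)] assms(2) unfolding smooth_def by blast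
qed
lemma smooth_sum: "finite A \<Longrightarrow> (\<And>i. i \<in> A \<Longrightarrow> smooth (f i)) \<Longrightarrow> smooth (\<lambda>x. \<Sum>i\<in>A. f i x)"
  by (induction A rule: finite_induct) (auto intro: smooth_const smooth_add)
lemma smooth_prod: "finite A \<Longrightarrow> (\<And>i. i \<in> A \<Longrightarrow> smooth (f i)) \<Longrightarrow> smooth (\<lambda>x. \<Prod>i\<in>A. f i x)"
  by (induction A rule: finite_induct) (auto intro: smooth_const smooth_mult)
lemma smooth_power: "smooth f \<Longrightarrow> smooth (\<lambda>x. f x ^ k)"
  by (induction k) (auto intro: smooth_const smooth_mult)

lemma DERIV_along_axis:
  fixes g :: "real^'n::finite \<Rightarrow> real"
  assumes "smooth g"
  shows "((\<lambda>t. g (y + t *\<^sub>R axis k 1)) has_real_derivative partial k g (y + t *\<^sub>R axis k 1)) (at t)"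
  using DERIV_along_line[of g y t "axis k 1"] smooth_differentiable[OF assms]
  by (simp add: axis_def if_distrib[of "\<lambda>z. z * _"] cong: if_cong)

text \<open>Two applications of the mean value theorem, in direction \<open>i\<close> and then in direction \<open>j\<close>. The left-hand
  side is symmetric in \<open>i\<close> and \<open>j\<close>, the right-hand side is not.\<close>

lemma smooth_difference_quotient:
  fixes f :: "real^'n::finite \<Rightarrow> real"
  assumes f: "smooth f" and h: "h > 0"
  shows "\<exists>s t. 0 < s \<and> s < h \<and> 0 < t \<and> t < h \<and>
    f (x + h *\<^sub>R axis i 1 + h *\<^sub>R axis j 1) - f (x + h *\<^sub>R axis i 1) - f (x + h *\<^sub>R axis j 1) + f x
      = h * h * partial j (partial i f) (x + s *\<^sub>R axis i 1 + t *\<^sub>R axis j 1)"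
proof -
  let ?a = "axis i 1 :: real^'n" and ?b = "axis j 1 :: real^'n"
  note der = DERIV_along_axis
  define p where "p = (\<lambda>s. f (x + h *\<^sub>R ?b + s *\<^sub>R ?a) - f (x + s *\<^sub>R ?a))"
  have "(p has_real_derivative (partial i f (x + h *\<^sub>R ?b + s *\<^sub>R ?a) - partial i f (x + s *\<^sub>R ?a))) (at s)" for s
    unfolding p_def by (intro DERIV_diff der f)
  from MVT2[OF h, OF this] obtain s where s: "0 < s" "s < h"
    "p h - p 0 = (h - 0) * (partial i f (x + h *\<^sub>R ?b + s *\<^sub>R ?a) - partial i f (x + s *\<^sub>R ?a))"
    by blast
  obtain t where t: "0 < t" "t < h"
    "partial i f (x + s *\<^sub>R ?a + h *\<^sub>R ?b) - partial i f (x + s *\<^sub>R ?a + 0 *\<^sub>R ?b)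
      = (h - 0) * partial j (partial i f) (x + s *\<^sub>R ?a + t *\<^sub>R ?b)"
    using MVT2[OF h, OF der[OF smooth_partial[OF f]]] by blast
  have "p h - p 0 = f (x + h *\<^sub>R ?a + h *\<^sub>R ?b) - f (x + h *\<^sub>R ?a) - f (x + h *\<^sub>R ?b) + f x"
    by (simp add: p_def algebra_simps)
  with s t show ?thesis by (intro exI[of _ s] exI[of _ t]) (simp add: algebra_simps)
qed

text \<open>Schwarz: both mixed derivatives are the limit of the same second difference quotient.\<close>

lemma partial_commute:
  fixes f :: "real^'n::finite \<Rightarrow> real"
  assumes f: "smooth f"
  shows "partial i (partial j f) = partial j (partial i f)"
proof (rule ext, rule ccontr)
  fix x
  let ?F = "partial i (partial j f)" and ?G = "partial j (partial i f)"
  assume ne: "?F x \<noteq> ?G x"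
  define e where "e = \<bar>?F x - ?G x\<bar> / 2"
  have e: "e > 0" using ne by (simp add: e_def)
  have "continuous (at x) ?F" "continuous (at x) ?G"
    using smooth_continuous[OF smooth_partial[OF smooth_partial[OF f]], of UNIV]
    by (auto simp: continuous_on_eq_continuous_at)
  then obtain d1 d2 where d: "d1 > 0" "d2 > 0"
    "\<And>y. dist y x < d1 \<Longrightarrow> dist (?F y) (?F x) < e" "\<And>y. dist y x < d2 \<Longrightarrow> dist (?G y) (?G x) < e"
    using e unfolding continuous_at_eps_delta by (metis dist_norm)
  define h where "h = min d1 d2 / 2"
  have h: "h > 0" "2 * h \<le> d1" "2 * h \<le> d2" using d by (auto simp: h_def)
  have close: "dist (x + s *\<^sub>R axis k 1 + t *\<^sub>R axis l 1) x < 2 * h"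
    if "0 < s" "s < h" "0 < t" "t < h" for s t k l
  proof -
    have "norm (s *\<^sub>R axis k (1::real) + t *\<^sub>R axis l 1) \<le> s + t"
      using norm_triangle_ineq[of "s *\<^sub>R axis k (1::real)" "t *\<^sub>R axis l 1"] that by simp
    then show ?thesis using that by (simp add: dist_norm add.assoc)
  qed
  obtain s t where 1: "0 < s" "s < h" "0 < t" "t < h" 
    "f (x + h *\<^sub>R axis i 1 + h *\<^sub>R axis j 1) - f (x + h *\<^sub>R axis i 1) - f (x + h *\<^sub>R axis j 1) + f x
      = h * h * ?G (x + s *\<^sub>R axis i 1 + t *\<^sub>R axis j 1)"
    using smooth_difference_quotient[OF f h(1)] by blast
  obtain s' t' where 2: "0 < s'" "s' < h" "0 < t'" "t' < h" 
    "f (x + h *\<^sub>R axis j 1 + h *\<^sub>R axis i 1) - f (x + h *\<^sub>R axis j 1) - f (x + h *\<^sub>R axis i 1) + f x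
      = h * h * ?F (x + s' *\<^sub>R axis j 1 + t' *\<^sub>R axis i 1)"
    using smooth_difference_quotient[OF f h(1)] by blast
  have "h * h * ?G (x + s *\<^sub>R axis i 1 + t *\<^sub>R axis j 1) = h * h * ?F (x + s' *\<^sub>R axis j 1 + t' *\<^sub>R axis i 1)"
    using 1(5) 2(5) by (simp add: algebra_simps)
  then have "?G (x + s *\<^sub>R axis i 1 + t *\<^sub>R axis j 1) = ?F (x + s' *\<^sub>R axis j 1 + t' *\<^sub>R axis i 1)"
    using h(1) by simp
  moreover have "dist (?G (x + s *\<^sub>R axis i 1 + t *\<^sub>R axis j 1)) (?G x) < e"
    using close[OF 1(1-4)] h by (intro d(4)) (meson less_le_trans)
  moreover have "dist (?F (x + s' *\<^sub>R axis j 1 + t' *\<^sub>R axis i 1)) (?F x) < e"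
    using close[OF 2(1-4)] h by (intro d(3)) (meson less_le_trans)
  ultimately have "dist (?F x) (?G x) < e + e"
    by (metis add.commute add_strict_mono dist_commute dist_triangle_less_add)
  then show False by (simp add: e_def dist_real_def)
qed

section \<open>Test functions and the fundamental lemma of the calculus of variations\<close>

text \<open>For \<open>p = 1\<close> this is the standard smooth function that is positive exactly on the positive half-line.
  The polynomial factor makes the family closed under differentiation, so that smoothness follows from
  a single computation of a derivative.\<close>

definition flat_exp :: "real poly \<Rightarrow> real \<Rightarrow> real" where
  "flat_exp p t = (if t > 0 then poly p (1 / t) * exp (- (1 / t)) else 0)"

lemma poly_exp_tendsto_0: "((\<lambda>x. poly p x * exp (- x)) \<longlongrightarrow> (0::real)) at_top"
proof -
  have "((\<lambda>x. \<Sum>i\<le>degree p. coeff p i * (x ^ i / exp x)) \<longlongrightarrow> (\<Sum>i\<le>degree p. coeff p i * 0)) at_top"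
    by (intro tendsto_intros tendsto_power_div_exp_0)
  moreover have "(\<Sum>i\<le>degree p. coeff p i * (x ^ i / exp x)) = poly p x * exp (- x)" for x
    by (simp add: poly_altdef sum_distrib_right exp_minus divide_inverse mult.assoc)
  ultimately show ?thesis by simp
qed

lemma flat_exp_has_derivative:
  "(flat_exp p has_real_derivative flat_exp ([:0, 0, 1:] * (p - pderiv p)) t) (at t)"
proof -
  consider "t > 0" | "t < 0" | "t = 0" by linarith
  then show ?thesis
  proof cases
    case 1
    have "((\<lambda>t. poly p (1 / t) * exp (- (1 / t))) has_real_derivative
        flat_exp ([:0, 0, 1:] * (p - pderiv p)) t) (at t)"
      using 1 by (auto intro!: derivative_eq_intros DERIV_chain'[OF _ poly_DERIV] simp: flat_exp_def field_simps power2_eq_square)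
    then show ?thesis
      by (rule has_field_derivative_transform_within_open[where S = "{0<..}"])
        (use 1 in \<open>auto simp: flat_exp_def\<close>)
  next
    case 2
    have "((\<lambda>t. 0) has_real_derivative flat_exp ([:0, 0, 1:] * (p - pderiv p)) t) (at t)"
      using 2 by (auto simp: flat_exp_def)
    then show ?thesis
      by (rule has_field_derivative_transform_within_open[where S = "{..<0}"])
        (use 2 in \<open>auto simp: flat_exp_def\<close>)
  next
    case 3
    have "((\<lambda>h. (flat_exp p (0 + h) - flat_exp p 0) / h) \<longlongrightarrow> 0) (at 0)"
    proof (rule filterlim_split_at)
      show "((\<lambda>h. (flat_exp p (0 + h) - flat_exp p 0) / h) \<longlongrightarrow> 0) (at_left 0)"
        by (rule tendsto_eventually)
          (auto simp: flat_exp_def eventually_at_filter intro!: always_eventually)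
      \<comment> \<open>The factor \<open>1 / h\<close> of the difference quotient is absorbed into the polynomial.\<close>
      have "((\<lambda>h. poly (pCons 0 p) (inverse h) * exp (- inverse h)) \<longlongrightarrow> (0::real)) (at_right 0)"
        by (rule filterlim_compose[OF poly_exp_tendsto_0 filterlim_inverse_at_top_right])
      then show "((\<lambda>h. (flat_exp p (0 + h) - flat_exp p 0) / h) \<longlongrightarrow> 0) (at_right 0)"
        by (rule Lim_transform_eventually)
          (auto simp: flat_exp_def eventually_at_filter field_simps intro!: always_eventually)
    qed
    then have "(flat_exp p has_real_derivative 0) (at 0)" by (simp add: DERIV_def)
    then show ?thesis using 3 by (simp add: flat_exp_def)
  qed
qed

lemma smooth_flat_exp: "smooth f \<Longrightarrow> smooth (\<lambda>x. flat_exp p (f x))"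
  using smooth_compose[of "\<lambda>n. flat_exp (((\<lambda>p. [:0, 0, 1:] * (p - pderiv p)) ^^ n) p)" f 0] flat_exp_has_derivative
  by simp

text \<open>The product is a smooth function that is positive exactly on the open box, so the functions \<open>1 - exp (- m \<dots>)\<close>
  are smooth, vanish outside the box and increase to its indicator function.\<close>

definition cutoff :: "real \<Rightarrow> real^'n::finite \<Rightarrow> real^'n \<Rightarrow> real^'n \<Rightarrow> real" where
  "cutoff m a b x = 1 - exp (- (m * (\<Prod>i\<in>UNIV. flat_exp 1 (x $ i - a $ i) * flat_exp 1 (b $ i - x $ i))))"

lemma smooth_cutoff: "smooth (cutoff m a b)"
proof -
  have lin: "smooth (\<lambda>x. x $ i - c)" "smooth (\<lambda>x. c - x $ i)" for i :: 'a and c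
    using smooth_add[OF smooth_nth[of i] smooth_const[of "- c"]]
      smooth_add[OF smooth_const[of c] smooth_mult[OF smooth_const[of "- 1"] smooth_nth[of i]]] by auto
  have "smooth (\<lambda>x. m * (\<Prod>i\<in>UNIV. flat_exp 1 (x $ i - a $ i) * flat_exp 1 (b $ i - x $ i)))"
    by (intro smooth_mult[OF smooth_const] smooth_prod smooth_mult smooth_flat_exp lin) auto
  moreover have "((\<lambda>t. (- 1) ^ n * exp (- t)) has_real_derivative (- 1) ^ Suc n * exp (- t)) (at t)"
    for n and t :: real
    by (auto intro!: derivative_eq_intros)
  ultimately have "smooth (\<lambda>x. exp (- (m * (\<Prod>i\<in>UNIV. flat_exp 1 (x $ i - a $ i) * flat_exp 1 (b $ i - x $ i)))))"
    using smooth_compose[of "\<lambda>n t. (- 1) ^ n * exp (- t)" _ 0] by auto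
  from smooth_add[OF smooth_const[of 1] smooth_mult[OF smooth_const[of "- 1"] this]]
  show ?thesis by (simp add: cutoff_def[abs_def])
qed

lemma cutoff_bounds: "m \<ge> 0 \<Longrightarrow> 0 \<le> cutoff m a b x" "cutoff m a b x \<le> 1"
proof -
  have "0 \<le> (\<Prod>i\<in>UNIV. flat_exp 1 (x $ i - a $ i) * flat_exp 1 (b $ i - x $ i))"
    by (intro prod_nonneg) (auto simp: flat_exp_def)
  then show "m \<ge> 0 \<Longrightarrow> 0 \<le> cutoff m a b x" by (simp add: cutoff_def)
qed (simp add: cutoff_def)

lemma cutoff_outside: "x \<notin> box a b \<Longrightarrow> cutoff m a b x = 0"
proof -
  assume "x \<notin> box a b"
  then obtain i where "\<not> (a $ i < x $ i \<and> x $ i < b $ i)" by (auto simp: mem_box_cart)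
  then have "flat_exp 1 (x $ i - a $ i) * flat_exp 1 (b $ i - x $ i) = 0" by (auto simp: flat_exp_def)
  then have "(\<Prod>i\<in>UNIV. flat_exp 1 (x $ i - a $ i) * flat_exp 1 (b $ i - x $ i)) = 0" by (subst prod_zero_iff) auto
  then show ?thesis by (simp add: cutoff_def)
qed

lemma cutoff_tendsto: "(\<lambda>m. cutoff (real m) a b x) \<longlonglongrightarrow> indicator (box a b) x"
proof (cases "x \<in> box a b")
  case True
  define c where "c = (\<Prod>i\<in>UNIV. flat_exp 1 (x $ i - a $ i) * flat_exp 1 (b $ i - x $ i))"
  have "c > 0" unfolding c_def using True by (intro prod_pos) (auto simp: flat_exp_def mem_box_cart)
  then have "(\<lambda>m. exp (- c) ^ m) \<longlonglongrightarrow> 0" by (intro LIMSEQ_realpow_zero) auto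
  moreover have "exp (- c) ^ m = exp (- (real m * c))" for m
    using exp_of_nat_mult[of m "- c"] by simp
  ultimately have "(\<lambda>m. exp (- (real m * c))) \<longlonglongrightarrow> 0" by simp
  then have "(\<lambda>m. 1 - exp (- (real m * c))) \<longlonglongrightarrow> 1 - 0" by (rule tendsto_diff[OF tendsto_const])
  then show ?thesis using True by (simp add: cutoff_def c_def)
qed (simp add: cutoff_outside)

lemma test_function_smooth: "test_function A \<phi> \<Longrightarrow> smooth \<phi>"
  by (simp add: test_function_def smooth_def)

lemma test_functionI:
  assumes "smooth \<phi>" "compact K" "K \<subseteq> A" "\<And>x. x \<notin> K \<Longrightarrow> \<phi> x = 0"
  shows "test_function A \<phi>"
proof -
  have "closure {x. \<phi> x \<noteq> 0} \<subseteq> K"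
    using assms by (intro closure_minimal) (auto intro: compact_imp_closed)
  moreover from this have "compact (closure {x. \<phi> x \<noteq> 0})"
    using closed_Int_compact[OF closed_closure assms(2), of "{x. \<phi> x \<noteq> 0}"] by (simp only: inf.absorb1)
  ultimately show ?thesis using assms(1,3) by (auto simp: test_function_def smooth_def)
qed

lemma test_functionE:
  assumes "test_function A \<phi>"
  obtains K where "compact K" "K \<subseteq> A" "\<And>x. x \<notin> K \<Longrightarrow> \<phi> x = 0"
  using assms closure_subset[of "{x. \<phi> x \<noteq> 0}"] unfolding test_function_def by blast

lemma test_function_cutoff: "cbox a b \<subseteq> A \<Longrightarrow> test_function A (cutoff m a b)"
  by (rule test_functionI[OF smooth_cutoff, of "cbox a b"])
    (auto intro!: cutoff_outside simp: box_subset_cbox[THEN subsetD])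

lemma test_function_bounded:
  assumes "test_function A \<phi>" obtains B where "\<And>x. \<bar>\<phi> x\<bar> \<le> B"
proof -
  obtain K where K: "compact K" "\<And>x. x \<notin> K \<Longrightarrow> \<phi> x = 0" using assms test_functionE by metis
  have "bounded (\<phi> ` K)"
    using K by (intro compact_imp_bounded compact_continuous_image smooth_continuous test_function_smooth[OF assms])
  then obtain B where "\<And>x. x \<in> K \<Longrightarrow> \<bar>\<phi> x\<bar> \<le> B" by (auto simp: bounded_iff)
  then have "\<bar>\<phi> x\<bar> \<le> max B 0" for x using K(2)[of x] by (cases "x \<in> K") (simp_all add: le_max_iff_disj)
  then show ?thesis using that by blast
qed

text \<open>Testing with cutoffs shows that the integral of \<open>h\<close> over every box inside \<open>A\<close> vanishes. By Lebesgue's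
  differentiation theorem \<open>h\<close> is almost everywhere the limit of its averages over small boxes.\<close>

lemma fundamental_lemma:
  fixes h :: "real^'n::finite \<Rightarrow> real"
  assumes A: "open A"
    and int: "\<And>K. compact K \<Longrightarrow> K \<subseteq> A \<Longrightarrow> set_integrable lebesgue K h"
    and zero: "\<And>\<phi>. test_function A \<phi> \<Longrightarrow> (LINT x|lebesgue. h x * \<phi> x) = 0"
  shows "AE x in lebesgue. x \<in> A \<longrightarrow> h x = 0"
proof -
  have box0: "integral (cbox a b) h = 0" if ab: "cbox a b \<subseteq> A" for a b
  proof -
    have i: "set_integrable lebesgue (cbox a b) h" using int ab by auto
    have hm: "(\<lambda>x. indicator (cbox a b) x * h x) \<in> borel_measurable lebesgue"
      using i by (auto simp: set_integrable_def)
    have cm: "cutoff (real m) a b \<in> borel_measurable lebesgue" for m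
      using borel_measurable_continuous_onI[OF smooth_continuous[OF smooth_cutoff]]
      by (intro measurable_completion) auto
    have eq: "h x * cutoff (real m) a b x = indicator (cbox a b) x * h x * cutoff (real m) a b x" for m x
      using cutoff_outside[of x a b] box_subset_cbox[of a b] by (auto simp: indicator_def)
    have "(\<lambda>m. LINT x|lebesgue. h x * cutoff (real m) a b x) \<longlonglongrightarrow> (LINT x|lebesgue. indicator (box a b) x * h x)"
    proof (rule integral_dominated_convergence[where w = "\<lambda>x. \<bar>indicator (cbox a b) x * h x\<bar>"])
      show "integrable lebesgue (\<lambda>x. \<bar>indicator (cbox a b) x * h x\<bar>)"
        using i by (auto simp: set_integrable_def)
      show "AE x in lebesgue. (\<lambda>m. h x * cutoff (real m) a b x) \<longlonglongrightarrow> indicator (box a b) x * h x"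
        by (intro AE_I2, subst (2) mult.commute) (auto intro!: tendsto_mult cutoff_tendsto simp: mult.commute[of "h _"])
      show "AE x in lebesgue. norm (h x * cutoff (real m) a b x) \<le> \<bar>indicator (cbox a b) x * h x\<bar>" for m
        unfolding eq using cutoff_bounds[of "real m" a b]
        by (auto simp: abs_mult intro!: mult_left_le AE_I2)
      show "(\<lambda>x. h x * cutoff (real m) a b x) \<in> borel_measurable lebesgue" for m
        unfolding eq using hm cm by measurable
      have "(\<lambda>x. indicator (box a b) x * (indicator (cbox a b) x * h x)) \<in> borel_measurable lebesgue"
        by (intro borel_measurable_times hm borel_measurable_indicator) auto
      moreover have "(\<lambda>x. indicator (box a b) x * (indicator (cbox a b) x * h x)) = (\<lambda>x. indicator (box a b) x * h x)"
        using box_subset_cbox[of a b] by (intro ext) (auto simp: indicator_def)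
      ultimately show "(\<lambda>x. indicator (box a b) x * h x) \<in> borel_measurable lebesgue" by simp
    qed
    moreover have "(LINT x|lebesgue. h x * cutoff (real m) a b x) = 0" for m
      using zero[OF test_function_cutoff[OF ab]] .
    ultimately have "(LINT x|lebesgue. indicator (box a b) x * h x) = 0"
      by (simp add: LIMSEQ_const_iff)
    moreover have "set_integrable lebesgue (box a b) h"
      using i by (rule set_integrable_subset) (auto simp: box_subset_cbox)
    ultimately have "integral (box a b) h = 0"
      using set_lebesgue_integral_eq_integral(2)[of "box a b" h] by (simp add: set_lebesgue_integral_def)
    then show ?thesis by (simp add: integral_open_interval)
  qed
  have loc: "AE x in lebesgue. x \<in> box c d \<longrightarrow> h x = 0" if cd: "cbox c d \<subseteq> A" for c d
  proof -
    let ?h = "\<lambda>x. indicator (cbox c d) x * h x"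
    have "integrable lebesgue ?h" using int[OF compact_cbox cd] by (simp add: set_integrable_def)
    then have "?h integrable_on UNIV"
      using set_lebesgue_integral_eq_integral(1)[of UNIV ?h] by (simp add: set_integrable_def)
    then have "?h integrable_on cbox a b" for a b
      using integrable_on_subcbox by blast
    from integrable_ccontinuous_explicit[OF this] obtain N where N: "negligible N"
      "\<And>x e. \<lbrakk>x \<notin> N; 0 < e\<rbrakk> \<Longrightarrow> \<exists>r>0. \<forall>t. 0 < t \<and> t < r \<longrightarrow>
         norm (integral (cbox x (x + t *\<^sub>R One)) ?h /\<^sub>R t ^ DIM(real^'n) - ?h x) < e"
      by blast
    have "h x = 0" if x: "x \<in> box c d" "x \<notin> N" for x
    proof (rule ccontr)
      assume "h x \<noteq> 0"
      then obtain r where r: "r > 0" "\<And>t. 0 < t \<Longrightarrow> t < r \<Longrightarrow>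
         norm (integral (cbox x (x + t *\<^sub>R One)) ?h /\<^sub>R t ^ DIM(real^'n) - ?h x) < \<bar>h x\<bar>"
        using N(2)[OF x(2), of "\<bar>h x\<bar>"] by auto
      obtain e where e: "e > 0" "cball x e \<subseteq> box c d"
        using x(1) open_box open_contains_cball by blast
      define t where "t = min (r / 2) (e / (norm (One :: real^'n) + 1))"
      have t: "0 < t" "t < r" using r(1) e(1) by (auto simp: t_def add_nonneg_pos)
      have corner: "x + t *\<^sub>R One \<in> cball x e"
      proof -
        have "t * norm (One :: real^'n) \<le> t * (norm (One :: real^'n) + 1)" using t by simp
        also have "\<dots> \<le> e / (norm (One :: real^'n) + 1) * (norm (One :: real^'n) + 1)"
          by (intro mult_right_mono) (auto simp: t_def)
        also have "\<dots> = e" by (simp add: add_nonneg_eq_0_iff)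
        finally show ?thesis using t by (simp add: dist_norm)
      qed
      have sub: "cbox x (x + t *\<^sub>R One) \<subseteq> cbox c d"
      proof
        fix y assume "y \<in> cbox x (x + t *\<^sub>R One)"
        moreover have "x \<in> cbox c d" "x + t *\<^sub>R One \<in> cbox c d"
          using e(2) x(1) box_subset_cbox[of c d] corner by auto
        ultimately show "y \<in> cbox c d" unfolding mem_box_cart by (meson order_trans)
      qed
      have "integral (cbox x (x + t *\<^sub>R One)) ?h = integral (cbox x (x + t *\<^sub>R One)) h"
        using sub by (intro integral_cong) (auto simp: indicator_def)
      also have "\<dots> = 0" using sub cd by (intro box0) auto
      finally show False using r(2)[OF t] x(1) box_subset_cbox[of c d] by (auto simp: indicator_def split: if_splits)
    qed
    then have "negligible {x \<in> box c d. h x \<noteq> 0}" using N(1) by (auto intro: negligible_subset)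
    then have "{x \<in> box c d. h x \<noteq> 0} \<in> null_sets lebesgue" by (simp add: negligible_iff_null_sets)
    then show ?thesis by (rule AE_I') auto
  qed
  \<comment> \<open>Countably many boxes cover \<open>A\<close>, and their faces are null sets.\<close>
  obtain D where D: "countable D" "D \<subseteq> Pow A" "\<And>X. X \<in> D \<Longrightarrow> \<exists>a b. X = cbox a b" "\<Union>D = A"
    using open_countable_Union_open_cbox[OF A] by metis
  have "AE x in lebesgue. x \<in> X \<longrightarrow> h x = 0" if XD: "X \<in> D" for X
  proof -
    obtain c d where X: "X = cbox c d" using D(3) XD by blast
    have "AE x in lebesgue. x \<notin> cbox c d - box c d"
      using negligible_frontier_interval[of c d] unfolding negligible_iff_null_sets by (rule AE_not_in)
    moreover have "cbox c d \<subseteq> A" using XD D(2) X by auto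
    ultimately show ?thesis using loc[of c d] X by (auto elim: eventually_elim2)
  qed
  then have "AE x in lebesgue. \<forall>X\<in>D. x \<in> X \<longrightarrow> h x = 0"
    using D(1) by (subst AE_ball_countable) auto
  then show ?thesis using D(4) by (auto elim!: eventually_mono)
qed

section \<open>Integration by parts\<close>

lemma smooth_measurable [measurable]: "smooth f \<Longrightarrow> f \<in> borel_measurable borel"
  by (intro borel_measurable_continuous_onI smooth_continuous)

lemma test_function_mono: "test_function A \<phi> \<Longrightarrow> A \<subseteq> B \<Longrightarrow> test_function B \<phi>"
  by (auto simp: test_function_def)

lemma test_function_outside: "test_function A \<phi> \<Longrightarrow> x \<notin> A \<Longrightarrow> \<phi> x = 0"
  by (metis test_functionE subsetD)

lemma test_function_mult: "smooth s \<Longrightarrow> test_function A \<phi> \<Longrightarrow> test_function A (\<lambda>x. s x * \<phi> x)"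
  by (frule test_function_smooth, erule test_functionE, rule test_functionI) (auto intro: smooth_mult)

lemma test_function_partial:
  assumes "test_function A \<phi>" shows "test_function A (partial i \<phi>)"
proof -
  obtain K where K: "compact K" "K \<subseteq> A" "\<And>x. x \<notin> K \<Longrightarrow> \<phi> x = 0" using assms test_functionE by metis
  have "partial i \<phi> x = 0" if "x \<notin> K" for x
  proof -
    have "((\<lambda>_. 0) has_derivative (\<lambda>_. 0 :: real)) (at x)" by simp
    then have "(\<phi> has_derivative (\<lambda>_. 0)) (at x)"
      by (rule has_derivative_transform_within_open[of _ _ _ _ "- K"])
        (use K that in \<open>auto simp: compact_imp_closed open_Compl\<close>)
    from partial_eqI(1)[OF this] show ?thesis by simp
  qed
  then show ?thesis
    using test_functionI[OF smooth_partial[OF test_function_smooth[OF assms]] K(1,2)] by blast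
qed

lemma test_function_translate:
  assumes "test_function A \<phi>" shows "test_function ((\<lambda>x. x + a) ` A) (\<lambda>x. \<phi> (x - a))"
proof -
  obtain K where K: "compact K" "K \<subseteq> A" "\<And>x. x \<notin> K \<Longrightarrow> \<phi> x = 0" using assms test_functionE by metis
  have "smooth (\<lambda>x. \<phi> (x + - a))" by (intro smooth_translate test_function_smooth[OF assms])
  moreover have "\<phi> (x - a) = 0" if "x \<notin> (\<lambda>x. x + a) ` K" for x
    using that by (intro K(3)) (metis diff_add_cancel image_eqI)
  moreover have "compact ((\<lambda>x. x + a) ` K)" by (intro compact_continuous_image continuous_intros K)
  ultimately show ?thesis
    using test_functionI[OF _ _ image_mono[OF K(2)], of "\<lambda>x. \<phi> (x - a)" "\<lambda>x. x + a"] by simp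
qed

lemma test_function_integrable: assumes "test_function A \<phi>" shows "integrable lborel \<phi>"
proof -
  obtain K where K: "compact K" "K \<subseteq> A" "\<And>x. x \<notin> K \<Longrightarrow> \<phi> x = 0" using assms test_functionE by metis
  have "integrable lborel (\<lambda>x. indicator K x *\<^sub>R \<phi> x)"
    using K by (intro borel_integrable_compact smooth_continuous test_function_smooth[OF assms])
  moreover have "(\<lambda>x. indicator K x *\<^sub>R \<phi> x) = \<phi>" using K(3) by (intro ext) (auto simp: indicator_def)
  ultimately show ?thesis by simp
qed

lemma lborel_integral_translate:
  fixes f :: "'a::euclidean_space \<Rightarrow> real"
  assumes [measurable]: "f \<in> borel_measurable borel"
  shows "(LINT x|lborel. f (x + a)) = (LINT x|lborel. f x)"
  by (subst (2) lborel_distr_plus[of a, symmetric], subst integral_distr) (auto simp: add.commute)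

lemma lborel_nn_integral_translate:
  fixes f :: "'a::euclidean_space \<Rightarrow> ennreal"
  assumes [measurable]: "f \<in> borel_measurable borel"
  shows "(\<integral>\<^sup>+x. f (x + a) \<partial>lborel) = (\<integral>\<^sup>+x. f x \<partial>lborel)"
  by (subst (2) lborel_distr_plus[of a, symmetric], subst nn_integral_distr) (auto simp: add.commute)

lemma lborel_integrable_translate:
  fixes f :: "'a::euclidean_space \<Rightarrow> real"
  assumes "integrable lborel f"
  shows "integrable lborel (\<lambda>x. f (x + a))"
proof -
  have [measurable]: "f \<in> borel_measurable borel" using assms by simp
  have "integrable (distr lborel borel ((+) a)) f" using assms by (simp add: lborel_distr_plus)
  then show ?thesis by (subst (asm) integrable_distr_eq) (auto simp: add.commute)
qed

text \<open>The integral of \<open>x \<mapsto> \<phi> (x + t e)\<close> does not depend on \<open>t\<close>, so its difference quotients,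
  which converge to the integral of the partial derivative, all vanish.\<close>

lemma integral_partial_test_function:
  fixes \<phi> :: "real^'n::finite \<Rightarrow> real"
  assumes \<phi>: "test_function A \<phi>"
  shows "(LINT x|lborel. partial i \<phi> x) = 0"
proof -
  let ?e = "axis i 1 :: real^'n"
  note sm = test_function_smooth[OF \<phi>]
  have [measurable]: "\<phi> \<in> borel_measurable borel" "partial i \<phi> \<in> borel_measurable borel"
    using sm smooth_partial by measurable
  obtain K where K: "compact K" "\<And>x. x \<notin> K \<Longrightarrow> \<phi> x = 0" using \<phi> test_functionE by metis
  obtain R where R: "\<And>x. x \<in> K \<Longrightarrow> norm x \<le> R" using compact_imp_bounded[OF K(1)] bounded_iff by metis
  obtain B where B: "\<And>x. \<bar>partial i \<phi> x\<bar> \<le> B"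
    using test_function_bounded[OF test_function_partial[OF \<phi>]] by metis
  define t where "t = (\<lambda>m. 1 / real (Suc m))"
  have t: "t m > 0" "t m \<le> 1" for m by (auto simp: t_def)
  define q where "q = (\<lambda>m x. (\<phi> (x + t m *\<^sub>R ?e) - \<phi> x) / t m)"
  have "(\<lambda>m. LINT x|lborel. q m x) \<longlonglongrightarrow> (LINT x|lborel. partial i \<phi> x)"
  proof (rule integral_dominated_convergence[where w = "\<lambda>x. indicator (cball 0 (R + 1)) x * B"])
    show "integrable lborel (\<lambda>x::real^'n. indicator (cball 0 (R + 1)) x * B)"
      using borel_integrable_compact[of "cball (0::real^'n) (R + 1)" "\<lambda>_. B"] by simp
    show "AE x in lborel. (\<lambda>m. q m x) \<longlonglongrightarrow> partial i \<phi> x"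
    proof (rule AE_I2)
      fix x
      have "((\<lambda>t. (\<phi> (x + t *\<^sub>R ?e) - \<phi> x) / t) \<longlongrightarrow> partial i \<phi> x) (at 0)"
        using DERIV_along_axis[OF sm, of x i 0] by (simp add: DERIV_def)
      moreover have "filterlim t (at 0) sequentially"
        unfolding t_def filterlim_at by (use LIMSEQ_Suc[OF lim_1_over_n] in auto)
      ultimately show "(\<lambda>m. q m x) \<longlonglongrightarrow> partial i \<phi> x"
        unfolding q_def by (rule filterlim_compose)
    qed
    show "AE x in lborel. norm (q m x) \<le> indicator (cball 0 (R + 1)) x * B" for m
    proof (rule AE_I2)
      fix x
      show "norm (q m x) \<le> indicator (cball 0 (R + 1)) x * B"
      proof (cases "x \<in> cball 0 (R + 1)")
        case True
        obtain s where "\<phi> (x + t m *\<^sub>R ?e) - \<phi> (x + 0 *\<^sub>R ?e) = (t m - 0) * partial i \<phi> (x + s *\<^sub>R ?e)"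
          using MVT2[OF t(1), OF DERIV_along_axis[OF sm]] by blast
        then have "q m x = partial i \<phi> (x + s *\<^sub>R ?e)" using t(1)[of m] by (simp add: q_def)
        then show ?thesis using B True by simp
      next
        case False
        then have "x \<notin> K" using R by force
        moreover have "x + t m *\<^sub>R ?e \<notin> K"
        proof
          assume "x + t m *\<^sub>R ?e \<in> K"
          then have "norm (x + t m *\<^sub>R ?e) \<le> R" by (rule R)
          moreover have "norm (t m *\<^sub>R ?e) \<le> 1" using t[of m] by simp
          ultimately have "norm x \<le> R + 1"
            using norm_triangle_ineq4[of "x + t m *\<^sub>R ?e" "t m *\<^sub>R ?e"] by simp
          then show False using False by simp
        qed
        ultimately show ?thesis using K(2) False by (simp add: q_def)
      qed
    qed
  qed (auto simp: q_def)
  moreover have "(LINT x|lborel. q m x) = 0" for m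
    using lborel_integral_translate[of \<phi> "t m *\<^sub>R ?e"] test_function_integrable[OF \<phi>]
    by (simp add: q_def lborel_integrable_translate)
  ultimately show ?thesis by (simp add: LIMSEQ_const_iff)
qed

lemma integral_partial_by_parts:
  assumes s: "smooth s" and \<phi>: "test_function A \<phi>"
  shows "(LINT x|lborel. s x * partial i \<phi> x) = - (LINT x|lborel. partial i s x * \<phi> x)"
proof -
  have "integrable lborel (\<lambda>x. s x * partial i \<phi> x)" "integrable lborel (\<lambda>x. partial i s x * \<phi> x)"
    using test_function_integrable[OF test_function_mult[OF s test_function_partial[OF \<phi>]]]
      test_function_integrable[OF test_function_mult[OF smooth_partial[OF s] \<phi>]] by auto
  moreover have "(LINT x|lborel. partial i s x * \<phi> x + s x * partial i \<phi> x) = 0"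
    using integral_partial_test_function[OF test_function_mult[OF s \<phi>], of i]
      partial_mult[OF smooth_differentiable[OF s] smooth_differentiable[OF test_function_smooth[OF \<phi>]]]
    by simp
  ultimately show ?thesis by simp
qed

section \<open>Higher derivatives\<close>

definition unit_index :: "'n \<Rightarrow> 'n \<Rightarrow> nat" where
  "unit_index i = (\<lambda>_. 0)(i := 1)"

lemma coord_list: "distinct (coord_list :: 'n::finite list)" "set (coord_list :: 'n list) = UNIV"
proof -
  have "\<exists>is. distinct is \<and> set is = (UNIV :: 'n set)"
    using finite_distinct_list[of "UNIV :: 'n set"] by auto
  from someI_ex[OF this] show "distinct (coord_list :: 'n::finite list)" "set (coord_list :: 'n list) = UNIV"
    unfolding coord_list_def by auto
qed

lemma smooth_partial_funpow: "smooth f \<Longrightarrow> smooth ((partial i ^^ k) f)"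
  by (induction k) (auto intro: smooth_partial)

lemma partial_funpow_commute:
  "smooth f \<Longrightarrow> partial i ((partial j ^^ k) f) = (partial j ^^ k) (partial i f)"
proof (induction k)
  case (Suc k)
  then show ?case using partial_commute[OF smooth_partial_funpow[of f k j], of i j] by simp
qed simp

lemma smooth_foldr_partial: "smooth f \<Longrightarrow> smooth (foldr (\<lambda>i. partial i ^^ \<alpha> i) is f)"
  by (induction "is") (auto intro: smooth_partial_funpow)

lemma smooth_mi_partial: "smooth f \<Longrightarrow> smooth (mi_partial \<alpha> f)"
  unfolding mi_partial_def by (rule smooth_foldr_partial)

lemma test_function_mi_partial:
  assumes "test_function A \<phi>" shows "test_function A (mi_partial \<alpha> \<phi>)"
proof -
  have pow: "test_function A ((partial i ^^ k) \<psi>)" if "test_function A \<psi>" for i k \<psi>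
    using that by (induction k) (auto intro: test_function_partial)
  have "test_function A (foldr (\<lambda>i. partial i ^^ \<alpha> i) is \<phi>)" for "is"
    using assms by (induction "is") (auto intro: pow)
  then show ?thesis by (simp add: mi_partial_def)
qed

lemma mi_partial_partial: "smooth f \<Longrightarrow> mi_partial \<alpha> (partial i f) = partial i (mi_partial \<alpha> f)"
proof -
  assume f: "smooth f"
  have "foldr (\<lambda>i. partial i ^^ \<alpha> i) is (partial i f) = partial i (foldr (\<lambda>i. partial i ^^ \<alpha> i) is f)" for "is"
    by (induction "is") (auto simp: partial_funpow_commute smooth_foldr_partial f)
  then show ?thesis by (simp add: mi_partial_def)
qed

lemma mi_partial_zero: "mi_partial (\<lambda>_. 0) f = f"
proof -
  have "foldr (\<lambda>i. partial i ^^ 0) is f = f" for "is" by (induction "is") auto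
  then show ?thesis unfolding mi_partial_def by simp
qed

text \<open>The additional derivative may be taken first, whatever its place in the fixed enumeration of the
  coordinates, because partial derivatives of smooth functions commute.\<close>

lemma mi_partial_Suc:
  assumes f: "smooth f"
  shows "mi_partial (\<alpha>(i := Suc (\<alpha> i))) f = mi_partial \<alpha> (partial i f)"
proof -
  have "foldr (\<lambda>j. partial j ^^ (\<alpha>(i := Suc (\<alpha> i))) j) is f =
      (if i \<in> set is then partial i (foldr (\<lambda>j. partial j ^^ \<alpha> j) is f) else foldr (\<lambda>j. partial j ^^ \<alpha> j) is f)"
    if "distinct is" for "is"
    using that
    by (induction "is") (auto simp: partial_funpow_commute smooth_foldr_partial f)
  from this[OF coord_list(1)] show ?thesis
    unfolding mi_partial_partial[OF f] unfolding mi_partial_def by (simp add: coord_list)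
qed

lemma mi_length_Suc: "mi_length (\<alpha>(i := Suc (\<alpha> i))) = Suc (mi_length \<alpha>)"
  unfolding mi_length_def by (subst (1 2) sum.remove[of _ i]) auto

lemma mi_length_eq_0: "mi_length \<alpha> = 0 \<longleftrightarrow> \<alpha> = (\<lambda>_. 0)"
  by (auto simp: mi_length_def)

lemma mi_length_eq_Suc:
  assumes "mi_length \<alpha> = Suc k"
  obtains \<beta> i where "\<alpha> = \<beta>(i := Suc (\<beta> i))" "mi_length \<beta> = k"
proof -
  obtain i where "\<alpha> i \<noteq> 0" using assms by (metis mi_length_eq_0 nat.distinct(1) ext)
  define \<beta> where "\<beta> = \<alpha>(i := \<alpha> i - 1)"
  have \<alpha>: "\<alpha> = \<beta>(i := Suc (\<beta> i))" using \<open>\<alpha> i \<noteq> 0\<close> by (auto simp: \<beta>_def fun_eq_iff)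
  have "Suc (mi_length \<beta>) = Suc k" using assms unfolding \<alpha> mi_length_Suc .
  then show ?thesis using that[OF \<alpha>] by simp
qed

lemma mi_induct [case_names zero Suc]:
  fixes \<alpha> :: "'n::finite \<Rightarrow> nat"
  assumes "P (\<lambda>_. 0)" "\<And>\<alpha> i. P \<alpha> \<Longrightarrow> P (\<alpha>(i := Suc (\<alpha> i)))"
  shows "P \<alpha>"
proof (induction "mi_length \<alpha>" arbitrary: \<alpha>)
  case 0
  then have "\<alpha> = (\<lambda>_. 0)" using mi_length_eq_0[of \<alpha>] by simp
  then show ?case using assms(1) by simp
next
  case (Suc k)
  obtain \<beta> i where "\<alpha> = \<beta>(i := Suc (\<beta> i))" "mi_length \<beta> = k"
    using mi_length_eq_Suc[OF Suc.hyps(2)[symmetric]] by blast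
  then show ?case using assms(2)[OF Suc.hyps(1)[of \<beta>], of i] by simp
qed

lemma unit_index_Suc: "unit_index i = (\<lambda>_. 0)(i := Suc ((\<lambda>_. 0) i))"
  by (simp add: unit_index_def)

lemma mi_length_unit_index: "mi_length (unit_index i) = 1"
  unfolding unit_index_Suc mi_length_Suc by (simp add: mi_length_def)

lemma mi_partial_unit_index: "smooth f \<Longrightarrow> mi_partial (unit_index i) f = partial i f"
  using mi_partial_Suc[of f "\<lambda>_. 0" i] by (simp add: unit_index_def mi_partial_zero)

lemma integral_mi_partial_by_parts:
  assumes s: "smooth s" and \<phi>: "test_function A \<phi>"
  shows "(LINT x|lborel. s x * mi_partial \<alpha> \<phi> x) = (- 1) ^ mi_length \<alpha> * (LINT x|lborel. mi_partial \<alpha> s x * \<phi> x)"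
  using \<phi>
proof (induction \<alpha> arbitrary: \<phi> rule: mi_induct)
  case zero
  then show ?case by (simp add: mi_partial_zero mi_length_eq_0[THEN iffD2])
next
  case (Suc \<alpha> i)
  have "(LINT x|lborel. s x * mi_partial (\<alpha>(i := Suc (\<alpha> i))) \<phi> x)
      = (- 1) ^ mi_length \<alpha> * (LINT x|lborel. mi_partial \<alpha> s x * partial i \<phi> x)"
    using Suc.IH[OF test_function_partial[OF Suc.prems]]
    by (simp only: mi_partial_Suc[OF test_function_smooth[OF Suc.prems]])
  also have "\<dots> = (- 1) ^ Suc (mi_length \<alpha>) * (LINT x|lborel. partial i (mi_partial \<alpha> s) x * \<phi> x)"
    by (simp add: integral_partial_by_parts[OF smooth_mi_partial[OF s] Suc.prems])
  finally show ?case by (simp only: mi_length_Suc mi_partial_Suc[OF s] mi_partial_partial[OF s])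
qed

section \<open>Weak derivatives\<close>

lemma sets_lebesgue_open: "open \<Omega> \<Longrightarrow> \<Omega> \<inter> space lebesgue \<in> sets lebesgue"
  by (simp add: lmeasurable_iff_integrable borel_open)

lemma integral_lebesgue_on_test:
  assumes "open \<Omega>" "test_function \<Omega> \<phi>"
  shows "(LINT x|lebesgue_on \<Omega>. u x * \<phi> x) = (LINT x|lebesgue. u x * \<phi> x)"
proof -
  have "indicator \<Omega> x *\<^sub>R (u x * \<phi> x) = u x * \<phi> x" for x
    using test_function_outside[OF assms(2), of x] by (auto simp: indicator_def)
  then show ?thesis by (subst integral_restrict_space[OF sets_lebesgue_open[OF assms(1)]]) (simp only:)
qed

lemma locally_integrable_iff:
  "locally_integrable \<Omega> u \<longleftrightarrow> (\<forall>K. compact K \<and> K \<subseteq> \<Omega> \<longrightarrow> set_integrable lebesgue K u)"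
  unfolding locally_integrable_def set_integrable_def
  by (intro iff_allI imp_cong refl integrable_restrict_space)
    (auto intro!: borel_compact)

lemma integrable_mult_test:
  assumes "locally_integrable \<Omega> u" "test_function \<Omega> \<phi>"
  shows "integrable lebesgue (\<lambda>x. u x * \<phi> x)"
proof -
  obtain K where K: "compact K" "K \<subseteq> \<Omega>" "\<And>x. x \<notin> K \<Longrightarrow> \<phi> x = 0" using assms test_functionE by metis
  obtain B where B: "\<And>x. \<bar>\<phi> x\<bar> \<le> B" using test_function_bounded[OF assms(2)] by metis
  have i: "integrable lebesgue (\<lambda>x. indicator K x * u x)"
    using assms(1) K unfolding locally_integrable_iff set_integrable_def by auto
  have eq: "u x * \<phi> x = indicator K x * u x * \<phi> x" for x using K(3)[of x] by (auto simp: indicator_def)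
  have "\<phi> \<in> borel_measurable lebesgue"
    by (intro measurable_completion) (simp add: smooth_measurable test_function_smooth[OF assms(2)])
  then have m: "(\<lambda>x. u x * \<phi> x) \<in> borel_measurable lebesgue"
    unfolding eq using borel_measurable_integrable[OF i] by (rule borel_measurable_times[rotated])
  show ?thesis
  proof (rule Bochner_Integration.integrable_bound[OF integrable_mult_right[OF i, of B] m])
    show "AE x in lebesgue. norm (u x * \<phi> x) \<le> norm (B * (indicator K x * u x))"
    proof (rule AE_I2)
      fix x
      have "\<bar>u x * indicator K x\<bar> * \<bar>\<phi> x\<bar> \<le> \<bar>u x * indicator K x\<bar> * B" by (intro mult_left_mono B) auto
      moreover have "0 \<le> B" using B[of x] by linarith
      ultimately show "norm (u x * \<phi> x) \<le> norm (B * (indicator K x * u x))"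
        unfolding eq by (simp add: abs_mult mult_ac)
    qed
  qed
qed

lemma has_weak_deriv_alt:
  assumes "open \<Omega>"
  shows "has_weak_deriv \<Omega> \<alpha> u w \<longleftrightarrow> locally_integrable \<Omega> u \<and> locally_integrable \<Omega> w \<and>
     (\<forall>\<phi>. test_function \<Omega> \<phi> \<longrightarrow>
        (LINT x|lebesgue. u x * mi_partial \<alpha> \<phi> x) = (-1) ^ mi_length \<alpha> * (LINT x|lebesgue. w x * \<phi> x))"
proof -
  have "(LINT x|lebesgue_on \<Omega>. u x * mi_partial \<alpha> \<phi> x) = (LINT x|lebesgue. u x * mi_partial \<alpha> \<phi> x)"
    "(LINT x|lebesgue_on \<Omega>. w x * \<phi> x) = (LINT x|lebesgue. w x * \<phi> x)" if "test_function \<Omega> \<phi>" for \<phi>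
    using integral_lebesgue_on_test[OF assms] test_function_mi_partial that by blast+
  then show ?thesis unfolding has_weak_deriv_def by simp
qed

lemma AE_lebesgue_on_iff:
  "open \<Omega> \<Longrightarrow> (AE x in lebesgue_on \<Omega>. P x) \<longleftrightarrow> (AE x in lebesgue. x \<in> \<Omega> \<longrightarrow> P x)"
  by (rule AE_restrict_space_iff) (rule sets_lebesgue_open)

lemma locally_integrable_add:
  "locally_integrable \<Omega> u \<Longrightarrow> locally_integrable \<Omega> v \<Longrightarrow> locally_integrable \<Omega> (\<lambda>x. u x + v x)"
  by (auto simp: locally_integrable_def)

lemma locally_integrable_cmult: "locally_integrable \<Omega> u \<Longrightarrow> locally_integrable \<Omega> (\<lambda>x. c * u x)"
  by (auto simp: locally_integrable_def)

lemma locally_integrable_continuous: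
  assumes "continuous_on UNIV u" shows "locally_integrable \<Omega> u"
  unfolding locally_integrable_iff set_integrable_def
proof (intro allI impI)
  fix K assume "compact K \<and> K \<subseteq> \<Omega>"
  then have "integrable lborel (\<lambda>x. indicator K x *\<^sub>R u x)"
    using assms by (intro borel_integrable_compact) (auto intro: continuous_on_subset)
  then show "integrable lebesgue (\<lambda>x. indicator K x *\<^sub>R u x)"
    by (subst integrable_completion) auto
qed

lemma has_weak_deriv_add:
  assumes \<Omega>: "open \<Omega>" and "has_weak_deriv \<Omega> \<alpha> u w" "has_weak_deriv \<Omega> \<alpha> u' w'"
  shows "has_weak_deriv \<Omega> \<alpha> (\<lambda>x. u x + u' x) (\<lambda>x. w x + w' x)"
  using assms(2,3) unfolding has_weak_deriv_alt[OF \<Omega>]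
  by (auto intro!: locally_integrable_add simp: distrib_right integrable_mult_test test_function_mi_partial distrib_left)

lemma has_weak_deriv_cmult:
  assumes \<Omega>: "open \<Omega>" and "has_weak_deriv \<Omega> \<alpha> u w"
  shows "has_weak_deriv \<Omega> \<alpha> (\<lambda>x. c * u x) (\<lambda>x. c * w x)"
  using assms(2) unfolding has_weak_deriv_alt[OF \<Omega>]
  by (auto intro!: locally_integrable_cmult simp: mult.assoc)

lemma has_weak_deriv_smooth:
  assumes "open \<Omega>" "smooth s"
  shows "has_weak_deriv \<Omega> \<alpha> s (mi_partial \<alpha> s)"
proof -
  have "(LINT x|lebesgue. s x * mi_partial \<alpha> \<phi> x) = (LINT x|lborel. s x * mi_partial \<alpha> \<phi> x)"
    "(LINT x|lebesgue. mi_partial \<alpha> s x * \<phi> x) = (LINT x|lborel. mi_partial \<alpha> s x * \<phi> x)"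
    if "test_function \<Omega> \<phi>" for \<phi>
    using smooth_measurable[OF smooth_mult[OF assms(2) smooth_mi_partial[OF test_function_smooth[OF that]]]]
      smooth_measurable[OF smooth_mult[OF smooth_mi_partial[OF assms(2)] test_function_smooth[OF that]]]
    by (auto intro!: integral_completion)
  then show ?thesis
    unfolding has_weak_deriv_alt[OF assms(1)]
    using integral_mi_partial_by_parts[OF assms(2)]
    by (auto intro!: locally_integrable_continuous smooth_continuous smooth_mi_partial assms)
qed

text \<open>Allowing two functions that agree almost everywhere gives at the same time uniqueness of the weak
  derivative and its independence of the representative.\<close>

lemma has_weak_deriv_unique:
  assumes \<Omega>: "open \<Omega>" and u: "has_weak_deriv \<Omega> \<alpha> u w" and v: "has_weak_deriv \<Omega> \<alpha> v w'"
    and uv: "AE x in lebesgue_on \<Omega>. u x = v x"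
  shows "AE x in lebesgue_on \<Omega>. w x = w' x"
proof -
  note u' = u[unfolded has_weak_deriv_alt[OF \<Omega>]] and v' = v[unfolded has_weak_deriv_alt[OF \<Omega>]]
  have loc: "locally_integrable \<Omega> (\<lambda>x. w x - w' x)"
    using locally_integrable_add[of \<Omega> w "\<lambda>x. (- 1) * w' x"] locally_integrable_cmult[of \<Omega> w' "- 1"] u' v' by simp
  have "AE x in lebesgue. x \<in> \<Omega> \<longrightarrow> w x - w' x = 0"
  proof (rule fundamental_lemma[OF \<Omega>])
    show "set_integrable lebesgue K (\<lambda>x. w x - w' x)" if "compact K" "K \<subseteq> \<Omega>" for K
      using loc that by (simp add: locally_integrable_iff)
    fix \<phi> assume \<phi>: "test_function \<Omega> \<phi>"
    note \<phi>' = test_function_mi_partial[OF \<phi>, of \<alpha>]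
    have "AE x in lebesgue. u x * mi_partial \<alpha> \<phi> x = v x * mi_partial \<alpha> \<phi> x"
      using uv unfolding AE_lebesgue_on_iff[OF \<Omega>]
      by eventually_elim (use test_function_outside[OF \<phi>'] in auto)
    then have "(LINT x|lebesgue. u x * mi_partial \<alpha> \<phi> x) = (LINT x|lebesgue. v x * mi_partial \<alpha> \<phi> x)"
      using integrable_mult_test[OF _ \<phi>', of u] integrable_mult_test[OF _ \<phi>', of v] u' v'
      by (intro integral_cong_AE) auto
    then have "(LINT x|lebesgue. w x * \<phi> x) = (LINT x|lebesgue. w' x * \<phi> x)"
      using u' v' \<phi> by simp
    then show "(LINT x|lebesgue. (w x - w' x) * \<phi> x) = 0"
      using integrable_mult_test[OF _ \<phi>, of w] integrable_mult_test[OF _ \<phi>, of w'] u' v'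
      by (simp add: left_diff_distrib)
  qed
  then show ?thesis unfolding AE_lebesgue_on_iff[OF \<Omega>] by simp
qed

text \<open>The test functions \<open>\<partial>\<^sub>i \<phi>\<close> in the definition of the weak derivative of order \<open>\<alpha>\<close> show that higher weak
  derivatives are iterated ones. Hence every derivative of order at most \<open>k\<close> of a function in
  \<open>W\<^sup>k\<^sup>+\<^sup>1\<^sup>,\<^sup>p\<close> is a function in \<open>W\<^sup>1\<^sup>,\<^sup>p\<close>.\<close>

lemma has_weak_deriv_step:
  assumes \<Omega>: "open \<Omega>" and "has_weak_deriv \<Omega> \<alpha> u w" "has_weak_deriv \<Omega> (\<alpha>(i := Suc (\<alpha> i))) u w'"
  shows "has_weak_deriv \<Omega> (unit_index i) w w'"
  using assms(2,3) unfolding has_weak_deriv_alt[OF \<Omega>]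
proof (elim conjE, intro conjI allI impI)
  fix \<phi> assume \<phi>: "test_function \<Omega> \<phi>"
    and 1: "\<forall>\<phi>. test_function \<Omega> \<phi> \<longrightarrow>
        (LINT x|lebesgue. u x * mi_partial \<alpha> \<phi> x) = (-1) ^ mi_length \<alpha> * (LINT x|lebesgue. w x * \<phi> x)"
    and 2: "\<forall>\<phi>. test_function \<Omega> \<phi> \<longrightarrow>
        (LINT x|lebesgue. u x * mi_partial (\<alpha>(i := Suc (\<alpha> i))) \<phi> x)
        = (-1) ^ mi_length (\<alpha>(i := Suc (\<alpha> i))) * (LINT x|lebesgue. w' x * \<phi> x)"
  have "(-1) ^ mi_length \<alpha> * (LINT x|lebesgue. w x * partial i \<phi> x)
      = (LINT x|lebesgue. u x * mi_partial (\<alpha>(i := Suc (\<alpha> i))) \<phi> x)"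
    using 1 test_function_partial[OF \<phi>] mi_partial_Suc[OF test_function_smooth[OF \<phi>]] by simp
  also have "\<dots> = (-1) ^ mi_length \<alpha> * - (LINT x|lebesgue. w' x * \<phi> x)"
    using 2 \<phi> by (simp add: mi_length_Suc)
  finally have "(LINT x|lebesgue. w x * partial i \<phi> x) = - (LINT x|lebesgue. w' x * \<phi> x)"
    by (subst (asm) mult_cancel_left) simp
  then show "(LINT x|lebesgue. w x * mi_partial (unit_index i) \<phi> x)
      = (-1) ^ mi_length (unit_index i) * (LINT x|lebesgue. w' x * \<phi> x)"
    by (simp add: mi_partial_unit_index[OF test_function_smooth[OF \<phi>]] mi_length_unit_index)
qed auto

section \<open>Power means\<close>

lemma powr_convex_combination:
  fixes a b t p :: real
  assumes p: "1 \<le> p" and a: "0 \<le> a" and b: "0 \<le> b" and t: "0 < t" "t < 1"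
  shows "((1 - t) * a + t * b) powr p \<le> (1 - t) * a powr p + t * b powr p"
proof -
  \<comment> \<open>If \<open>a\<close> or \<open>b\<close> is \<open>0\<close>, what is left of the inequality is \<open>s powr p \<le> s\<close> for the remaining weight \<open>s\<close>.\<close>
  have shrink: "s powr p \<le> s" if "0 < s" "s < 1" for s :: real
    using powr_mono'[of 1 p s] p that by simp
  consider "a > 0" "b > 0" | "a = 0" | "b = 0" using a b by linarith
  then show ?thesis
  proof cases
    case 1
    then show ?thesis using convex_onD[OF powr_convex[OF p], of t a b] t by simp
  next
    case 2
    then show ?thesis using shrink[OF t] t b by (simp add: powr_mult mult_right_mono)
  next
    case 3
    then show ?thesis using shrink[of "1 - t"] t a by (simp add: powr_mult mult_right_mono)
  qed
qed

lemma abs_powr_convex: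
  assumes "1 \<le> p" shows "convex_on UNIV (\<lambda>x::real. \<bar>x\<bar> powr p)"
proof (rule convex_onI)
  fix t x y :: real assume t: "0 < t" "t < 1"
  have "\<bar>(1 - t) *\<^sub>R x + t *\<^sub>R y\<bar> \<le> (1 - t) * \<bar>x\<bar> + t * \<bar>y\<bar>"
    using abs_triangle_ineq[of "(1 - t) * x" "t * y"] t by (simp add: abs_mult)
  then have "\<bar>(1 - t) *\<^sub>R x + t *\<^sub>R y\<bar> powr p \<le> ((1 - t) * \<bar>x\<bar> + t * \<bar>y\<bar>) powr p"
    using assms by (intro powr_mono2) auto
  also have "\<dots> \<le> (1 - t) * \<bar>x\<bar> powr p + t * \<bar>y\<bar> powr p"
    using powr_convex_combination[OF assms _ _ t] by simp
  finally show "\<bar>(1 - t) *\<^sub>R x + t *\<^sub>R y\<bar> powr p \<le> (1 - t) * \<bar>x\<bar> powr p + t * \<bar>y\<bar> powr p" .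
qed simp

text \<open>Jensen's inequality. If \<open>X\<close> is not integrable, the left-hand side is \<open>0\<close>; if only \<open>\<bar>X\<bar>\<^sup>p\<close> is not, the right-hand
  side is infinite.\<close>

lemma (in prob_space) powr_expectation_le:
  assumes p: "1 \<le> p" and [measurable]: "X \<in> borel_measurable M"
  shows "ennreal (\<bar>expectation X\<bar> powr p) \<le> (\<integral>\<^sup>+x. ennreal (\<bar>X x\<bar> powr p) \<partial>M)"
proof (cases "integrable M X \<and> integrable M (\<lambda>x. \<bar>X x\<bar> powr p)")
  case True
  then have "\<bar>expectation X\<bar> powr p \<le> expectation (\<lambda>x. \<bar>X x\<bar> powr p)"
    using abs_powr_convex[OF p] by (intro jensens_inequality[where I = UNIV]) auto
  then show ?thesis using True by (simp add: nn_integral_eq_integral)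
next
  case False
  show ?thesis
  proof (cases "integrable M X")
    case True
    then have "\<not> (\<integral>\<^sup>+x. ennreal (\<bar>X x\<bar> powr p) \<partial>M) < \<infinity>" using False by (auto intro: integrableI_nonneg)
    then show ?thesis by (simp add: not_less top_unique)
  qed (use p in \<open>simp add: not_integrable_integral_eq\<close>)
qed

lemma powr_sum_le:
  fixes a :: "'i \<Rightarrow> real"
  assumes "finite I" "\<And>i. i \<in> I \<Longrightarrow> 0 \<le> a i" "0 \<le> p"
  shows "(\<Sum>i\<in>I. a i) powr p \<le> real (card I) powr p * (\<Sum>i\<in>I. a i powr p)"
proof (cases "I = {}")
  case False
  then have "Max (a ` I) \<in> a ` I" using assms(1) by (intro Max_in) auto
  then obtain j where "j \<in> I" "Max (a ` I) = a j" by auto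
  then have j: "j \<in> I" "\<And>i. i \<in> I \<Longrightarrow> a i \<le> a j" using Max_ge[of "a ` I"] assms(1) by auto
  have "(\<Sum>i\<in>I. a i) \<le> real (card I) * a j" using sum_bounded_above[of I a "a j"] j(2) by simp
  then have "(\<Sum>i\<in>I. a i) powr p \<le> (real (card I) * a j) powr p"
    using assms by (intro powr_mono2 sum_nonneg) auto
  also have "\<dots> = real (card I) powr p * a j powr p" using assms(2) j(1) by (simp add: powr_mult)
  also have "\<dots> \<le> real (card I) powr p * (\<Sum>i\<in>I. a i powr p)"
    using assms(1) j(1) by (intro mult_left_mono member_le_sum) auto
  finally show ?thesis .
qed simp

lemma powr_add_le:
  fixes a b :: real
  assumes "0 \<le> a" "0 \<le> b" "0 \<le> p"
  shows "(a + b) powr p \<le> 2 powr p * (a powr p + b powr p)"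
  using powr_sum_le[of "{True, False}" "\<lambda>i. if i then a else b" p] assms by simp

section \<open>The fundamental theorem of calculus for weak derivatives\<close>

text \<open>Lebesgue measure on the unit interval, carried by the whole line so that the measurable sets are all
  Borel sets. It averages over the points \<open>y + s h\<close> of a segment.\<close>

definition unit_interval :: "real measure" where
  "unit_interval = density lborel (indicator {0..1})"

lemma sets_unit_interval [measurable_cong, simp]: "sets unit_interval = sets borel"
  and space_unit_interval [simp]: "space unit_interval = UNIV"
  by (auto simp: unit_interval_def)

lemma prob_space_unit_interval: "prob_space unit_interval"
  by (rule prob_spaceI) (simp add: unit_interval_def emeasure_density)

lemma integral_unit_interval:
  "f \<in> borel_measurable borel \<Longrightarrow> (LINT s|unit_interval. f s) = (LINT s|lborel. f s * indicator {0..1} s)" for f :: "real \<Rightarrow> real"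
  unfolding unit_interval_def ennreal_indicator[symmetric]
  by (subst integral_density) (auto simp: mult.commute)

lemma pair_unit_lborel: "pair_sigma_finite unit_interval (lborel :: 'a::euclidean_space measure)"
proof -
  interpret prob_space unit_interval by (rule prob_space_unit_interval)
  show ?thesis ..
qed

text \<open>Translation invariance of Lebesgue measure makes the inner integral over \<open>y\<close> independent of \<open>s\<close>. The two
  instances with a bounded test function in the place of \<open>b\<close> justify both applications of Fubini below.\<close>

lemma integrable_pair_shift:
  fixes f :: "'a::euclidean_space \<Rightarrow> real"
  assumes f: "integrable lborel f"
    and b[measurable]: "b \<in> borel_measurable borel" and B: "\<And>y. \<bar>b y\<bar> \<le> B"
  shows "integrable (unit_interval \<Otimes>\<^sub>M lborel) (\<lambda>(s, y). f (y + s *\<^sub>R h) * b (y + s *\<^sub>R k))"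
proof -
  interpret U: prob_space unit_interval by (rule prob_space_unit_interval)
  interpret pair_sigma_finite unit_interval "lborel :: 'a measure" by (rule pair_unit_lborel)
  have [measurable]: "f \<in> borel_measurable borel" using f by simp
  have i: "integrable (unit_interval \<Otimes>\<^sub>M lborel) (\<lambda>(s, y). f (y + s *\<^sub>R h))"
  proof (rule Fubini_integrable)
    show "AE s in unit_interval. integrable lborel (\<lambda>y. case (s, y) of (s, y) \<Rightarrow> f (y + s *\<^sub>R h))"
      using lborel_integrable_translate[OF f] by auto
    have "(LINT y|lborel. norm (case (s, y) of (s, y) \<Rightarrow> f (y + s *\<^sub>R h))) = (LINT y|lborel. norm (f y))" for s
      using lborel_integral_translate[of "\<lambda>y. norm (f y)" "s *\<^sub>R h"] by simp
    then show "integrable unit_interval (\<lambda>s. LINT y|lborel. norm (case (s, y) of (s, y) \<Rightarrow> f (y + s *\<^sub>R h)))"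
      by simp
  qed measurable
  show ?thesis
  proof (rule Bochner_Integration.integrable_bound[OF integrable_mult_right[OF i, of B]])
    show "AE q in unit_interval \<Otimes>\<^sub>M lborel. norm (case q of (s, y) \<Rightarrow> f (y + s *\<^sub>R h) * b (y + s *\<^sub>R k))
        \<le> norm (B * (case q of (s, y) \<Rightarrow> f (y + s *\<^sub>R h)))"
    proof (rule AE_I2, clarify)
      fix s y
      have "\<bar>f (y + s *\<^sub>R h)\<bar> * \<bar>b (y + s *\<^sub>R k)\<bar> \<le> \<bar>f (y + s *\<^sub>R h)\<bar> * B" by (intro mult_left_mono B) auto
      moreover have "0 \<le> B" using B[of y] by linarith
      ultimately show "norm (f (y + s *\<^sub>R h) * b (y + s *\<^sub>R k)) \<le> norm (B * f (y + s *\<^sub>R h))"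
        by (simp add: abs_mult mult.commute)
    qed
  qed measurable
qed

text \<open>Paired with a test function \<open>\<phi>\<close> on \<open>A\<close>, the right-hand side becomes, after translating by \<open>s h\<close>, the
  pairing of the gradient with \<open>\<phi>(y - s h)\<close>. This is a test function on \<open>\<Omega>\<close> because the segments stay in
  \<open>\<Omega>\<close>, so the weak derivative moves onto \<open>\<phi>\<close>, where the integral over \<open>s\<close> is elementary. The result is
  the pairing of the increment of \<open>u\<close> with \<open>\<phi>\<close>.\<close>

lemma translation_identity:
  fixes u :: "real^'n::finite \<Rightarrow> real"
  assumes u: "integrable lborel u" and g: "\<And>i. integrable lborel (g i)"
    and weak: "\<And>\<phi> i. test_function \<Omega> \<phi> \<Longrightarrow> (LINT x|lborel. u x * partial i \<phi> x) = - (LINT x|lborel. g i x * \<phi> x)"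
    and A: "open A" "\<And>y s. y \<in> A \<Longrightarrow> 0 \<le> s \<Longrightarrow> s \<le> 1 \<Longrightarrow> y + s *\<^sub>R h \<in> \<Omega>"
  shows "AE y in lborel. y \<in> A \<longrightarrow>
     u (y + h) - u y = (LINT s|unit_interval. (\<Sum>i\<in>UNIV. h $ i * g i (y + s *\<^sub>R h)))"
proof -
  interpret U: prob_space unit_interval by (rule prob_space_unit_interval)
  interpret pair_sigma_finite unit_interval "lborel :: (real^'n) measure" by (rule pair_unit_lborel)
  have [measurable]: "u \<in> borel_measurable borel" "\<And>i. g i \<in> borel_measurable borel"
    using u g borel_measurable_integrable by force+
  define D where "D = (\<lambda>y. \<Sum>i\<in>UNIV. h $ i * g i y)"
  have D: "integrable lborel D" unfolding D_def using g by auto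
  then have [measurable]: "D \<in> borel_measurable borel" by simp
  define E where "E = (\<lambda>y. LINT s|unit_interval. D (y + s *\<^sub>R h))"
  have iD: "integrable (unit_interval \<Otimes>\<^sub>M lborel) (\<lambda>(s, y). D (y + s *\<^sub>R h))"
    using integrable_pair_shift[OF D, of "\<lambda>_. 1" 1 h 0] by simp
  have E: "integrable lborel E"
    unfolding E_def by (rule integrable_snd[OF iD])
  define H where "H = (\<lambda>y. u (y + h) - u y - E y)"
  have H: "integrable lborel H"
    unfolding H_def using u E by (intro Bochner_Integration.integrable_diff lborel_integrable_translate)
  have "AE y in lebesgue. y \<in> A \<longrightarrow> H y = 0"
  proof (rule fundamental_lemma[OF A(1)])
    show "set_integrable lebesgue K H" if "compact K" for K
    proof -
      have "integrable lebesgue H" using H by (subst integrable_completion) auto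
      then show ?thesis unfolding set_integrable_def using that
        by (intro integrable_mult_indicator) (auto intro: fmeasurableD lmeasurable_compact)
    qed
    fix \<phi> assume \<phi>: "test_function A \<phi>"
    note sm = test_function_smooth[OF \<phi>]
    have [measurable]: "\<phi> \<in> borel_measurable borel" using sm by measurable
    obtain B where B: "\<And>x. \<bar>\<phi> x\<bar> \<le> B" using test_function_bounded[OF \<phi>] by metis
    define \<psi> where "\<psi> = (\<lambda>y. \<Sum>i\<in>UNIV. h $ i * partial i \<phi> y)"
    have psi: "test_function A (\<lambda>y. h $ i * partial i \<phi> y)" for i
      using test_function_mult[OF smooth_const test_function_partial[OF \<phi>]] .
    have smpsi: "smooth \<psi>"
      unfolding \<psi>_def by (intro smooth_sum finite test_function_smooth[OF psi])
    then have [measurable]: "\<psi> \<in> borel_measurable borel" by measurable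
    have "\<exists>B. \<forall>y. \<bar>\<psi> y\<bar> \<le> B"
    proof -
      have "\<exists>b. \<forall>y. \<bar>h $ i * partial i \<phi> y\<bar> \<le> b" for i
        using test_function_bounded[OF psi[of i]] by metis
      then obtain b where b: "\<And>i y. \<bar>h $ i * partial i \<phi> y\<bar> \<le> b i" by metis
      have "\<bar>\<psi> y\<bar> \<le> (\<Sum>i\<in>UNIV. b i)" for y
        unfolding \<psi>_def by (rule order_trans[OF sum_abs sum_mono]) (rule b)
      then show ?thesis by blast
    qed
    then obtain B' where B': "\<And>y. \<bar>\<psi> y\<bar> \<le> B'" by blast
    have iuphi: "integrable lborel (\<lambda>y. f y * \<phi> (y + a))" if "integrable lborel f" for f :: "real^'n \<Rightarrow> real" and a
    proof (rule Bochner_Integration.integrable_bound[OF integrable_mult_right[OF that, of B]])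
      show "AE x in lborel. norm (f x * \<phi> (x + a)) \<le> norm (B * f x)"
      proof (rule AE_I2)
        fix x
        have "\<bar>f x\<bar> * \<bar>\<phi> (x + a)\<bar> \<le> \<bar>f x\<bar> * B" by (intro mult_left_mono B) auto
        moreover have "0 \<le> B" using B[of x] by linarith
        ultimately show "norm (f x * \<phi> (x + a)) \<le> norm (B * f x)" by (simp add: abs_mult mult.commute)
      qed
    qed (use that in measurable)
    have shift: "(LINT y|lborel. D (y + s *\<^sub>R h) * \<phi> y) = - (LINT y|lborel. u y * \<psi> (y + s *\<^sub>R (- h)))"
      if s: "0 \<le> s" "s \<le> 1" for s
    proof -
      have "test_function \<Omega> (\<lambda>x. \<phi> (x - s *\<^sub>R h))"
        using A(2) s by (intro test_function_mono[OF test_function_translate[OF \<phi>]]) auto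
      then have \<phi>s: "test_function \<Omega> (\<lambda>x. \<phi> (x + s *\<^sub>R (- h)))" by simp
      note w = weak[OF this, unfolded partial_translate]
      have "(LINT y|lborel. D (y + s *\<^sub>R h) * \<phi> y) = (LINT y|lborel. D (y + s *\<^sub>R h + s *\<^sub>R (- h)) * \<phi> (y + s *\<^sub>R (- h)))"
        using lborel_integral_translate[of "\<lambda>y. D (y + s *\<^sub>R h) * \<phi> y" "s *\<^sub>R (- h)", symmetric]
        by (simp add: add_ac)
      also have "\<dots> = (LINT y|lborel. (\<Sum>i\<in>UNIV. h $ i * (g i y * \<phi> (y + s *\<^sub>R (- h)))))"
        by (simp add: D_def sum_distrib_right mult.assoc)
      also have "\<dots> = (\<Sum>i\<in>UNIV. h $ i * (LINT y|lborel. g i y * \<phi> (y + s *\<^sub>R (- h))))"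
        by (subst Bochner_Integration.integral_sum) (intro integrable_mult_right iuphi g, simp)
      also have "\<dots> = - (\<Sum>i\<in>UNIV. h $ i * (LINT y|lborel. u y * partial i \<phi> (y + s *\<^sub>R (- h))))"
        using w by (simp add: sum_negf)
      also have "(\<Sum>i\<in>UNIV. h $ i * (LINT y|lborel. u y * partial i \<phi> (y + s *\<^sub>R (- h)))) =
         (LINT y|lborel. (\<Sum>i\<in>UNIV. h $ i * (u y * partial i \<phi> (y + s *\<^sub>R (- h)))))"
      proof (subst Bochner_Integration.integral_sum)
        fix i
        have "integrable lebesgue (\<lambda>y. u y * partial i (\<lambda>x. \<phi> (x + s *\<^sub>R (- h))) y)"
        proof (rule integrable_mult_test[OF _ test_function_partial[OF \<phi>s]])
          have "integrable lebesgue u" using u by (subst integrable_completion) auto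
          then show "locally_integrable \<Omega> u" unfolding locally_integrable_iff set_integrable_def
            using integrable_mult_indicator[OF fmeasurableD[OF lmeasurable_compact]] by blast
        qed
        moreover have "(\<lambda>y. u y * partial i (\<lambda>x. \<phi> (x + s *\<^sub>R (- h))) y) \<in> borel_measurable borel"
          using smooth_measurable[OF test_function_smooth[OF test_function_partial[OF \<phi>s]]]
          by (intro borel_measurable_times) auto
        ultimately have "integrable lborel (\<lambda>y. u y * partial i (\<lambda>x. \<phi> (x + s *\<^sub>R (- h))) y)"
          by (simp add: integrable_completion)
        then show "integrable lborel (\<lambda>y. h $ i * (u y * partial i \<phi> (y + s *\<^sub>R (- h))))"
          unfolding partial_translate by (intro integrable_mult_right)
      qed simp
      also have "\<dots> = (LINT y|lborel. u y * \<psi> (y + s *\<^sub>R (- h)))"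
        by (simp add: \<psi>_def sum_distrib_left mult_ac)
      finally show ?thesis .
    qed
    have inner: "(LINT s|unit_interval. \<psi> (y + s *\<^sub>R (- h))) = \<phi> y - \<phi> (y + - h)" for y
    proof -
      have der: "((\<lambda>s. - \<phi> (y + s *\<^sub>R (- h))) has_real_derivative \<psi> (y + s *\<^sub>R (- h))) (at s)" for s
        using DERIV_minus[OF DERIV_along_line[of \<phi> y s "- h", OF smooth_differentiable[OF sm]]]
        by (simp add: \<psi>_def sum_negf)
      have "(LINT s|unit_interval. \<psi> (y + s *\<^sub>R (- h))) = (LINT s|lborel. \<psi> (y + s *\<^sub>R (- h)) * indicator {0..1} s)"
        by (rule integral_unit_interval) measurable
      also have "\<dots> = (- \<phi> (y + 1 *\<^sub>R (- h))) - (- \<phi> (y + 0 *\<^sub>R (- h)))"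
      proof (rule integral_FTC_Icc_real)
        show "isCont (\<lambda>s. \<psi> (y + s *\<^sub>R (- h))) s" for s
          using continuous_on_compose2[OF smooth_continuous[OF smpsi, of UNIV], of UNIV "\<lambda>s. y + s *\<^sub>R (- h)"]
          by (auto simp: continuous_on_eq_continuous_at intro!: continuous_intros)
      qed (use der in auto)
      finally show ?thesis by simp
    qed
    have "(LINT y|lborel. E y * \<phi> y) = (LINT y|lborel. (LINT s|unit_interval. D (y + s *\<^sub>R h) * \<phi> (y + s *\<^sub>R 0)))"
      unfolding E_def by simp
    also have "\<dots> = (LINT s|unit_interval. (LINT y|lborel. D (y + s *\<^sub>R h) * \<phi> (y + s *\<^sub>R 0)))"
      by (rule Fubini_integral[OF integrable_pair_shift[OF D _ B]]) simp
    also have "\<dots> = (LINT s|unit_interval. - (LINT y|lborel. u y * \<psi> (y + s *\<^sub>R (- h))))"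
    proof (rule integral_cong_AE)
      show "AE s in unit_interval. (LINT y|lborel. D (y + s *\<^sub>R h) * \<phi> (y + s *\<^sub>R 0)) =
          - (LINT y|lborel. u y * \<psi> (y + s *\<^sub>R (- h)))"
        using shift unfolding unit_interval_def by (subst AE_density) (auto simp: indicator_def intro!: AE_I2)
    qed measurable
    also have "\<dots> = - (LINT s|unit_interval. (LINT y|lborel. u (y + s *\<^sub>R 0) * \<psi> (y + s *\<^sub>R (- h))))"
      by simp
    also have "(LINT s|unit_interval. (LINT y|lborel. u (y + s *\<^sub>R 0) * \<psi> (y + s *\<^sub>R (- h)))) =
        (LINT y|lborel. (LINT s|unit_interval. u (y + s *\<^sub>R 0) * \<psi> (y + s *\<^sub>R (- h))))"
      by (rule Fubini_integral[OF integrable_pair_shift[OF u _ B'], symmetric]) simp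
    also have "\<dots> = (LINT y|lborel. u y * \<phi> y - u y * \<phi> (y + - h))"
      by (simp only: scaleR_zero_right add_0_right integral_mult_right_zero inner right_diff_distrib)
    also have "\<dots> = (LINT y|lborel. u y * \<phi> y) - (LINT y|lborel. u y * \<phi> (y + - h))"
      using iuphi[OF u, of 0] iuphi[OF u, of "- h"] by simp
    finally have e: "(LINT y|lborel. E y * \<phi> y) = (LINT y|lborel. u y * \<phi> (y + - h)) - (LINT y|lborel. u y * \<phi> y)"
      by simp
    have "(LINT y|lborel. u (y + h) * \<phi> y) = (LINT y|lborel. u y * \<phi> (y + - h))"
      using lborel_integral_translate[of "\<lambda>y. u (y + h) * \<phi> y" "- h", symmetric] by simp
    moreover have "(LINT y|lborel. H y * \<phi> y) = (LINT y|lborel. u (y + h) * \<phi> y) - (LINT y|lborel. u y * \<phi> y) - (LINT y|lborel. E y * \<phi> y)"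
      using iuphi[OF u, of 0] iuphi[OF E, of 0] iuphi[OF lborel_integrable_translate[OF u], of h 0]
      by (simp add: H_def left_diff_distrib)
    ultimately have "(LINT y|lborel. H y * \<phi> y) = 0" using e by simp
    moreover have [measurable]: "H \<in> borel_measurable borel" using H by simp
    ultimately show "(LINT y|lebesgue. H y * \<phi> y) = 0" by (subst integral_completion) auto
  qed
  then show ?thesis unfolding AE_completion_iff H_def E_def D_def by (auto elim!: eventually_mono)
qed

section \<open>The Poincare inequality\<close>

text \<open>Functions in \<open>W\<^sup>1\<^sup>,\<^sup>p(\<Omega>)\<close> for bounded \<open>\<Omega>\<close>, extended by \<open>0\<close> and replaced by Borel representatives; both
  are then integrable over the whole space and product measures can be used.\<close>

definition has_weak_gradient :: "(real^'n::finite) set \<Rightarrow> (real^'n \<Rightarrow> real) \<Rightarrow> ('n \<Rightarrow> real^'n \<Rightarrow> real) \<Rightarrow> bool" where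
  "has_weak_gradient \<Omega> u g \<longleftrightarrow> integrable lborel u \<and> (\<forall>i. integrable lborel (g i)) \<and>
     (\<forall>\<phi> i. test_function \<Omega> \<phi> \<longrightarrow> (LINT x|lborel. u x * partial i \<phi> x) = - (LINT x|lborel. g i x * \<phi> x))"

definition energy :: "real \<Rightarrow> ('n::finite \<Rightarrow> real^'n \<Rightarrow> real) \<Rightarrow> ennreal" where
  "energy p g = (\<Sum>i\<in>UNIV. \<integral>\<^sup>+x. ennreal (\<bar>g i x\<bar> powr p) \<partial>lborel)"

text \<open>The increment along the segment is an average of directional derivatives. Jensen's inequality and
  Tonelli's theorem reduce its \<open>p\<close>-th power to the energy, as each translate of the gradient has the same
  integral over the whole space.\<close>

lemma translation_estimate:
  fixes u :: "real^'n::finite \<Rightarrow> real"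
  assumes p: "1 \<le> p" and ug: "has_weak_gradient \<Omega> u g"
    and A: "open A" "\<And>y s. y \<in> A \<Longrightarrow> 0 \<le> s \<Longrightarrow> s \<le> 1 \<Longrightarrow> y + s *\<^sub>R h \<in> \<Omega>"
  shows "(\<integral>\<^sup>+y. indicator A y * ennreal (\<bar>u (y + h) - u y\<bar> powr p) \<partial>lborel)
    \<le> ennreal ((norm h * real CARD('n)) powr p) * energy p g"
proof -
  interpret U: prob_space unit_interval by (rule prob_space_unit_interval)
  interpret pair_sigma_finite unit_interval "lborel :: (real^'n) measure" by (rule pair_unit_lborel)
  have u: "integrable lborel u" and g: "\<And>i. integrable lborel (g i)"
    and weak: "\<And>\<phi> i. test_function \<Omega> \<phi> \<Longrightarrow> (LINT x|lborel. u x * partial i \<phi> x) = - (LINT x|lborel. g i x * \<phi> x)"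
    using ug by (auto simp: has_weak_gradient_def)
  have [measurable]: "u \<in> borel_measurable borel" "\<And>i. g i \<in> borel_measurable borel"
    using u g borel_measurable_integrable by force+
  define D where "D = (\<lambda>y. \<Sum>i\<in>UNIV. h $ i * g i y)"
  have [measurable]: "D \<in> borel_measurable borel" unfolding D_def by measurable
  let ?c = "(norm h * real CARD('n)) powr p"
  have Dle: "\<bar>D y\<bar> powr p \<le> ?c * (\<Sum>i\<in>UNIV. \<bar>g i y\<bar> powr p)" for y
  proof -
    have "\<bar>D y\<bar> \<le> (\<Sum>i\<in>UNIV. norm h * \<bar>g i y\<bar>)"
      unfolding D_def
      by (rule order_trans[OF sum_abs sum_mono]) (auto simp: abs_mult component_le_norm_cart intro!: mult_right_mono)
    then have "\<bar>D y\<bar> powr p \<le> (\<Sum>i\<in>UNIV. norm h * \<bar>g i y\<bar>) powr p"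
      using p by (intro powr_mono2) auto
    also have "\<dots> \<le> real CARD('n) powr p * (\<Sum>i\<in>UNIV. (norm h * \<bar>g i y\<bar>) powr p)"
      using p by (intro powr_sum_le) auto
    also have "\<dots> = ?c * (\<Sum>i\<in>UNIV. \<bar>g i y\<bar> powr p)"
      by (simp add: powr_mult sum_distrib_left mult_ac)
    finally show ?thesis .
  qed
  have ident: "AE y in lborel. y \<in> A \<longrightarrow>
     u (y + h) - u y = (LINT s|unit_interval. (\<Sum>i\<in>UNIV. h $ i * g i (y + s *\<^sub>R h)))"
    by (rule translation_identity[OF u g _ A(1)]) (use weak A(2) in auto)
  have "(\<integral>\<^sup>+y. indicator A y * ennreal (\<bar>u (y + h) - u y\<bar> powr p) \<partial>lborel)
     \<le> (\<integral>\<^sup>+y. (\<integral>\<^sup>+s. ennreal (\<bar>D (y + s *\<^sub>R h)\<bar> powr p) \<partial>unit_interval) \<partial>lborel)"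
  proof (rule nn_integral_mono_AE)
    show "AE y in lborel. indicator A y * ennreal (\<bar>u (y + h) - u y\<bar> powr p)
        \<le> (\<integral>\<^sup>+s. ennreal (\<bar>D (y + s *\<^sub>R h)\<bar> powr p) \<partial>unit_interval)"
      using ident
    proof eventually_elim
      case (elim y)
      have "ennreal (\<bar>LINT s|unit_interval. D (y + s *\<^sub>R h)\<bar> powr p)
          \<le> (\<integral>\<^sup>+s. ennreal (\<bar>D (y + s *\<^sub>R h)\<bar> powr p) \<partial>unit_interval)"
        by (rule U.powr_expectation_le[OF p]) measurable
      then show ?case using elim by (cases "y \<in> A") (auto simp: D_def)
    qed
  qed
  also have "\<dots> = (\<integral>\<^sup>+s. (\<integral>\<^sup>+y. ennreal (\<bar>D (y + s *\<^sub>R h)\<bar> powr p) \<partial>lborel) \<partial>unit_interval)"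
    by (rule Fubini') measurable
  also have "\<dots> = (\<integral>\<^sup>+s. (\<integral>\<^sup>+y. ennreal (\<bar>D y\<bar> powr p) \<partial>lborel) \<partial>unit_interval)"
    by (intro nn_integral_cong lborel_nn_integral_translate[of "\<lambda>y. ennreal (\<bar>D y\<bar> powr p)"]) measurable
  also have "\<dots> = (\<integral>\<^sup>+y. ennreal (\<bar>D y\<bar> powr p) \<partial>lborel)"
    using U.emeasure_space_1 by simp
  also have "\<dots> \<le> (\<integral>\<^sup>+y. ennreal ?c * (\<Sum>i\<in>UNIV. ennreal (\<bar>g i y\<bar> powr p)) \<partial>lborel)"
    using Dle by (intro nn_integral_mono) (simp add: sum_nonneg flip: ennreal_mult)
  also have "\<dots> = ennreal ?c * energy p g"
    by (simp add: energy_def nn_integral_cmult nn_integral_sum del: sum_ennreal)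
  finally show ?thesis .
qed

abbreviation deviation :: "real \<Rightarrow> (real^'n::finite) set \<Rightarrow> (real^'n \<Rightarrow> real) \<Rightarrow> real \<Rightarrow> ennreal" where
  "deviation p S u c \<equiv> (\<integral>\<^sup>+y. indicator S y * ennreal (\<bar>u y - c\<bar> powr p) \<partial>lborel)"

text \<open>The deviation from a constant is measured on the part \<open>S\<close> of the domain, the gradient on all of \<open>\<Omega>\<close>. The
  bound \<open>\<gamma>\<close> stands for the energy, which keeps the constants real. The number \<open>c\<close> depends on \<open>u\<close>, whereas
  \<open>K\<close> does not.\<close>

definition poincare_on :: "(real^'n::finite) set \<Rightarrow> real \<Rightarrow> (real^'n) set \<Rightarrow> bool" where
  "poincare_on \<Omega> p S \<longleftrightarrow> (\<exists>K\<ge>0. \<forall>u g \<gamma>. has_weak_gradient \<Omega> u g \<longrightarrow> 0 \<le> \<gamma> \<longrightarrow> energy p g \<le> ennreal \<gamma> \<longrightarrow>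
     (\<exists>c. deviation p S u c \<le> ennreal (K * \<gamma>)))"

text \<open>The points of \<open>B\<close> are visible from all points of \<open>A\<close> inside \<open>\<Omega>\<close>. In the double integral of
  \<open>\<bar>u(y) - u(z)\<bar>\<^sup>p\<close> over \<open>y \<in> A\<close> and \<open>z \<in> B\<close>, the substitution \<open>z = y + h\<close> leaves for each fixed
  \<open>h\<close> the integral of an increment, and only \<open>\<bar>h\<bar> \<le> d\<close> contributes. Some \<open>z \<in> B\<close> is at most as bad as
  the average, and \<open>c = u(z)\<close> is the constant.\<close>

lemma poincare_on_visible:
  fixes A B :: "(real^'n::finite) set"
  assumes p: "1 \<le> p" and A: "open A" and B: "open B" "B \<noteq> {}" "bounded B"
    and d: "\<And>y z. y \<in> A \<Longrightarrow> z \<in> B \<Longrightarrow> norm (z - y) \<le> d"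
    and seg: "\<And>y z s. y \<in> A \<Longrightarrow> z \<in> B \<Longrightarrow> 0 \<le> s \<Longrightarrow> s \<le> 1 \<Longrightarrow> y + s *\<^sub>R (z - y) \<in> \<Omega>"
  shows "poincare_on \<Omega> p A"
proof -
  have Bm: "B \<in> lmeasurable" using B by (simp add: bounded_set_imp_lmeasurable)
  define m where "m = measure lborel B"
  have [measurable]: "A \<in> sets borel" "B \<in> sets borel" using A B by auto
  have eB: "emeasure lborel B = ennreal m"
    unfolding m_def using B(3) emeasure_bounded_finite by (intro emeasure_eq_ennreal_measure) (auto simp: less_top)
  have "B \<notin> null_sets lborel"
    using B(1,2) open_not_negligible[of B] negligible_iff_null_sets null_sets_completionI by blast
  then have m: "m > 0" using eB by (auto simp: null_sets_def m_def zero_less_measure_iff)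
  define v where "v = measure lborel (cball (0::real^'n) d)"
  have ev: "emeasure lborel (cball (0::real^'n) d) = ennreal v"
    unfolding v_def using emeasure_bounded_finite[OF bounded_cball] by (intro emeasure_eq_ennreal_measure) (auto simp: less_top)
  define C where "C = v * (d * real CARD('n)) powr p"
  have v: "0 \<le> v" by (simp add: v_def)
  show ?thesis
    unfolding poincare_on_def
  proof (rule exI[of _ "C / m"], intro conjI allI impI)
    show "0 \<le> C / m" using m v by (simp add: C_def)
    fix u g \<gamma> assume ug: "has_weak_gradient \<Omega> u g" and \<gamma>: "0 \<le> \<gamma>" "energy p g \<le> ennreal \<gamma>"
    have [measurable]: "u \<in> borel_measurable borel" using ug by (auto simp: has_weak_gradient_def)
    define F where "F = (\<lambda>z. deviation p A u (u z))"
    have [measurable]: "F \<in> borel_measurable borel" unfolding F_def by measurable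
    have "(\<integral>\<^sup>+z. indicator B z * F z \<partial>lborel)
        = (\<integral>\<^sup>+z. (\<integral>\<^sup>+y. indicator B z * (indicator A y * ennreal (\<bar>u y - u z\<bar> powr p)) \<partial>lborel) \<partial>lborel)"
      unfolding F_def by (intro nn_integral_cong nn_integral_cmult[symmetric]) measurable
    also have "\<dots> = (\<integral>\<^sup>+y. (\<integral>\<^sup>+z. indicator B z * (indicator A y * ennreal (\<bar>u y - u z\<bar> powr p)) \<partial>lborel) \<partial>lborel)"
      by (rule lborel_pair.Fubini') measurable
    also have "\<dots> = (\<integral>\<^sup>+y. (\<integral>\<^sup>+h. indicator B (h + y) * (indicator A y * ennreal (\<bar>u y - u (h + y)\<bar> powr p)) \<partial>lborel) \<partial>lborel)"
      by (intro nn_integral_cong lborel_nn_integral_translate[symmetric]) measurable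
    also have "\<dots> = (\<integral>\<^sup>+h. (\<integral>\<^sup>+y. indicator B (h + y) * (indicator A y * ennreal (\<bar>u y - u (h + y)\<bar> powr p)) \<partial>lborel) \<partial>lborel)"
      by (rule lborel_pair.Fubini') measurable
    also have "\<dots> \<le> (\<integral>\<^sup>+h. indicator (cball (0::real^'n) d) h * ennreal ((d * real CARD('n)) powr p * \<gamma>) \<partial>lborel)"
    proof (rule nn_integral_mono)
      fix h :: "real^'n"
      define Ah where "Ah = {y \<in> A. y + h \<in> B}"
      have "open Ah"
      proof -
        have "Ah = A \<inter> (\<lambda>y. y + h) -` B" by (auto simp: Ah_def)
        then show ?thesis using A B(1) by (auto intro!: open_Int open_vimage continuous_intros)
      qed
      have eq: "(\<integral>\<^sup>+y. indicator B (h + y) * (indicator A y * ennreal (\<bar>u y - u (h + y)\<bar> powr p)) \<partial>lborel)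
          = (\<integral>\<^sup>+y. indicator Ah y * ennreal (\<bar>u (y + h) - u y\<bar> powr p) \<partial>lborel)"
        by (intro nn_integral_cong) (auto simp: Ah_def indicator_def add.commute abs_minus_commute)
      show "(\<integral>\<^sup>+y. indicator B (h + y) * (indicator A y * ennreal (\<bar>u y - u (h + y)\<bar> powr p)) \<partial>lborel)
         \<le> indicator (cball 0 d) h * ennreal ((d * real CARD('n)) powr p * \<gamma>)"
      proof (cases "Ah = {}")
        case False
        then have h: "norm h \<le> d" using d by (fastforce simp: Ah_def)
        have "(\<integral>\<^sup>+y. indicator Ah y * ennreal (\<bar>u (y + h) - u y\<bar> powr p) \<partial>lborel)
           \<le> ennreal ((norm h * real CARD('n)) powr p) * energy p g"
        proof (rule translation_estimate[OF p ug \<open>open Ah\<close>])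
          fix y s assume "y \<in> Ah" "0 \<le> s" "s \<le> (1::real)"
          then show "y + s *\<^sub>R h \<in> \<Omega>" using seg[of y "y + h" s] by (simp add: Ah_def)
        qed
        also have "\<dots> \<le> ennreal ((d * real CARD('n)) powr p) * ennreal \<gamma>"
          using h p by (intro mult_mono \<gamma> ennreal_leI powr_mono2 mult_right_mono) auto
        finally show ?thesis unfolding eq using h \<gamma> by (simp add: ennreal_mult)
      qed (simp add: eq)
    qed
    also have "\<dots> = ennreal v * ennreal ((d * real CARD('n)) powr p * \<gamma>)"
      by (subst nn_integral_multc) (auto simp: ev intro!: borel_measurable_indicator borel_closed)
    also have "\<dots> = ennreal (C * \<gamma>)"
      using v \<gamma> by (simp add: C_def mult.assoc flip: ennreal_mult)
    finally have le: "(\<integral>\<^sup>+z. indicator B z * F z \<partial>lborel) \<le> ennreal (C * \<gamma>)" .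
    have "\<exists>z. F z \<le> ennreal (C / m * \<gamma>)"
    proof (rule ccontr)
      assume "\<nexists>z. F z \<le> ennreal (C / m * \<gamma>)"
      then have big: "\<And>z. ennreal (C / m * \<gamma>) < F z" by (simp add: not_le)
      have "(\<integral>\<^sup>+z. indicator B z * ennreal (C / m * \<gamma>) \<partial>lborel) < (\<integral>\<^sup>+z. indicator B z * F z \<partial>lborel)"
      proof (rule nn_integral_less)
        show "(\<integral>\<^sup>+z. indicator B z * ennreal (C / m * \<gamma>) \<partial>lborel) \<noteq> \<infinity>"
          by (simp add: nn_integral_multc eB ennreal_mult_eq_top_iff)
        show "AE z in lborel. indicator B z * ennreal (C / m * \<gamma>) \<le> indicator B z * F z"
          using big by (intro AE_I2 mult_left_mono) (auto intro: less_imp_le)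
        show "\<not> (AE z in lborel. indicator B z * F z \<le> indicator B z * ennreal (C / m * \<gamma>))"
        proof
          assume "AE z in lborel. indicator B z * F z \<le> indicator B z * ennreal (C / m * \<gamma>)"
          then have "AE z in lborel. z \<notin> B"
          proof eventually_elim
            case (elim z)
            then show ?case using big[of z] by (auto simp: indicator_def split: if_splits)
          qed
          then show False using \<open>B \<notin> null_sets lborel\<close> by (simp add: AE_iff_null)
        qed
      qed measurable
      also have "(\<integral>\<^sup>+z. indicator B z * ennreal (C / m * \<gamma>) \<partial>lborel) = ennreal (C * \<gamma>)"
        using m v \<gamma> by (simp add: nn_integral_multc eB C_def flip: ennreal_mult)
      finally show False using le by simp
    qed
    then show "\<exists>c. deviation p A u c \<le> ennreal (C / m * \<gamma>)"
      unfolding F_def by blast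
  qed
qed

text \<open>The constants \<open>a\<close> and \<open>b\<close> for the two sets cannot differ much, since both are close to \<open>u\<close> on the
  intersection, which has positive measure; hence \<open>a\<close> serves for the union.\<close>

lemma poincare_on_Un:
  fixes S T :: "(real^'n::finite) set"
  assumes p: "1 \<le> p" and S: "open S" "bounded S" "poincare_on \<Omega> p S"
    and T: "open T" "bounded T" "poincare_on \<Omega> p T" and ne: "S \<inter> T \<noteq> {}"
  shows "poincare_on \<Omega> p (S \<union> T)"
proof -
  obtain K where K: "0 \<le> K" "\<And>u g \<gamma>. has_weak_gradient \<Omega> u g \<Longrightarrow> 0 \<le> \<gamma> \<Longrightarrow> energy p g \<le> ennreal \<gamma> \<Longrightarrow>
     \<exists>c. deviation p S u c \<le> ennreal (K * \<gamma>)"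
    using S(3) unfolding poincare_on_def by blast
  obtain L where L: "0 \<le> L" "\<And>u g \<gamma>. has_weak_gradient \<Omega> u g \<Longrightarrow> 0 \<le> \<gamma> \<Longrightarrow> energy p g \<le> ennreal \<gamma> \<Longrightarrow>
     \<exists>c. deviation p T u c \<le> ennreal (L * \<gamma>)"
    using T(3) unfolding poincare_on_def by blast
  have [measurable]: "S \<in> sets borel" "T \<in> sets borel" using S T by auto
  define m where "m = measure lborel (S \<inter> T)"
  have em: "emeasure lborel (S \<inter> T) = ennreal m"
    unfolding m_def using S(2) emeasure_bounded_finite[of "S \<inter> T"]
    by (intro emeasure_eq_ennreal_measure) (auto simp: less_top bounded_Int)
  have "S \<inter> T \<notin> null_sets lborel"
    using S(1) T(1) ne open_not_negligible[of "S \<inter> T"] negligible_iff_null_sets null_sets_completionI by blast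
  then have m: "m > 0" using em by (auto simp: null_sets_def m_def zero_less_measure_iff)
  define t where "t = measure lborel T"
  have et: "emeasure lborel T = ennreal t"
    unfolding t_def using emeasure_bounded_finite[OF T(2)]
    by (intro emeasure_eq_ennreal_measure) (auto simp: less_top)
  have t: "0 \<le> t" by (simp add: t_def)
  define P where "P = 2 powr p"
  have P: "0 \<le> P" by (simp add: P_def)
  define M where "M = K + P * (L + t * (P * (K + L) / m))"
  show ?thesis
    unfolding poincare_on_def
  proof (rule exI[of _ M], intro conjI allI impI)
    show "0 \<le> M" using K(1) L(1) P t m by (simp add: M_def)
    fix u g \<gamma> assume ug: "has_weak_gradient \<Omega> u g" and \<gamma>: "0 \<le> \<gamma>" "energy p g \<le> ennreal \<gamma>"
    have [measurable]: "u \<in> borel_measurable borel" using ug by (auto simp: has_weak_gradient_def)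
    obtain a where a: "deviation p S u a \<le> ennreal (K * \<gamma>)"
      using K(2)[OF ug \<gamma>] by blast
    obtain b where b: "deviation p T u b \<le> ennreal (L * \<gamma>)"
      using L(2)[OF ug \<gamma>] by blast
    have tri: "\<bar>x - z\<bar> powr p \<le> P * (\<bar>y - x\<bar> powr p + \<bar>y - z\<bar> powr p)" for x y z :: real
    proof -
      have "\<bar>x - z\<bar> powr p \<le> (\<bar>y - x\<bar> + \<bar>y - z\<bar>) powr p" using p by (intro powr_mono2) auto
      also have "\<dots> \<le> P * (\<bar>y - x\<bar> powr p + \<bar>y - z\<bar> powr p)"
        unfolding P_def using p by (intro powr_add_le) auto
      finally show ?thesis .
    qed
    have tri': "ennreal (\<bar>x - z\<bar> powr p) \<le> ennreal P * (ennreal (\<bar>y - x\<bar> powr p) + ennreal (\<bar>y - z\<bar> powr p))" for x y z :: real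
      using tri[of x z y] P by (simp flip: ennreal_mult ennreal_plus)
    have "ennreal (\<bar>a - b\<bar> powr p) * ennreal m = (\<integral>\<^sup>+y. indicator (S \<inter> T) y * ennreal (\<bar>a - b\<bar> powr p) \<partial>lborel)"
      by (simp add: nn_integral_multc em mult.commute)
    also have "\<dots> \<le> (\<integral>\<^sup>+y. ennreal P * (indicator S y * ennreal (\<bar>u y - a\<bar> powr p) + indicator T y * ennreal (\<bar>u y - b\<bar> powr p)) \<partial>lborel)"
      using tri'[of a b] by (intro nn_integral_mono) (auto simp: indicator_def)
    also have "\<dots> = ennreal P * (deviation p S u a
        + deviation p T u b)"
      by (simp add: nn_integral_cmult nn_integral_add)
    also have "\<dots> \<le> ennreal P * (ennreal (K * \<gamma>) + ennreal (L * \<gamma>))"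
      by (intro mult_left_mono add_mono a b) simp
    finally have "\<bar>a - b\<bar> powr p * m \<le> P * (K * \<gamma> + L * \<gamma>)"
      using K L P m \<gamma> by (simp flip: ennreal_mult ennreal_plus)
    then have ab: "\<bar>a - b\<bar> powr p \<le> P * (K + L) / m * \<gamma>"
      using m by (simp add: field_simps)
    have "deviation p (S \<union> T) u a
      \<le> (\<integral>\<^sup>+y. indicator S y * ennreal (\<bar>u y - a\<bar> powr p) + ennreal P * (indicator T y * ennreal (\<bar>u y - b\<bar> powr p) + indicator T y * ennreal (\<bar>a - b\<bar> powr p)) \<partial>lborel)"
    proof (rule nn_integral_mono)
      fix y
      have "ennreal (\<bar>u y - a\<bar> powr p) \<le> ennreal P * (ennreal (\<bar>u y - b\<bar> powr p) + ennreal (\<bar>a - b\<bar> powr p))"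
        using tri'[of "u y" a b] by (simp add: abs_minus_commute)
      then show "indicator (S \<union> T) y * ennreal (\<bar>u y - a\<bar> powr p)
        \<le> indicator S y * ennreal (\<bar>u y - a\<bar> powr p) + ennreal P * (indicator T y * ennreal (\<bar>u y - b\<bar> powr p) + indicator T y * ennreal (\<bar>a - b\<bar> powr p))"
        by (cases "y \<in> S"; cases "y \<in> T") auto
    qed
    also have "\<dots> = deviation p S u a
      + ennreal P * (deviation p T u b + ennreal t * ennreal (\<bar>a - b\<bar> powr p))"
      by (simp add: nn_integral_cmult nn_integral_add nn_integral_multc et)
    also have "\<dots> \<le> ennreal (K * \<gamma>) + ennreal P * (ennreal (L * \<gamma>) + ennreal t * ennreal (P * (K + L) / m * \<gamma>))"
      by (intro add_mono mult_left_mono a b ennreal_leI ab) auto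
    also have "\<dots> = ennreal (M * \<gamma>)"
      using K L P m \<gamma> t by (simp add: M_def algebra_simps flip: ennreal_mult ennreal_plus)
    finally show "\<exists>c. deviation p (S \<union> T) u c \<le> ennreal (M * \<gamma>)"
      by blast
  qed
qed

lemma poincare_on_near_interior:
  assumes p: "1 \<le> p" and \<Omega>: "open \<Omega>" "x \<in> \<Omega>"
  shows "\<exists>V. open V \<and> x \<in> V \<and> poincare_on \<Omega> p (V \<inter> \<Omega>)"
proof -
  obtain e where e: "e > 0" "ball x e \<subseteq> \<Omega>" using \<Omega> open_contains_ball by blast
  have "poincare_on \<Omega> p (ball x e)"
  proof (rule poincare_on_visible[OF p, of _ "ball x e" "2 * e"])
    fix y z assume "y \<in> ball x e" "z \<in> ball x e"
    then show "norm (z - y) \<le> 2 * e"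
      using dist_triangle2[of z y x] by (simp add: dist_norm[of z y, symmetric] dist_commute)
  next
    fix y z and s :: real assume "y \<in> ball x e" "z \<in> ball x e" "0 \<le> s" "s \<le> 1"
    then have "(1 - s) *\<^sub>R y + s *\<^sub>R z \<in> ball x e"
      by (intro convexD_alt) auto
    moreover have "(1 - s) *\<^sub>R y + s *\<^sub>R z = y + s *\<^sub>R (z - y)" by (simp add: algebra_simps)
    ultimately show "y + s *\<^sub>R (z - y) \<in> \<Omega>" using e by auto
  qed (use e in auto)
  moreover have "ball x e \<inter> \<Omega> = ball x e" using e by auto
  ultimately show ?thesis using e by (intro exI[of _ "ball x e"]) auto
qed

text \<open>In direction \<open>e\<close> the domain opens upwards over the graph of \<open>g\<close>. From a point within \<open>\<rho>\<close> of \<open>x\<close> to a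
  point within \<open>\<rho>\<close> of \<open>x + \<tau> e\<close>, the height rises at least by \<open>s (\<tau> - 2 \<rho>)\<close> after the fraction \<open>s\<close> of the
  segment, while the graph rises at most by \<open>2 L \<rho> s\<close>. So the segment stays above the graph as soon as
  \<open>\<tau> \<ge> 2 (L + 1) \<rho>\<close>.\<close>

lemma poincare_on_near_boundary:
  fixes \<Omega> :: "(real^'n::finite) set"
  assumes p: "1 \<le> p" and \<Omega>: "open \<Omega>"
    and U: "open U" "x \<in> U" and e: "norm e = 1"
    and g: "lipschitz_on L {z. z \<bullet> e = 0} (g :: real^'n \<Rightarrow> real)"
    and graph: "\<Omega> \<inter> U = {y \<in> U. g (y - (y \<bullet> e) *\<^sub>R e) < y \<bullet> e}"
  shows "\<exists>V. open V \<and> x \<in> V \<and> poincare_on \<Omega> p (V \<inter> \<Omega>)"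
proof -
  have L: "0 \<le> L" using g by (rule lipschitz_on_nonneg)
  obtain R where R: "R > 0" "ball x R \<subseteq> U" using U open_contains_ball by blast
  \<comment> \<open>This choice makes \<open>\<tau> + 4 \<rho> = R\<close>, so the segments do not leave \<open>U\<close> either.\<close>
  define \<rho> where "\<rho> = R / (2 * L + 6)"
  have \<rho>: "\<rho> > 0" "(2 * L + 6) * \<rho> = R" using R L by (auto simp: \<rho>_def field_simps)
  define \<tau> where "\<tau> = 2 * (L + 1) * \<rho>"
  have ee: "e \<bullet> e = 1" using e by (simp add: power2_norm_eq_inner[symmetric])
  have "poincare_on \<Omega> p (ball x \<rho> \<inter> \<Omega>)"
  proof (rule poincare_on_visible[OF p, of _ "ball (x + \<tau> *\<^sub>R e) \<rho>" R])
    fix y z assume "y \<in> ball x \<rho> \<inter> \<Omega>" "z \<in> ball (x + \<tau> *\<^sub>R e) \<rho>"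
    then have y: "norm (y - x) < \<rho>" "y \<in> \<Omega>" and z: "norm (z - (x + \<tau> *\<^sub>R e)) < \<rho>"
      by (auto simp: dist_norm norm_minus_commute)
    define w where "w = (z - (x + \<tau> *\<^sub>R e)) - (y - x)"
    have zy: "z - y = \<tau> *\<^sub>R e + w" by (simp add: w_def)
    have w: "norm w < 2 * \<rho>"
      unfolding w_def using norm_triangle_ineq4[of "z - (x + \<tau> *\<^sub>R e)" "y - x"] y z by simp
    have \<tau>: "\<tau> \<ge> 0" using L \<rho> by (simp add: \<tau>_def)
    have nzy: "norm (z - y) < \<tau> + 2 * \<rho>"
      unfolding zy using norm_triangle_ineq[of "\<tau> *\<^sub>R e" w] w e \<tau> by simp
    have \<tau>R: "\<tau> + 4 * \<rho> = R" using \<rho>(2) by (simp add: \<tau>_def algebra_simps)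
    show "norm (z - y) \<le> R" using nzy \<tau>R \<rho> by simp
    fix s :: real assume s: "0 \<le> s" "s \<le> 1"
    define q where "q = y + s *\<^sub>R (z - y)"
    have "norm (q - x) \<le> norm (y - x) + norm (s *\<^sub>R (z - y))"
      unfolding q_def using norm_triangle_ineq[of "y - x" "s *\<^sub>R (z - y)"] by (simp add: algebra_simps)
    also have "norm (s *\<^sub>R (z - y)) \<le> norm (z - y)" using s by (simp add: mult_left_le_one_le)
    finally have "norm (q - x) < R" using nzy y \<tau>R \<rho> by simp
    then have qU: "q \<in> U" using R by (auto simp: dist_norm norm_minus_commute)
    have "norm (y - x) < R" using y \<tau>R \<tau> \<rho> by simp
    then have "y \<in> U" using R by (auto simp: dist_norm norm_minus_commute)
    then have gy: "g (y - (y \<bullet> e) *\<^sub>R e) < y \<bullet> e" using y(2) graph by blast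
    define pw where "pw = w - (w \<bullet> e) *\<^sub>R e"
    have qe: "q \<bullet> e = y \<bullet> e + s * \<tau> + s * (w \<bullet> e)"
      by (simp add: q_def zy inner_add_left ee algebra_simps)
    have qq: "q - (q \<bullet> e) *\<^sub>R e = (y - (y \<bullet> e) *\<^sub>R e) + s *\<^sub>R pw"
      unfolding qe by (simp add: q_def zy pw_def algebra_simps)
    have "dist (g (q - (q \<bullet> e) *\<^sub>R e)) (g (y - (y \<bullet> e) *\<^sub>R e)) \<le> L * dist (q - (q \<bullet> e) *\<^sub>R e) (y - (y \<bullet> e) *\<^sub>R e)"
      using g by (rule lipschitz_onD) (auto simp: inner_diff_left ee)
    also have "dist (q - (q \<bullet> e) *\<^sub>R e) (y - (y \<bullet> e) *\<^sub>R e) = s * norm pw"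
      unfolding qq using s by (simp add: dist_norm)
    also have "norm pw \<le> norm w"
    proof -
      have "(norm pw)\<^sup>2 = (norm w)\<^sup>2 - (w \<bullet> e)\<^sup>2"
        unfolding power2_norm_eq_inner pw_def
        by (simp add: inner_diff_left inner_diff_right ee inner_commute power2_eq_square)
      then show ?thesis by (simp add: norm_le_square power2_norm_eq_inner[symmetric] flip: power2_le_iff_abs_le) 
    qed
    finally have "g (q - (q \<bullet> e) *\<^sub>R e) \<le> g (y - (y \<bullet> e) *\<^sub>R e) + L * (s * norm w)"
      using s L by (auto simp: dist_real_def mult_left_mono)
    also have "\<dots> \<le> g (y - (y \<bullet> e) *\<^sub>R e) + L * (s * (2 * \<rho>))"
      using w L s by (intro add_left_mono mult_left_mono) auto
    also have "\<dots> < y \<bullet> e + L * (s * (2 * \<rho>))" using gy by simp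
    also have "\<dots> = y \<bullet> e + s * \<tau> - s * (2 * \<rho>)" by (simp add: \<tau>_def algebra_simps)
    also have "\<dots> \<le> q \<bullet> e"
    proof -
      have "\<bar>w \<bullet> e\<bar> \<le> 2 * \<rho>" using Cauchy_Schwarz_ineq2[of w e] w e by simp
      then have "s * - (2 * \<rho>) \<le> s * (w \<bullet> e)" using s by (intro mult_left_mono) auto
      then show ?thesis by (simp add: qe)
    qed
    finally show "y + s *\<^sub>R (z - y) \<in> \<Omega>" using qU graph unfolding q_def by blast
  qed (use \<rho> \<Omega> in auto)
  then show ?thesis using \<rho> by (intro exI[of _ "ball x \<rho>"]) auto
qed

text \<open>In a finite cover by neighbourhoods with the inequality, consider a maximal subfamily on whose union it
  still holds. No other member meets this union inside \<open>\<Omega>\<close>, since it could be merged, so the union and the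
  other members would disconnect \<open>\<Omega>\<close> unless the subfamily covers \<open>\<Omega>\<close>.\<close>

lemma poincare_on_lipschitz_domain:
  fixes \<Omega> :: "(real^'n::finite) set"
  assumes p: "1 \<le> p" and dom: "bounded_lipschitz_domain \<Omega>"
  shows "poincare_on \<Omega> p \<Omega>"
proof -
  have \<Omega>: "open \<Omega>" "connected \<Omega>" "\<Omega> \<noteq> {}" "bounded \<Omega>" using dom by (auto simp: bounded_lipschitz_domain_def)
  have bd: "\<And>V. bounded (V \<inter> \<Omega>)" using \<Omega>(4) bounded_subset by blast
  have loc: "\<exists>V. open V \<and> x \<in> V \<and> poincare_on \<Omega> p (V \<inter> \<Omega>)" if x: "x \<in> closure \<Omega>" for x
  proof (cases "x \<in> \<Omega>")
    case True
    then show ?thesis using poincare_on_near_interior[OF p \<Omega>(1)] by blast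
  next
    case False
    then have "x \<in> frontier \<Omega>" using x \<Omega>(1) by (simp add: frontier_def interior_open)
    then obtain U e L g where "open U" "x \<in> U" "norm e = 1" "lipschitz_on L {z. z \<bullet> e = 0} (g :: real^'n \<Rightarrow> real)"
      "\<Omega> \<inter> U = {y \<in> U. g (y - (y \<bullet> e) *\<^sub>R e) < y \<bullet> e}"
      using dom unfolding bounded_lipschitz_domain_def by blast
    from poincare_on_near_boundary[OF p \<Omega>(1) this] show ?thesis .
  qed
  define \<V> where "\<V> = {V. open V \<and> V \<inter> \<Omega> \<noteq> {} \<and> poincare_on \<Omega> p (V \<inter> \<Omega>)}"
  have "closure \<Omega> \<subseteq> \<Union>\<V>"
  proof
    fix x assume x: "x \<in> closure \<Omega>"
    then obtain V where V: "open V" "x \<in> V" "poincare_on \<Omega> p (V \<inter> \<Omega>)" using loc by blast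
    then have "V \<inter> \<Omega> \<noteq> {}" using x by (metis IntI disjoint_iff open_Int_closure_eq_empty)
    then show "x \<in> \<Union>\<V>" using V by (auto simp: \<V>_def)
  qed
  moreover have "compact (closure \<Omega>)" using \<Omega>(4) by simp
  moreover have "\<And>V. V \<in> \<V> \<Longrightarrow> open V" by (simp add: \<V>_def)
  ultimately obtain D where D: "D \<subseteq> \<V>" "finite D" "closure \<Omega> \<subseteq> \<Union>D"
    by (meson compactE)
  define good where "good = (\<lambda>F. F \<subseteq> D \<and> F \<noteq> {} \<and> poincare_on \<Omega> p (\<Union>F \<inter> \<Omega>))"
  obtain V0 where V0: "V0 \<in> D" using D(3) \<Omega>(3) closure_subset by fastforce
  have "good {V0}" using V0 D(1) by (auto simp: good_def \<V>_def)
  moreover have fin: "finite {F. good F}"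
    by (rule finite_subset[of _ "Pow D"]) (auto simp: good_def D(2))
  ultimately obtain F where F: "good F" "\<And>F'. good F' \<Longrightarrow> F \<subseteq> F' \<Longrightarrow> F' = F"
    using finite_has_maximal2[OF fin, of "{V0}"] by (metis (no_types, lifting) mem_Collect_eq)
  define P Q where "P = \<Union>F \<inter> \<Omega>" and "Q = \<Union>(D - F) \<inter> \<Omega>"
  have op: "open P" "open Q"
    using F(1) D(1) \<Omega>(1) unfolding P_def Q_def good_def \<V>_def by (auto intro!: open_Int open_Union)
  have "\<Omega> \<subseteq> \<Union>D" using D(3) closure_subset by blast
  then have cov: "P \<union> Q = \<Omega>" unfolding P_def Q_def by blast
  have "P \<noteq> {}" using F(1) D(1) by (auto simp: P_def good_def \<V>_def)
  have "P \<inter> Q = {}"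
  proof (rule ccontr)
    assume "P \<inter> Q \<noteq> {}"
    then obtain V where V: "V \<in> D" "V \<notin> F" "P \<inter> (V \<inter> \<Omega>) \<noteq> {}" by (auto simp: P_def Q_def)
    have "poincare_on \<Omega> p (P \<union> (V \<inter> \<Omega>))"
      using V D(1) F(1) op(1) \<Omega>(1) bd
      by (intro poincare_on_Un[OF p]) (auto simp: P_def good_def \<V>_def)
    moreover have "P \<union> (V \<inter> \<Omega>) = \<Union>(insert V F) \<inter> \<Omega>" by (auto simp: P_def)
    ultimately have "good (insert V F)" using F(1) V by (auto simp: good_def)
    then show False using F(2)[of "insert V F"] V by auto
  qed
  then have "Q = {}" using \<Omega>(2) op cov \<open>P \<noteq> {}\<close> unfolding connected_def by blast
  then show ?thesis using cov F(1) by (simp add: good_def P_def)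
qed

section \<open>The \<open>L\<^sup>p\<close> norm\<close>

definition pnorm :: "'a measure \<Rightarrow> real \<Rightarrow> ('a \<Rightarrow> real) \<Rightarrow> real" where
  "pnorm M p u = (LINT x|M. \<bar>u x\<bar> powr p) powr (1 / p)"

lemma pnorm_nonneg: "0 \<le> pnorm M p u"
  by (simp add: pnorm_def)

lemma pnorm_powr: "1 \<le> p \<Longrightarrow> pnorm M p u powr p = (LINT x|M. \<bar>u x\<bar> powr p)"
  by (simp add: pnorm_def powr_powr)

lemma pnorm_leI:
  assumes "1 \<le> p" "0 \<le> a" "(LINT x|M. \<bar>u x\<bar> powr p) \<le> a powr p"
  shows "pnorm M p u \<le> a"
proof -
  have "pnorm M p u \<le> (a powr p) powr (1 / p)"
    unfolding pnorm_def using assms by (intro powr_mono2) auto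
  then show ?thesis using assms by (simp add: powr_powr)
qed

lemma integrable_powr_add:
  fixes u v :: "'a \<Rightarrow> real"
  assumes p: "1 \<le> p" and u: "u \<in> borel_measurable M" "integrable M (\<lambda>x. \<bar>u x\<bar> powr p)"
    and v: "v \<in> borel_measurable M" "integrable M (\<lambda>x. \<bar>v x\<bar> powr p)"
  shows "integrable M (\<lambda>x. \<bar>u x + v x\<bar> powr p)"
proof (rule Bochner_Integration.integrable_bound)
  show "integrable M (\<lambda>x. 2 powr p * (\<bar>u x\<bar> powr p + \<bar>v x\<bar> powr p))"
    using u v by auto
  show "AE x in M. norm (\<bar>u x + v x\<bar> powr p) \<le> norm (2 powr p * (\<bar>u x\<bar> powr p + \<bar>v x\<bar> powr p))"
  proof (rule AE_I2)
    fix x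
    have "\<bar>u x + v x\<bar> powr p \<le> (\<bar>u x\<bar> + \<bar>v x\<bar>) powr p" using p by (intro powr_mono2) auto
    also have "\<dots> \<le> 2 powr p * (\<bar>u x\<bar> powr p + \<bar>v x\<bar> powr p)" using p by (intro powr_add_le) auto
    finally show "norm (\<bar>u x + v x\<bar> powr p) \<le> norm (2 powr p * (\<bar>u x\<bar> powr p + \<bar>v x\<bar> powr p))" by simp
  qed
qed (use u v in measurable)

text \<open>Convexity of \<open>t \<mapsto> t\<^sup>p\<close>, with the weights \<open>a / (a + b)\<close> and \<open>b / (a + b)\<close> applied to \<open>u\<close> and \<open>v\<close> rescaled
  by the inverse weights.\<close>

lemma integral_powr_add_le:
  fixes u v :: "'a \<Rightarrow> real" and a b :: real
  assumes p: "1 \<le> p" and u: "u \<in> borel_measurable M" "integrable M (\<lambda>x. \<bar>u x\<bar> powr p)"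
    and v: "v \<in> borel_measurable M" "integrable M (\<lambda>x. \<bar>v x\<bar> powr p)"
    and a: "0 < a" "(LINT x|M. \<bar>u x\<bar> powr p) \<le> a powr p"
    and b: "0 < b" "(LINT x|M. \<bar>v x\<bar> powr p) \<le> b powr p"
  shows "(LINT x|M. \<bar>u x + v x\<bar> powr p) \<le> (a + b) powr p"
proof -
  define t where "t = b / (a + b)"
  have t: "0 < t" "t < 1" using a b by (auto simp: t_def)
  have ta: "1 - t = a / (a + b)" using a b by (simp add: t_def field_simps)
  let ?s = "(a + b) powr p"
  have pw: "\<bar>u x + v x\<bar> powr p \<le> (1 - t) * (?s / a powr p * \<bar>u x\<bar> powr p) + t * (?s / b powr p * \<bar>v x\<bar> powr p)" for x
  proof -
    have "\<bar>u x + v x\<bar> \<le> (1 - t) * ((a + b) / a * \<bar>u x\<bar>) + t * ((a + b) / b * \<bar>v x\<bar>)"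
      using abs_triangle_ineq[of "u x" "v x"] a(1) b(1) unfolding ta unfolding t_def by (simp add: add_pos_pos less_imp_neq)
    then have "\<bar>u x + v x\<bar> powr p \<le> ((1 - t) * ((a + b) / a * \<bar>u x\<bar>) + t * ((a + b) / b * \<bar>v x\<bar>)) powr p"
      using p by (intro powr_mono2) auto
    also have "\<dots> \<le> (1 - t) * ((a + b) / a * \<bar>u x\<bar>) powr p + t * ((a + b) / b * \<bar>v x\<bar>) powr p"
      using a b by (intro powr_convex_combination p t) auto
    finally show ?thesis using a b by (simp add: powr_mult powr_divide)
  qed
  have "(LINT x|M. \<bar>u x + v x\<bar> powr p)
      \<le> (LINT x|M. (1 - t) * (?s / a powr p * \<bar>u x\<bar> powr p) + t * (?s / b powr p * \<bar>v x\<bar> powr p))"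
    using u v by (intro integral_mono integrable_powr_add p u v pw) auto
  also have "\<dots> = (1 - t) * (?s / a powr p * (LINT x|M. \<bar>u x\<bar> powr p)) + t * (?s / b powr p * (LINT x|M. \<bar>v x\<bar> powr p))"
    using u v by simp
  also have "\<dots> \<le> (1 - t) * (?s / a powr p * a powr p) + t * (?s / b powr p * b powr p)"
    using a b t by (intro add_mono mult_left_mono) auto
  also have "\<dots> = ?s" using a b by (simp add: algebra_simps)
  finally show ?thesis .
qed

text \<open>Minkowski's inequality. Enlarging both norms by \<open>e / 2\<close> avoids division by zero.\<close>

lemma pnorm_triangle:
  assumes p: "1 \<le> p" and u: "u \<in> borel_measurable M" "integrable M (\<lambda>x. \<bar>u x\<bar> powr p)"
    and v: "v \<in> borel_measurable M" "integrable M (\<lambda>x. \<bar>v x\<bar> powr p)"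
  shows "pnorm M p (\<lambda>x. u x + v x) \<le> pnorm M p u + pnorm M p v"
proof (rule field_le_epsilon)
  fix e :: real assume e: "0 < e"
  have le: "(LINT x|M. \<bar>w x\<bar> powr p) \<le> (pnorm M p w + e / 2) powr p" for w
    using e p pnorm_nonneg[of M p w] by (subst pnorm_powr[OF p, symmetric], intro powr_mono2) auto
  have pos: "0 < pnorm M p w + e / 2" for w using pnorm_nonneg[of M p w] e by simp
  have "pnorm M p (\<lambda>x. u x + v x) \<le> (pnorm M p u + e / 2) + (pnorm M p v + e / 2)"
    using pos[of u] pos[of v] by (intro pnorm_leI[OF p] integral_powr_add_le[OF p u v] le pos) auto
  then show "pnorm M p (\<lambda>x. u x + v x) \<le> pnorm M p u + pnorm M p v + e" by simp
qed

lemma pnorm_cmult: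
  assumes "1 \<le> p" shows "pnorm M p (\<lambda>x. c * u x) = \<bar>c\<bar> * pnorm M p u"
  using assms by (simp add: pnorm_def abs_mult powr_mult powr_powr)

text \<open>Minkowski's inequality for the counting measure.\<close>

lemma sum_powr_triangle:
  fixes x y :: "'i \<Rightarrow> real"
  assumes "finite I" "1 \<le> p"
  shows "(\<Sum>i\<in>I. \<bar>x i + y i\<bar> powr p) powr (1 / p) \<le> (\<Sum>i\<in>I. \<bar>x i\<bar> powr p) powr (1 / p) + (\<Sum>i\<in>I. \<bar>y i\<bar> powr p) powr (1 / p)"
  using pnorm_triangle[of p x "count_space I" y] assms
  by (simp add: pnorm_def lebesgue_integral_count_space_finite integrable_count_space)

lemma sum_powr_le_powr_sum:
  fixes a :: "'i \<Rightarrow> real"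
  assumes "finite I" "\<And>i. i \<in> I \<Longrightarrow> 0 \<le> a i" "1 \<le> p"
  shows "(\<Sum>i\<in>I. a i powr p) \<le> (\<Sum>i\<in>I. a i) powr p"
proof -
  define s where "s = (\<Sum>i\<in>I. a i)"
  \<comment> \<open>In \<open>t\<^sup>p = t \<cdot> t\<^sup>p\<^sup>-\<^sup>1\<close> the second factor may be enlarged from \<open>a\<^sub>i\<close> to the whole sum.\<close>
  have split: "t powr p = t * t powr (p - 1)" if "0 \<le> t" for t :: real
    using that powr_add[of t 1 "p - 1"] by (cases "t = 0") auto
  have "(\<Sum>i\<in>I. a i powr p) \<le> (\<Sum>i\<in>I. a i * s powr (p - 1))"
  proof (rule sum_mono)
    fix i assume i: "i \<in> I"
    have "a i \<le> s" unfolding s_def using assms i by (intro member_le_sum) auto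
    then show "a i powr p \<le> a i * s powr (p - 1)"
      using assms i by (subst split) (auto intro!: mult_left_mono powr_mono2)
  qed
  also have "\<dots> = s powr p" using assms by (subst split) (auto simp: s_def sum_nonneg sum_distrib_right)
  finally show ?thesis by (simp add: s_def)
qed

lemma Lp_norm_eq_pnorm: "Lp_norm \<Omega> p = pnorm (lebesgue_on \<Omega>) p"
  by (auto simp: Lp_norm_def pnorm_def)

lemma Lp_norm_nonneg: "0 \<le> Lp_norm \<Omega> p u"
  by (simp add: Lp_norm_eq_pnorm pnorm_nonneg)

lemma Lp_norm_triangle:
  "1 \<le> p \<Longrightarrow> u \<in> Lp_space \<Omega> p \<Longrightarrow> v \<in> Lp_space \<Omega> p \<Longrightarrow> Lp_norm \<Omega> p (\<lambda>x. u x + v x) \<le> Lp_norm \<Omega> p u + Lp_norm \<Omega> p v"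
  by (auto simp: Lp_norm_eq_pnorm Lp_space_def intro!: pnorm_triangle)

lemma Lp_norm_cmult: "1 \<le> p \<Longrightarrow> Lp_norm \<Omega> p (\<lambda>x. c * u x) = \<bar>c\<bar> * Lp_norm \<Omega> p u"
  by (simp add: Lp_norm_eq_pnorm pnorm_cmult)

lemma Lp_space_add:
  "1 \<le> p \<Longrightarrow> u \<in> Lp_space \<Omega> p \<Longrightarrow> v \<in> Lp_space \<Omega> p \<Longrightarrow> (\<lambda>x. u x + v x) \<in> Lp_space \<Omega> p"
  by (auto simp: Lp_space_def intro!: integrable_powr_add)

lemma Lp_space_cmult: "u \<in> Lp_space \<Omega> p \<Longrightarrow> (\<lambda>x. c * u x) \<in> Lp_space \<Omega> p"
  by (auto simp: Lp_space_def abs_mult powr_mult)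

lemma Lp_norm_cong_AE:
  assumes "u \<in> borel_measurable (lebesgue_on \<Omega>)" "v \<in> borel_measurable (lebesgue_on \<Omega>)"
    "AE x in lebesgue_on \<Omega>. u x = v x"
  shows "Lp_norm \<Omega> p u = Lp_norm \<Omega> p v"
proof -
  have "(LINT x|lebesgue_on \<Omega>. \<bar>u x\<bar> powr p) = (LINT x|lebesgue_on \<Omega>. \<bar>v x\<bar> powr p)"
    using assms by (intro integral_cong_AE) auto
  then show ?thesis by (simp add: Lp_norm_def)
qed

lemma Lp_norm_eq_0_iff:
  assumes "u \<in> Lp_space \<Omega> p" "1 \<le> p"
  shows "Lp_norm \<Omega> p u = 0 \<longleftrightarrow> (AE x in lebesgue_on \<Omega>. u x = 0)"
proof -
  have "Lp_norm \<Omega> p u = 0 \<longleftrightarrow> (LINT x|lebesgue_on \<Omega>. \<bar>u x\<bar> powr p) = 0"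
    by (simp add: Lp_norm_def)
  also have "\<dots> \<longleftrightarrow> (AE x in lebesgue_on \<Omega>. \<bar>u x\<bar> powr p = 0)"
    using assms by (intro integral_nonneg_eq_0_iff_AE) (auto simp: Lp_space_def)
  finally show ?thesis by simp
qed

lemma Lp_space_continuous:
  fixes u :: "real^'n::finite \<Rightarrow> real"
  assumes \<Omega>: "open \<Omega>" "bounded \<Omega>" and u: "continuous_on UNIV u" and p: "1 \<le> p"
  shows "u \<in> Lp_space \<Omega> p"
proof -
  have um: "u \<in> borel_measurable lebesgue"
    using borel_measurable_continuous_onI[OF u] by (intro measurable_completion) auto
  then have m: "u \<in> borel_measurable (lebesgue_on \<Omega>)" by (rule measurable_restrict_space1)
  have "compact (u ` closure \<Omega>)"
    using u \<Omega>(2) by (intro compact_continuous_image) (auto intro: continuous_on_subset)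
  then obtain B where B: "\<And>x. x \<in> closure \<Omega> \<Longrightarrow> \<bar>u x\<bar> \<le> B"
    using compact_imp_bounded bounded_iff by (metis imageI real_norm_def)
  have "integrable (lebesgue_on \<Omega>) (\<lambda>x. \<bar>u x\<bar> powr p)"
  proof (rule integrableI_bounded_set[where A = \<Omega> and B = "B powr p"])
    show "\<Omega> \<in> sets (lebesgue_on \<Omega>)"
      using sets.top[of "lebesgue_on \<Omega>"] by (simp add: space_restrict_space)
    show "emeasure (lebesgue_on \<Omega>) \<Omega> < \<infinity>"
      using \<Omega> emeasure_bounded_finite[OF \<Omega>(2)] by (simp add: emeasure_restrict_space borel_open)
    show "AE x in lebesgue_on \<Omega>. x \<in> \<Omega> \<longrightarrow> norm (\<bar>u x\<bar> powr p) \<le> B powr p"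
      using B closure_subset[of \<Omega>] p by (intro AE_I2) (auto intro!: powr_mono2)
  qed (use m \<Omega> in \<open>auto intro!: AE_I2\<close>)
  then show ?thesis using m by (simp add: Lp_space_def)
qed

text \<open>A Borel measurable function that agrees almost everywhere with the extension of \<open>w\<close> by zero
  makes the product measure arguments on \<^const>\<open>lborel\<close> applicable.\<close>

lemma Lp_borel_representative:
  fixes w :: "real^'n::finite \<Rightarrow> real"
  assumes \<Omega>: "open \<Omega>" "bounded \<Omega>" and p: "1 \<le> p" and w: "w \<in> Lp_space \<Omega> p"
  obtains w' where "integrable lborel w'" "AE x in lebesgue. indicator \<Omega> x * w x = w' x"
    "(\<integral>\<^sup>+x. ennreal (\<bar>w' x\<bar> powr p) \<partial>lborel) = ennreal (Lp_norm \<Omega> p w powr p)"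
proof -
  note S = sets_lebesgue_open[OF \<Omega>(1)]
  have "(\<lambda>x. indicator \<Omega> x *\<^sub>R w x) \<in> borel_measurable lebesgue"
    using w borel_measurable_restrict_space_iff[OF S, of w] by (auto simp: Lp_space_def)
  then have wm: "(\<lambda>x. indicator \<Omega> x * w x) \<in> borel_measurable lebesgue" by simp
  obtain w' where w': "w' \<in> borel_measurable lborel" "AE x in lborel. indicator \<Omega> x * w x = w' x"
    using completion_ex_borel_measurable_real[OF wm] by blast
  have ae: "AE x in lebesgue. indicator \<Omega> x * w x = w' x" using w'(2) by (simp add: AE_completion_iff)
  have [measurable]: "w' \<in> borel_measurable borel" using w'(1) by simp
  have wi: "integrable lebesgue (\<lambda>x. indicator \<Omega> x * \<bar>w x\<bar> powr p)"
    using w integrable_restrict_space[OF S, of "\<lambda>x. \<bar>w x\<bar> powr p"] by (auto simp: Lp_space_def)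
  have "integrable lebesgue w'"
  proof (rule Bochner_Integration.integrable_bound)
    have "integrable lebesgue (indicator \<Omega> :: _ \<Rightarrow> real)"
      using \<Omega> emeasure_bounded_finite[OF \<Omega>(2)] by (auto simp: borel_open)
    then show "integrable lebesgue (\<lambda>x. indicator \<Omega> x + indicator \<Omega> x * \<bar>w x\<bar> powr p)"
      using wi by simp
    show "w' \<in> borel_measurable lebesgue" by (rule measurable_completion) simp
    show "AE x in lebesgue. norm (w' x) \<le> norm (indicator \<Omega> x + indicator \<Omega> x * \<bar>w x\<bar> powr p)"
      using ae
    proof eventually_elim
      case (elim x)
      have "\<bar>w x\<bar> \<le> 1 + \<bar>w x\<bar> powr p"
        using powr_mono[of 1 p "\<bar>w x\<bar>"] p by (cases "\<bar>w x\<bar> \<le> 1") (auto intro: order_trans add_increasing2)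
      then show ?case unfolding elim[symmetric] by (auto simp: indicator_def)
    qed
  qed
  then have 1: "integrable lborel w'" by (subst (asm) integrable_completion) auto
  have "(\<integral>\<^sup>+x. ennreal (\<bar>w' x\<bar> powr p) \<partial>lborel) = (\<integral>\<^sup>+x. ennreal (\<bar>w' x\<bar> powr p) \<partial>lebesgue)"
    by (simp add: nn_integral_completion)
  also have "\<dots> = (\<integral>\<^sup>+x. ennreal (indicator \<Omega> x * \<bar>w x\<bar> powr p) \<partial>lebesgue)"
    using ae by (intro nn_integral_cong_AE) (auto elim!: eventually_mono simp: indicator_def split: if_splits)
  also have "\<dots> = ennreal (LINT x|lebesgue. indicator \<Omega> x * \<bar>w x\<bar> powr p)"
    using wi by (intro nn_integral_eq_integral) auto
  also have "\<dots> = ennreal (Lp_norm \<Omega> p w powr p)"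
    using integral_restrict_space[OF S, of "\<lambda>x. \<bar>w x\<bar> powr p"] pnorm_powr[OF p, of "lebesgue_on \<Omega>" w]
    by (simp add: Lp_norm_eq_pnorm)
  finally show ?thesis using that 1 ae by blast
qed

lemma poincare_Lp:
  fixes \<Omega> :: "(real^'n::finite) set"
  assumes dom: "bounded_lipschitz_domain \<Omega>" and p: "1 \<le> p"
  obtains K where "0 \<le> K" "\<And>u g. u \<in> Lp_space \<Omega> p \<Longrightarrow> (\<And>i. g i \<in> Lp_space \<Omega> p) \<Longrightarrow>
    (\<And>i. has_weak_deriv \<Omega> (unit_index i) u (g i)) \<Longrightarrow>
    \<exists>c. Lp_norm \<Omega> p (\<lambda>x. u x - c) \<le> K * (\<Sum>i\<in>UNIV. Lp_norm \<Omega> p (g i))"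
proof -
  have \<Omega>: "open \<Omega>" "bounded \<Omega>" using dom by (auto simp: bounded_lipschitz_domain_def)
  note S = sets_lebesgue_open[OF \<Omega>(1)]
  obtain K where K: "0 \<le> K" "\<And>u g \<gamma>. has_weak_gradient \<Omega> u g \<Longrightarrow> 0 \<le> \<gamma> \<Longrightarrow> energy p g \<le> ennreal \<gamma> \<Longrightarrow>
     \<exists>c. deviation p \<Omega> u c \<le> ennreal (K * \<gamma>)"
    using poincare_on_lipschitz_domain[OF p dom] unfolding poincare_on_def by blast
  show ?thesis
  proof (rule that[of "K powr (1 / p)"])
    fix u g
    assume u: "u \<in> Lp_space \<Omega> p" and g: "\<And>i. g i \<in> Lp_space \<Omega> p"
      and wd: "\<And>i. has_weak_deriv \<Omega> (unit_index i) u (g i)"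
    obtain u' where u': "integrable lborel u'" "AE x in lebesgue. indicator \<Omega> x * u x = u' x"
      using Lp_borel_representative[OF \<Omega> p u] by metis
    have "\<forall>i. \<exists>w. integrable lborel w \<and> (AE x in lebesgue. indicator \<Omega> x * g i x = w x) \<and>
        (\<integral>\<^sup>+x. ennreal (\<bar>w x\<bar> powr p) \<partial>lborel) = ennreal (Lp_norm \<Omega> p (g i) powr p)"
    proof
      fix i
      show "\<exists>w. integrable lborel w \<and> (AE x in lebesgue. indicator \<Omega> x * g i x = w x) \<and>
        (\<integral>\<^sup>+x. ennreal (\<bar>w x\<bar> powr p) \<partial>lborel) = ennreal (Lp_norm \<Omega> p (g i) powr p)"
        by (rule Lp_borel_representative[OF \<Omega> p g[of i]]) blast
    qed
    from choice[OF this] obtain g' where g': "\<And>i. integrable lborel (g' i)" "\<And>i. AE x in lebesgue. indicator \<Omega> x * g i x = g' i x"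
      "\<And>i. (\<integral>\<^sup>+x. ennreal (\<bar>g' i x\<bar> powr p) \<partial>lborel) = ennreal (Lp_norm \<Omega> p (g i) powr p)"
      by blast
    have test: "(LINT x|lborel. w' x * \<phi> x) = (LINT x|lebesgue. w x * \<phi> x)"
      if "integrable lborel w'" "AE x in lebesgue. indicator \<Omega> x * w x = w' x" "test_function \<Omega> \<phi>" "locally_integrable \<Omega> w" for w w' \<phi>
    proof -
      have wm: "integrable lebesgue (\<lambda>x. w x * \<phi> x)" using that(4,3) by (rule integrable_mult_test)
      have \<phi>: "\<phi> \<in> borel_measurable borel" by (rule smooth_measurable[OF test_function_smooth[OF that(3)]])
      have m: "(\<lambda>x. w' x * \<phi> x) \<in> borel_measurable lborel" using that(1) \<phi> by auto
      have eq: "w x * \<phi> x = indicator \<Omega> x * w x * \<phi> x" for x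
        using test_function_outside[OF that(3), of x] by (cases "x \<in> \<Omega>") auto
      have "AE x in lebesgue. w' x * \<phi> x = w x * \<phi> x"
        using that(2) by eventually_elim (subst eq, simp)
      moreover have "(\<lambda>x. w' x * \<phi> x) \<in> borel_measurable lebesgue" using m by (rule measurable_completion)
      ultimately have "(LINT x|lebesgue. w' x * \<phi> x) = (LINT x|lebesgue. w x * \<phi> x)"
        using wm by (intro integral_cong_AE) auto
      then show ?thesis using m by (simp add: integral_completion)
    qed
    have "has_weak_gradient \<Omega> u' g'"
      unfolding has_weak_gradient_def
    proof (intro conjI allI impI u' g')
      fix \<phi> i assume \<phi>: "test_function \<Omega> \<phi>"
      have li: "locally_integrable \<Omega> u" "locally_integrable \<Omega> (g i)" using wd[of i] by (auto simp: has_weak_deriv_def)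
      show "(LINT x|lborel. u' x * partial i \<phi> x) = - (LINT x|lborel. g' i x * \<phi> x)"
        using wd[of i, unfolded has_weak_deriv_alt[OF \<Omega>(1)], THEN conjunct2, THEN conjunct2, rule_format, OF \<phi>]
        unfolding test[OF g'(1,2) \<phi> li(2)] test[OF u' test_function_partial[OF \<phi>] li(1)]
        by (simp add: mi_partial_unit_index[OF test_function_smooth[OF \<phi>]] mi_length_unit_index)
    qed
    moreover define \<gamma> where "\<gamma> = (\<Sum>i\<in>UNIV. Lp_norm \<Omega> p (g i) powr p)"
    moreover have "energy p g' = ennreal \<gamma>" unfolding energy_def g'(3) \<gamma>_def by simp
    ultimately obtain c where c: "deviation p \<Omega> u' c \<le> ennreal (K * \<gamma>)"
      using K(2)[of u' g' \<gamma>] by (auto simp: sum_nonneg)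
    have \<gamma>: "0 \<le> \<gamma>" by (simp add: \<gamma>_def sum_nonneg)
    have uc: "(\<lambda>x. u x - c) \<in> Lp_space \<Omega> p"
      using Lp_space_add[OF p u Lp_space_continuous[OF \<Omega> _ p, of "\<lambda>_. - c"]] by simp
    have "ennreal (Lp_norm \<Omega> p (\<lambda>x. u x - c) powr p) = ennreal (LINT x|lebesgue_on \<Omega>. \<bar>u x - c\<bar> powr p)"
      using pnorm_powr[OF p] by (simp add: Lp_norm_eq_pnorm)
    also have "\<dots> = (\<integral>\<^sup>+x. ennreal (\<bar>u x - c\<bar> powr p) \<partial>lebesgue_on \<Omega>)"
      using uc by (intro nn_integral_eq_integral[symmetric]) (auto simp: Lp_space_def)
    also have "\<dots> = (\<integral>\<^sup>+x. ennreal (\<bar>u x - c\<bar> powr p) * indicator \<Omega> x \<partial>lebesgue)"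
      by (rule nn_integral_restrict_space[OF S])
    also have "\<dots> = (\<integral>\<^sup>+x. indicator \<Omega> x * ennreal (\<bar>u' x - c\<bar> powr p) \<partial>lebesgue)"
      using u'(2) by (intro nn_integral_cong_AE) (auto elim!: eventually_mono simp: indicator_def split: if_splits)
    also have "\<dots> \<le> ennreal (K * \<gamma>)" using c by (simp add: nn_integral_completion)
    finally have "Lp_norm \<Omega> p (\<lambda>x. u x - c) powr p \<le> K * \<gamma>" using K(1) \<gamma> by (simp add: ennreal_le_iff)
    also have "\<dots> \<le> K * (\<Sum>i\<in>UNIV. Lp_norm \<Omega> p (g i)) powr p"
      unfolding \<gamma>_def using K(1) p by (intro mult_left_mono sum_powr_le_powr_sum) (auto simp: Lp_norm_nonneg)
    also have "\<dots> = (K powr (1 / p) * (\<Sum>i\<in>UNIV. Lp_norm \<Omega> p (g i))) powr p"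
      using K(1) p by (simp add: powr_mult powr_powr sum_nonneg Lp_norm_nonneg)
    finally have "Lp_norm \<Omega> p (\<lambda>x. u x - c) \<le> K powr (1 / p) * (\<Sum>i\<in>UNIV. Lp_norm \<Omega> p (g i))"
      unfolding Lp_norm_eq_pnorm pnorm_powr[OF p]
      by (intro pnorm_leI[OF p]) (auto simp: sum_nonneg pnorm_nonneg)
    then show "\<exists>c. Lp_norm \<Omega> p (\<lambda>x. u x - c) \<le> K powr (1 / p) * (\<Sum>i\<in>UNIV. Lp_norm \<Omega> p (g i))" by blast
  qed simp
qed

section \<open>Monomials\<close>

text \<open>The factorials remove all numerical factors from differentiation, which then only lowers exponents.\<close>

definition divided_power :: "('n::finite \<Rightarrow> nat) \<Rightarrow> real^'n \<Rightarrow> real" where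
  "divided_power \<alpha> x = (\<Prod>i\<in>UNIV. (x $ i) ^ \<alpha> i / fact (\<alpha> i))"

lemma smooth_divided_power: "smooth (divided_power \<alpha>)"
proof -
  have "smooth (\<lambda>x. \<Prod>i\<in>UNIV. (1 / fact (\<alpha> i)) * (x $ i) ^ \<alpha> i)"
    by (intro smooth_prod smooth_mult smooth_const smooth_power smooth_nth) simp
  then show ?thesis by (simp add: divided_power_def[abs_def])
qed

lemma divided_power_zero: "divided_power (\<lambda>_. 0) x = 1"
  by (simp add: divided_power_def)

lemma divided_power_at_0: "divided_power \<alpha> 0 = (if \<alpha> = (\<lambda>_. 0) then 1 else 0)"
proof (cases "\<alpha> = (\<lambda>_. 0)")
  case False
  then obtain i where "\<alpha> i \<noteq> 0" by auto
  then have "((0 :: real^'a) $ i) ^ \<alpha> i / fact (\<alpha> i) = 0" by simp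
  then have "divided_power \<alpha> 0 = 0" unfolding divided_power_def by (subst prod_zero_iff) auto
  then show ?thesis using False by simp
qed (simp add: divided_power_zero)

lemma partial_divided_power: "partial i (divided_power \<alpha>) = (if \<alpha> i = 0 then (\<lambda>_. 0) else divided_power (\<alpha>(i := \<alpha> i - 1)))"
proof
  fix x :: "real^'a"
  define R where "R = (\<Prod>j\<in>UNIV - {i}. (x $ j) ^ \<alpha> j / fact (\<alpha> j))"
  have line: "divided_power \<alpha> (x + t *\<^sub>R axis i 1) = (x $ i + t) ^ \<alpha> i / fact (\<alpha> i) * R" for t
    unfolding divided_power_def R_def
    by (subst prod.remove[of _ i]) (auto simp: axis_def intro!: prod.cong)
  show "partial i (divided_power \<alpha>) x = (if \<alpha> i = 0 then (\<lambda>_. 0) else divided_power (\<alpha>(i := \<alpha> i - 1))) x"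
  proof (cases "\<alpha> i")
    case 0
    then show ?thesis unfolding partial_def line by simp
  next
    case (Suc k)
    have "((\<lambda>t. (x $ i + t) ^ Suc k / fact (Suc k) * R) has_real_derivative
        real (Suc k) * (x $ i) ^ k / fact (Suc k) * R) (at 0)"
      by (auto intro!: derivative_eq_intros simp del: fact_Suc power_Suc)
    moreover have "real (Suc k) * (x $ i) ^ k / fact (Suc k) = (x $ i) ^ k / fact k"
      unfolding fact_Suc by (simp del: of_nat_Suc)
    ultimately have "((\<lambda>t. (x $ i + t) ^ Suc k / fact (Suc k) * R) has_real_derivative (x $ i) ^ k / fact k * R) (at 0)"
      by simp
    then have "partial i (divided_power \<alpha>) x = (x $ i) ^ k / fact k * R"
      unfolding partial_def line Suc by (rule DERIV_imp_deriv)
    also have "\<dots> = divided_power (\<alpha>(i := k)) x"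
      unfolding divided_power_def R_def by (subst (2) prod.remove[of _ i]) (auto intro!: prod.cong)
    finally show ?thesis using Suc by simp
  qed
qed

lemma mi_partial_const_0: "mi_partial \<gamma> (\<lambda>_. 0) = (\<lambda>_. 0)"
  by (induction \<gamma> rule: mi_induct) (simp_all only: mi_partial_zero mi_partial_Suc smooth_const partial_const)

lemma mi_partial_divided_power:
  "mi_partial \<gamma> (divided_power \<alpha>) = (if \<forall>i. \<gamma> i \<le> \<alpha> i then divided_power (\<lambda>i. \<alpha> i - \<gamma> i) else (\<lambda>_. 0))"
proof (induction \<gamma> arbitrary: \<alpha> rule: mi_induct)
  case zero
  then show ?case by (simp add: mi_partial_zero)
next
  case (Suc \<gamma> i)
  show ?case
  proof (cases "\<alpha> i = 0")
    case True
    then have "\<not> (\<forall>j. (\<gamma>(i := Suc (\<gamma> i))) j \<le> \<alpha> j)" by auto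
    moreover have "mi_partial (\<gamma>(i := Suc (\<gamma> i))) (divided_power \<alpha>) = (\<lambda>_. 0)"
      using True by (simp only: mi_partial_Suc[OF smooth_divided_power] partial_divided_power mi_partial_const_0 simp_thms if_True)
    ultimately show ?thesis by (simp only: if_False)
  next
    case False
    then have "(\<forall>j. \<gamma> j \<le> (\<alpha>(i := \<alpha> i - 1)) j) \<longleftrightarrow> (\<forall>j. (\<gamma>(i := Suc (\<gamma> i))) j \<le> \<alpha> j)"
      by (auto simp: Suc_le_eq less_imp_le_nat split: if_splits)
    moreover have "(\<lambda>j. (\<alpha>(i := \<alpha> i - 1)) j - \<gamma> j) = (\<lambda>j. \<alpha> j - (\<gamma>(i := Suc (\<gamma> i))) j)" by auto
    ultimately show ?thesis using False
      by (simp only: mi_partial_Suc[OF smooth_divided_power] partial_divided_power Suc.IH if_False)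
  qed
qed

text \<open>Unless \<open>\<gamma> = \<alpha>\<close>, an order of at least the degree means that some coordinate is differentiated more often
  than its exponent.\<close>

lemma mi_partial_divided_power_top:
  assumes "mi_length \<alpha> \<le> mi_length \<gamma>"
  shows "mi_partial \<gamma> (divided_power \<alpha>) x = (if \<gamma> = \<alpha> then 1 else 0)"
proof (cases "\<forall>i. \<gamma> i \<le> \<alpha> i")
  case True
  have "\<gamma> = \<alpha>"
  proof (rule ccontr)
    assume "\<gamma> \<noteq> \<alpha>"
    then obtain i where "\<gamma> i < \<alpha> i" using True by (metis ext le_neq_implies_less)
    then have "mi_length \<gamma> < mi_length \<alpha>"
      unfolding mi_length_def using True by (intro sum_strict_mono_ex1) auto
    then show False using assms by simp
  qed
  then show ?thesis by (simp add: mi_partial_divided_power divided_power_zero)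
qed (auto simp: mi_partial_divided_power)

definition poly_of :: "('n::finite \<Rightarrow> nat) set \<Rightarrow> (('n \<Rightarrow> nat) \<Rightarrow> real) \<Rightarrow> real^'n \<Rightarrow> real" where
  "poly_of I c x = (\<Sum>\<alpha>\<in>I. c \<alpha> * divided_power \<alpha> x)"

lemma smooth_poly_of: "finite I \<Longrightarrow> smooth (poly_of I c)"
  unfolding poly_of_def[abs_def] by (intro smooth_sum smooth_mult smooth_const smooth_divided_power)

lemma partial_sum:
  assumes "finite I" "\<And>\<alpha>. smooth (s \<alpha>)"
  shows "partial i (\<lambda>x. \<Sum>\<alpha>\<in>I. c \<alpha> * s \<alpha> x) = (\<lambda>x. \<Sum>\<alpha>\<in>I. c \<alpha> * partial i (s \<alpha>) x)"
  using assms(1)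
proof induction
  case (insert a F)
  have "smooth (\<lambda>x. \<Sum>\<alpha>\<in>F. c \<alpha> * s \<alpha> x)" "smooth (\<lambda>x. c a * s a x)"
    using insert by (intro smooth_sum smooth_mult smooth_const assms; simp)+
  then show ?case
    using insert by (simp add: partial_add smooth_differentiable partial_mult smooth_const assms partial_const)
qed (simp add: partial_const)

lemma mi_partial_sum:
  assumes "finite I" "\<And>\<alpha>. smooth (s \<alpha>)"
  shows "mi_partial \<gamma> (\<lambda>x. \<Sum>\<alpha>\<in>I. c \<alpha> * s \<alpha> x) = (\<lambda>x. \<Sum>\<alpha>\<in>I. c \<alpha> * mi_partial \<gamma> (s \<alpha>) x)"
  using assms(2)
proof (induction \<gamma> arbitrary: s rule: mi_induct)
  case (Suc \<gamma> i)
  have "smooth (\<lambda>x. \<Sum>\<alpha>\<in>I. c \<alpha> * s \<alpha> x)" by (intro smooth_sum smooth_mult smooth_const Suc.prems assms(1))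
  then show ?case
    by (simp only: mi_partial_Suc partial_sum[OF assms(1) Suc.prems] Suc.IH[OF smooth_partial[OF Suc.prems]] Suc.prems)
qed (simp add: mi_partial_zero)

lemma mi_partial_poly_of:
  "finite I \<Longrightarrow> mi_partial \<gamma> (poly_of I c) = (\<lambda>x. \<Sum>\<alpha>\<in>I. c \<alpha> * mi_partial \<gamma> (divided_power \<alpha>) x)"
  using mi_partial_sum[of I divided_power \<gamma> c] by (simp add: smooth_divided_power poly_of_def[abs_def])

lemma mi_partial_poly_of_top:
  assumes "finite I" "\<And>\<alpha>. \<alpha> \<in> I \<Longrightarrow> mi_length \<alpha> \<le> mi_length \<gamma> \<or> c \<alpha> = 0"
  shows "mi_partial \<gamma> (poly_of I c) = (\<lambda>x. if \<gamma> \<in> I then c \<gamma> else 0)"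
proof
  fix x
  have "mi_partial \<gamma> (poly_of I c) x = (\<Sum>\<alpha>\<in>I. if \<gamma> = \<alpha> then c \<alpha> else 0)"
    unfolding mi_partial_poly_of[OF assms(1)]
  proof (rule sum.cong)
    fix \<alpha> assume "\<alpha> \<in> I"
    then show "c \<alpha> * mi_partial \<gamma> (divided_power \<alpha>) x = (if \<gamma> = \<alpha> then c \<alpha> else 0)"
      using assms(2)[of \<alpha>] mi_partial_divided_power_top[of \<alpha> \<gamma> x] by auto
  qed simp
  then show "mi_partial \<gamma> (poly_of I c) x = (if \<gamma> \<in> I then c \<gamma> else 0)" using assms(1) by simp
qed

text \<open>Divided powers are dual to the derivatives at the origin.\<close>

lemma poly_of_coefficient:
  assumes "finite I" "\<gamma> \<in> I" shows "mi_partial \<gamma> (poly_of I c) 0 = c \<gamma>"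
proof -
  have "mi_partial \<gamma> (divided_power \<alpha>) 0 = (if \<alpha> = \<gamma> then 1 else 0)" for \<alpha>
  proof -
    have "\<alpha> = \<gamma>" if "\<forall>i. \<gamma> i \<le> \<alpha> i" "(\<lambda>i. \<alpha> i - \<gamma> i) = (\<lambda>_. 0)"
      using that by (metis diff_is_0_eq eq_iff ext)
    then show ?thesis by (auto simp: mi_partial_divided_power divided_power_at_0)
  qed
  then show ?thesis using assms by (simp add: mi_partial_poly_of if_distrib[of "\<lambda>z. _ * z"] cong: if_cong)
qed

section \<open>Sobolev spaces on bounded open sets\<close>

locale bounded_open =
  fixes \<Omega> :: "(real^'n::finite) set" and p :: real
  assumes open_\<Omega>: "open \<Omega>" and bounded_\<Omega>: "bounded \<Omega>" and p: "1 \<le> p"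
begin

definition dnorm :: "('n \<Rightarrow> nat) \<Rightarrow> (real^'n \<Rightarrow> real) \<Rightarrow> real" where
  "dnorm \<alpha> u = Lp_norm \<Omega> p (weak_deriv \<Omega> \<alpha> u)"

abbreviation top_dnorm :: "nat \<Rightarrow> (real^'n \<Rightarrow> real) \<Rightarrow> real" where
  "top_dnorm k u \<equiv> (\<Sum>\<gamma> | mi_length \<gamma> = k. dnorm \<gamma> u)"

lemma dnorm_nonneg: "0 \<le> dnorm \<alpha> u"
  by (simp add: dnorm_def Lp_norm_nonneg)

text \<open>Lebesgue measure is complete, so measurability passes to functions that agree almost everywhere. This is
  needed for the weak derivative selected by \<^const>\<open>weak_deriv\<close>, which is a priori only locally integrable.\<close>

lemma Lp_space_AE:
  assumes u: "u \<in> Lp_space \<Omega> p" and uv: "AE x in lebesgue_on \<Omega>. u x = v x"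
  shows "v \<in> Lp_space \<Omega> p"
proof -
  note S = sets_lebesgue_open[OF open_\<Omega>]
  have um: "u \<in> borel_measurable (lebesgue_on \<Omega>)" using u by (simp add: Lp_space_def)
  have "AE x in lebesgue. indicator \<Omega> x *\<^sub>R u x = indicator \<Omega> x *\<^sub>R v x"
    using uv unfolding AE_lebesgue_on_iff[OF open_\<Omega>] by eventually_elim (auto simp: indicator_def)
  moreover have "(\<lambda>x. indicator \<Omega> x *\<^sub>R u x) \<in> borel_measurable lebesgue"
    using um borel_measurable_restrict_space_iff[OF S, of u] by auto
  ultimately have "(\<lambda>x. indicator \<Omega> x *\<^sub>R v x) \<in> borel_measurable lebesgue"
    by (rule borel_measurable_AE[rotated])
  then have vm: "v \<in> borel_measurable (lebesgue_on \<Omega>)"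
    using borel_measurable_restrict_space_iff[OF S, of v] by auto
  have "integrable (lebesgue_on \<Omega>) (\<lambda>x. \<bar>u x\<bar> powr p) = integrable (lebesgue_on \<Omega>) (\<lambda>x. \<bar>v x\<bar> powr p)"
    using um vm uv by (intro integrable_cong_AE) auto
  then show ?thesis using u vm by (simp add: Lp_space_def)
qed

lemma weak_deriv_Lp:
  assumes "has_weak_deriv \<Omega> \<alpha> u w" "w \<in> Lp_space \<Omega> p"
  shows "has_weak_deriv \<Omega> \<alpha> u (weak_deriv \<Omega> \<alpha> u)" "weak_deriv \<Omega> \<alpha> u \<in> Lp_space \<Omega> p"
    "dnorm \<alpha> u = Lp_norm \<Omega> p w"
proof -
  show hw: "has_weak_deriv \<Omega> \<alpha> u (weak_deriv \<Omega> \<alpha> u)"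
    unfolding weak_deriv_def using assms(1) by (rule someI[of "has_weak_deriv \<Omega> \<alpha> u"])
  have ae: "AE x in lebesgue_on \<Omega>. w x = weak_deriv \<Omega> \<alpha> u x"
    using has_weak_deriv_unique[OF open_\<Omega> assms(1) hw] by simp
  show L: "weak_deriv \<Omega> \<alpha> u \<in> Lp_space \<Omega> p" by (rule Lp_space_AE[OF assms(2) ae])
  show "dnorm \<alpha> u = Lp_norm \<Omega> p w"
    unfolding dnorm_def using L assms(2) ae by (intro Lp_norm_cong_AE[symmetric]) (auto simp: Lp_space_def)
qed

lemma sobolev_weak_deriv:
  assumes "u \<in> sobolev_space \<Omega> k p" "mi_length \<alpha> \<le> k"
  shows "has_weak_deriv \<Omega> \<alpha> u (weak_deriv \<Omega> \<alpha> u)" "weak_deriv \<Omega> \<alpha> u \<in> Lp_space \<Omega> p"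
  using assms weak_deriv_Lp unfolding sobolev_space_def Ind_def by blast+

lemma sobolev_add:
  "u \<in> sobolev_space \<Omega> k p \<Longrightarrow> v \<in> sobolev_space \<Omega> k p \<Longrightarrow> (\<lambda>x. u x + v x) \<in> sobolev_space \<Omega> k p"
  unfolding sobolev_space_def using has_weak_deriv_add[OF open_\<Omega>] Lp_space_add[OF p] by blast

lemma sobolev_cmult: "u \<in> sobolev_space \<Omega> k p \<Longrightarrow> (\<lambda>x. c * u x) \<in> sobolev_space \<Omega> k p"
  unfolding sobolev_space_def using has_weak_deriv_cmult[OF open_\<Omega>] Lp_space_cmult by blast

lemma sobolev_diff:
  "u \<in> sobolev_space \<Omega> k p \<Longrightarrow> v \<in> sobolev_space \<Omega> k p \<Longrightarrow> (\<lambda>x. u x - v x) \<in> sobolev_space \<Omega> k p"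
  using sobolev_add[of u k "\<lambda>x. (- 1) * v x"] sobolev_cmult[of v k "- 1"] by simp

lemma Lp_space_smooth: "smooth s \<Longrightarrow> s \<in> Lp_space \<Omega> p"
  by (intro Lp_space_continuous open_\<Omega> bounded_\<Omega> p smooth_continuous)

lemma sobolev_smooth: "smooth s \<Longrightarrow> s \<in> sobolev_space \<Omega> k p"
  unfolding sobolev_space_def
  using has_weak_deriv_smooth[OF open_\<Omega>] Lp_space_smooth smooth_mi_partial by blast

lemma dnorm_smooth: "smooth s \<Longrightarrow> dnorm \<alpha> s = Lp_norm \<Omega> p (mi_partial \<alpha> s)"
  by (rule weak_deriv_Lp(3)) (auto intro: has_weak_deriv_smooth open_\<Omega> Lp_space_smooth smooth_mi_partial)

lemma dnorm_add:
  assumes "u \<in> sobolev_space \<Omega> k p" "v \<in> sobolev_space \<Omega> k p" "mi_length \<alpha> \<le> k"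
  shows "dnorm \<alpha> (\<lambda>x. u x + v x) \<le> dnorm \<alpha> u + dnorm \<alpha> v"
proof -
  note u = sobolev_weak_deriv[OF assms(1,3)] and v = sobolev_weak_deriv[OF assms(2,3)]
  have "dnorm \<alpha> (\<lambda>x. u x + v x) = Lp_norm \<Omega> p (\<lambda>x. weak_deriv \<Omega> \<alpha> u x + weak_deriv \<Omega> \<alpha> v x)"
    by (rule weak_deriv_Lp(3)[OF has_weak_deriv_add[OF open_\<Omega> u(1) v(1)] Lp_space_add[OF p u(2) v(2)]])
  then show ?thesis unfolding dnorm_def using Lp_norm_triangle[OF p u(2) v(2)] by simp
qed

lemma dnorm_cmult:
  assumes "u \<in> sobolev_space \<Omega> k p" "mi_length \<alpha> \<le> k"
  shows "dnorm \<alpha> (\<lambda>x. c * u x) = \<bar>c\<bar> * dnorm \<alpha> u"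
proof -
  note u = sobolev_weak_deriv[OF assms]
  have "dnorm \<alpha> (\<lambda>x. c * u x) = Lp_norm \<Omega> p (\<lambda>x. c * weak_deriv \<Omega> \<alpha> u x)"
    by (rule weak_deriv_Lp(3)[OF has_weak_deriv_cmult[OF open_\<Omega> u(1)] Lp_space_cmult[OF u(2)]])
  then show ?thesis unfolding dnorm_def using Lp_norm_cmult[OF p] by simp
qed

lemma seminorm_dnorm: "mi_length \<alpha> \<le> k \<Longrightarrow> seminorm_on (sobolev_space \<Omega> k p) (dnorm \<alpha>)"
  unfolding seminorm_on_def using dnorm_add dnorm_cmult dnorm_nonneg by blast

lemma dnorm_zero:
  assumes "u \<in> sobolev_space \<Omega> k p" shows "dnorm (\<lambda>_. 0) u = Lp_norm \<Omega> p u"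
proof (rule weak_deriv_Lp(3))
  show "u \<in> Lp_space \<Omega> p" using assms by (simp add: sobolev_space_def)
  have "locally_integrable \<Omega> u"
    using sobolev_weak_deriv(1)[OF assms, of "\<lambda>_. 0"] by (simp add: has_weak_deriv_def mi_length_def)
  then show "has_weak_deriv \<Omega> (\<lambda>_. 0) u u"
    by (simp add: has_weak_deriv_def mi_length_def mi_partial_zero)
qed

lemma dnorm_cong_AE:
  assumes "u \<in> sobolev_space \<Omega> k p" "v \<in> sobolev_space \<Omega> k p" "mi_length \<alpha> \<le> k"
    and "AE x in lebesgue_on \<Omega>. u x = v x"
  shows "dnorm \<alpha> u = dnorm \<alpha> v"
proof -
  note u = sobolev_weak_deriv[OF assms(1,3)] and v = sobolev_weak_deriv[OF assms(2,3)]
  show ?thesis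
    unfolding dnorm_def using u(2) v(2) has_weak_deriv_unique[OF open_\<Omega> u(1) v(1) assms(4)]
    by (intro Lp_norm_cong_AE) (auto simp: Lp_space_def)
qed

lemma dnorm_sobolev_norm_bounds:
  shows "mi_length \<alpha> \<le> k \<Longrightarrow> dnorm \<alpha> u \<le> sobolev_norm \<Omega> k p u"
    and "sobolev_norm \<Omega> k p u \<le> (\<Sum>\<alpha>\<in>Ind k. dnorm \<alpha> u)"
proof -
  have eq: "sobolev_norm \<Omega> k p u = (\<Sum>\<alpha>\<in>Ind k. dnorm \<alpha> u powr p) powr (1 / p)"
    by (simp add: sobolev_norm_def dnorm_def)
  have root: "(a powr p) powr (1 / p) = a" if "0 \<le> a" for a :: real
    using that p by (simp add: powr_powr)
  show "dnorm \<alpha> u \<le> sobolev_norm \<Omega> k p u" if "mi_length \<alpha> \<le> k"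
  proof -
    have "dnorm \<alpha> u powr p \<le> (\<Sum>\<alpha>\<in>Ind k. dnorm \<alpha> u powr p)"
      using that by (intro member_le_sum) (auto simp: Ind_def finite_Ind[unfolded Ind_def])
    then have "(dnorm \<alpha> u powr p) powr (1 / p) \<le> sobolev_norm \<Omega> k p u"
      unfolding eq using p by (intro powr_mono2) auto
    then show ?thesis by (simp add: root dnorm_nonneg)
  qed
  have "sobolev_norm \<Omega> k p u \<le> ((\<Sum>\<alpha>\<in>Ind k. dnorm \<alpha> u) powr p) powr (1 / p)"
    unfolding eq using p
    by (intro powr_mono2 sum_powr_le_powr_sum sum_nonneg) (auto simp: finite_Ind dnorm_nonneg)
  then show "sobolev_norm \<Omega> k p u \<le> (\<Sum>\<alpha>\<in>Ind k. dnorm \<alpha> u)"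
    by (simp add: root sum_nonneg dnorm_nonneg)
qed

section \<open>Approximation by polynomials\<close>

text \<open>One order of differentiation at a time, from the top: subtracting the monomials of degree
  \<open>m\<close> changes the derivatives of order \<open>m\<close> by the constants that the Poincare inequality calls for
  and leaves those of higher order alone.\<close>

lemma bramble_hilbert_level:
  assumes K: "0 \<le> K" "\<And>u g. u \<in> Lp_space \<Omega> p \<Longrightarrow> (\<And>i. g i \<in> Lp_space \<Omega> p) \<Longrightarrow>
    (\<And>i. has_weak_deriv \<Omega> (unit_index i) u (g i)) \<Longrightarrow>
    \<exists>c. Lp_norm \<Omega> p (\<lambda>x. u x - c) \<le> K * (\<Sum>i\<in>UNIV. Lp_norm \<Omega> p (g i))"
  shows "j \<le> r + 1 \<Longrightarrow> \<exists>C\<ge>0. \<forall>v\<in>sobolev_space \<Omega> (r + 1) p. \<exists>c. \<forall>\<gamma>.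
    mi_length \<gamma> \<le> r + 1 \<longrightarrow> r + 1 \<le> mi_length \<gamma> + j \<longrightarrow>
    dnorm \<gamma> (\<lambda>x. v x - poly_of (Ind r) c x) \<le> C * top_dnorm (r + 1) v"
proof (induction j)
  case 0
  show ?case
  proof (rule exI[of _ 1], intro conjI ballI)
    fix v assume "v \<in> sobolev_space \<Omega> (r + 1) p"
    have "dnorm \<gamma> v \<le> top_dnorm (r + 1) v" if "mi_length \<gamma> = r + 1" for \<gamma>
      using that by (intro member_le_sum) (auto simp: dnorm_nonneg finite_mi_length_eq)
    then show "\<exists>c. \<forall>\<gamma>. mi_length \<gamma> \<le> r + 1 \<longrightarrow> r + 1 \<le> mi_length \<gamma> + 0 \<longrightarrow>
      dnorm \<gamma> (\<lambda>x. v x - poly_of (Ind r) c x) \<le> 1 * top_dnorm (r + 1) v"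
      by (intro exI[of _ "\<lambda>_. 0"]) (auto simp: poly_of_def)
  qed simp
next
  case (Suc j)
  then obtain C where C: "0 \<le> C" "\<And>v. v \<in> sobolev_space \<Omega> (r + 1) p \<Longrightarrow> \<exists>c. \<forall>\<gamma>.
    mi_length \<gamma> \<le> r + 1 \<longrightarrow> r + 1 \<le> mi_length \<gamma> + j \<longrightarrow>
    dnorm \<gamma> (\<lambda>x. v x - poly_of (Ind r) c x) \<le> C * top_dnorm (r + 1) v"
    by (meson Suc_leD)
  define m where "m = r - j"
  have m: "m + j = r" using Suc.prems by (simp add: m_def)
  define C' where "C' = C + K * (real CARD('n) * C)"
  have C': "0 \<le> C'" "C \<le> C'" "K * (real CARD('n) * C) \<le> C'" using C(1) K(1) by (auto simp: C'_def)
  show ?case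
  proof (rule exI[of _ C'], intro conjI ballI)
    fix v assume v: "v \<in> sobolev_space \<Omega> (r + 1) p"
    define T where "T = top_dnorm (r + 1) v"
    have T: "0 \<le> T" by (simp add: T_def sum_nonneg dnorm_nonneg)
    obtain c where c: "\<And>\<gamma>. mi_length \<gamma> \<le> r + 1 \<Longrightarrow> r + 1 \<le> mi_length \<gamma> + j \<Longrightarrow>
      dnorm \<gamma> (\<lambda>x. v x - poly_of (Ind r) c x) \<le> C * T"
      using C(2)[OF v] unfolding T_def by blast
    define w where "w = (\<lambda>x. v x - poly_of (Ind r) c x)"
    have w: "w \<in> sobolev_space \<Omega> (r + 1) p"
      unfolding w_def by (intro sobolev_diff v sobolev_smooth smooth_poly_of finite_Ind)
    have ex: "\<exists>b. Lp_norm \<Omega> p (\<lambda>x. weak_deriv \<Omega> \<gamma> w x - b) \<le> C' * T" if \<gamma>: "mi_length \<gamma> = m" for \<gamma>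
    proof -
      have len: "mi_length \<gamma> \<le> r + 1" "mi_length (\<gamma>(i := Suc (\<gamma> i))) \<le> r + 1"
        "r + 1 \<le> mi_length (\<gamma>(i := Suc (\<gamma> i))) + j" for i
        unfolding mi_length_Suc \<gamma> using m by auto
      note w0 = sobolev_weak_deriv[OF w len(1)] and w1 = sobolev_weak_deriv[OF w len(2)]
      obtain b where "Lp_norm \<Omega> p (\<lambda>x. weak_deriv \<Omega> \<gamma> w x - b)
          \<le> K * (\<Sum>i\<in>UNIV. Lp_norm \<Omega> p (weak_deriv \<Omega> (\<gamma>(i := Suc (\<gamma> i))) w))"
        using K(2)[OF w0(2) w1(2) has_weak_deriv_step[OF open_\<Omega> w0(1) w1(1)]] by blast
      also have "\<dots> \<le> K * (\<Sum>i\<in>(UNIV :: 'n set). C * T)"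
        using c[OF len(2,3)] K(1) by (intro mult_left_mono sum_mono) (auto simp: dnorm_def w_def)
      also have "\<dots> = K * (real CARD('n) * C) * T" by simp
      also have "\<dots> \<le> C' * T" using C'(3) T by (rule mult_right_mono)
      finally show ?thesis by blast
    qed
    then obtain b where b: "\<And>\<gamma>. mi_length \<gamma> = m \<Longrightarrow> Lp_norm \<Omega> p (\<lambda>x. weak_deriv \<Omega> \<gamma> w x - b \<gamma>) \<le> C' * T"
      by metis
    define b' where "b' = (\<lambda>\<gamma>. if mi_length \<gamma> = m then b \<gamma> else 0)"
    have split: "v x - poly_of (Ind r) (\<lambda>\<alpha>. c \<alpha> + b' \<alpha>) x = w x + (- 1) * poly_of (Ind r) b' x" for x
      by (simp add: w_def poly_of_def sum.distrib distrib_right)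
    have "dnorm \<gamma> (\<lambda>x. w x + (- 1) * poly_of (Ind r) b' x) \<le> C' * T"
      if \<gamma>: "mi_length \<gamma> \<le> r + 1" "m \<le> mi_length \<gamma>" for \<gamma>
    proof -
      have top: "mi_partial \<gamma> (poly_of (Ind r) b') = (\<lambda>x. b' \<gamma>)"
      proof -
        have "\<gamma> \<notin> Ind r \<Longrightarrow> b' \<gamma> = 0" using m by (auto simp: b'_def Ind_def)
        then show ?thesis
          using \<gamma> by (subst mi_partial_poly_of_top) (auto simp: finite_Ind b'_def)
      qed
      have "has_weak_deriv \<Omega> \<gamma> (poly_of (Ind r) b') (\<lambda>x. b' \<gamma>)"
        using has_weak_deriv_smooth[OF open_\<Omega> smooth_poly_of[OF finite_Ind], of \<gamma> r b'] by (simp add: top)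
      note wd = has_weak_deriv_add[OF open_\<Omega> sobolev_weak_deriv(1)[OF w \<gamma>(1)] has_weak_deriv_cmult[OF open_\<Omega> this, of "- 1"]]
      have "(\<lambda>x. weak_deriv \<Omega> \<gamma> w x + (- 1) * b' \<gamma>) \<in> Lp_space \<Omega> p"
        by (intro Lp_space_add p sobolev_weak_deriv(2)[OF w \<gamma>(1)] Lp_space_smooth smooth_const)
      from weak_deriv_Lp(3)[OF wd this]
      have eq: "dnorm \<gamma> (\<lambda>x. w x + (- 1) * poly_of (Ind r) b' x) = Lp_norm \<Omega> p (\<lambda>x. weak_deriv \<Omega> \<gamma> w x - b' \<gamma>)"
        by simp
      show ?thesis
      proof (cases "mi_length \<gamma> = m")
        case True
        then show ?thesis unfolding eq using b[OF True] by (simp add: b'_def)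
      next
        case False
        then have "dnorm \<gamma> w \<le> C * T" unfolding w_def using \<gamma> m by (intro c) auto
        also have "\<dots> \<le> C' * T" using C'(2) T by (rule mult_right_mono)
        finally show ?thesis unfolding eq using False by (simp add: b'_def dnorm_def)
      qed
    qed
    then show "\<exists>c. \<forall>\<gamma>. mi_length \<gamma> \<le> r + 1 \<longrightarrow> r + 1 \<le> mi_length \<gamma> + Suc j \<longrightarrow>
      dnorm \<gamma> (\<lambda>x. v x - poly_of (Ind r) c x) \<le> C' * top_dnorm (r + 1) v"
      using m unfolding T_def[symmetric]
      by (intro exI[of _ "\<lambda>\<alpha>. c \<alpha> + b' \<alpha>"]) (auto simp: split)
  qed (rule C')
qed

end

text \<open>After \<open>r + 1\<close> of the preceding steps order \<open>0\<close> is reached, and a single polynomial serves all orders.\<close>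

lemma bramble_hilbert:
  fixes \<Omega> :: "(real^'n::finite) set"
  assumes dom: "bounded_lipschitz_domain \<Omega>" and p: "1 \<le> p"
  obtains C where "0 \<le> C" "\<And>v. v \<in> sobolev_space \<Omega> (r + 1) p \<Longrightarrow> \<exists>c. \<forall>\<gamma>. mi_length \<gamma> \<le> r + 1 \<longrightarrow>
    Lp_norm \<Omega> p (weak_deriv \<Omega> \<gamma> (\<lambda>x. v x - poly_of (Ind r) c x))
      \<le> C * (\<Sum>\<gamma> | mi_length \<gamma> = r + 1. Lp_norm \<Omega> p (weak_deriv \<Omega> \<gamma> v))"
proof -
  interpret bounded_open \<Omega> p
    using dom p by unfold_locales (auto simp: bounded_lipschitz_domain_def)
  obtain K where K: "0 \<le> K" "\<And>u g. u \<in> Lp_space \<Omega> p \<Longrightarrow> (\<And>i. g i \<in> Lp_space \<Omega> p) \<Longrightarrow>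
    (\<And>i. has_weak_deriv \<Omega> (unit_index i) u (g i)) \<Longrightarrow>
    \<exists>c. Lp_norm \<Omega> p (\<lambda>x. u x - c) \<le> K * (\<Sum>i\<in>UNIV. Lp_norm \<Omega> p (g i))"
    using poincare_Lp[OF dom p] by blast
  from bramble_hilbert_level[OF K, of "r + 1" r, OF _ _ _ order_refl] obtain C where "0 \<le> C"
    "\<And>v. v \<in> sobolev_space \<Omega> (r + 1) p \<Longrightarrow> \<exists>c. \<forall>\<gamma>.
    mi_length \<gamma> \<le> r + 1 \<longrightarrow> r + 1 \<le> mi_length \<gamma> + (r + 1) \<longrightarrow>
    dnorm \<gamma> (\<lambda>x. v x - poly_of (Ind r) c x) \<le> C * top_dnorm (r + 1) v"
    by blast
  with that[of C] show ?thesis unfolding dnorm_def by simp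
qed

section \<open>Seminorms on a space of coefficients\<close>

text \<open>A seminorm on the finite-dimensional space of families indexed by \<open>I\<close>. Families are total functions, and
  the last assumption states that only their values on \<open>I\<close> matter.\<close>

locale coefficient_seminorm =
  fixes I :: "'i set" and M :: "('i \<Rightarrow> real) \<Rightarrow> real"
  assumes finite_I: "finite I"
    and nonneg: "0 \<le> M c"
    and triangle: "M (\<lambda>i. c i + d i) \<le> M c + M d"
    and scale: "M (\<lambda>i. t * c i) = \<bar>t\<bar> * M c"
    and local: "(\<And>i. i \<in> I \<Longrightarrow> c i = d i) \<Longrightarrow> M c = M d"
begin

lemma le_sum_coefficients: "M c \<le> (\<Sum>i\<in>I. \<bar>c i\<bar> * M (\<lambda>j. if j = i then 1 else 0))"
proof -
  have "M (\<lambda>i. if i \<in> F then c i else 0) \<le> (\<Sum>i\<in>F. \<bar>c i\<bar> * M (\<lambda>j. if j = i then 1 else 0))" if "finite F" for F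
    using that
  proof induction
    case empty
    then show ?case using scale[of 0 "\<lambda>_. 0"] by simp
  next
    case (insert a F)
    have "(\<lambda>i. if i \<in> insert a F then c i else 0) = (\<lambda>i. c a * (if i = a then 1 else 0) + (if i \<in> F then c i else 0))"
      using insert(2) by auto
    then show ?case
      using triangle[of "\<lambda>i. c a * (if i = a then 1 else 0)" "\<lambda>i. if i \<in> F then c i else 0"] insert
      by (simp add: scale)
  qed
  from this[OF finite_I] show ?thesis using local[of "\<lambda>i. if i \<in> I then c i else 0" c] by simp
qed

lemma continuous_on_M: "continuous_on S M"
  unfolding continuous_on_def
proof
  fix c assume "c \<in> S"
  define g where "g = (\<lambda>d. \<Sum>i\<in>I. \<bar>d i - c i\<bar> * M (\<lambda>j. if j = i then 1 else 0))"
  have "continuous_on UNIV g"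
    unfolding g_def by (intro continuous_intros continuous_on_product_coordinates)
  then have "(g \<longlongrightarrow> g c) (at c within S)"
    using continuous_on_subset[of UNIV g "insert c S"] \<open>c \<in> S\<close> unfolding continuous_on_def by (simp add: insert_absorb)
  then have lim: "(g \<longlongrightarrow> 0) (at c within S)" by (simp add: g_def)
  have "norm (M d - M c) \<le> g d" for d
  proof -
    have "M d \<le> M c + M (\<lambda>i. d i - c i)" using triangle[of c "\<lambda>i. d i - c i"] by simp
    moreover have "M c \<le> M d + M (\<lambda>i. d i - c i)"
      using triangle[of d "\<lambda>i. (- 1) * (d i - c i)"] scale[of "- 1" "\<lambda>i. d i - c i"] by simp
    moreover have "M (\<lambda>i. d i - c i) \<le> g d" unfolding g_def by (rule le_sum_coefficients)
    ultimately show ?thesis by (simp add: abs_if)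
  qed
  then have "((\<lambda>d. M d - M c) \<longlongrightarrow> 0) (at c within S)"
    by (intro Lim_null_comparison[OF always_eventually lim]) simp
  then show "(M \<longlongrightarrow> M c) (at c within S)" by (simp add: LIM_zero_iff)
qed

text \<open>The unit sphere of the \<open>\<ell>\<^sup>1\<close> norm is compact in the product topology once the coordinates outside \<open>I\<close> are
  fixed to \<open>0\<close>, so the continuous function \<open>M\<close> attains a positive minimum there.\<close>

lemma definite_imp_controls_coefficients:
  assumes definite: "\<And>c i. M c = 0 \<Longrightarrow> i \<in> I \<Longrightarrow> c i = 0"
  shows "\<exists>K\<ge>0. \<forall>c. (\<Sum>i\<in>I. \<bar>c i\<bar>) \<le> K * M c"
proof (cases "I = {}")
  case True
  then show ?thesis using nonneg by (intro exI[of _ 0]) simp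
next
  case False
  define B where "B = PiE UNIV (\<lambda>i. if i \<in> I then {-1..1::real} else {0})"
  define S where "S = B \<inter> {c. (\<Sum>i\<in>I. \<bar>c i\<bar>) = 1}"
  have "compactin (product_topology (\<lambda>i. euclidean) UNIV) B"
    unfolding B_def by (subst compactin_PiE) auto
  then have "compact B" by (simp add: euclidean_product_topology)
  moreover have "closed {c :: 'i \<Rightarrow> real. (\<Sum>i\<in>I. \<bar>c i\<bar>) = 1}"
    by (intro closed_Collect_eq continuous_intros continuous_on_product_coordinates)
  ultimately have "compact S" unfolding S_def by (rule compact_Int_closed)
  have normalise: "\<exists>d\<in>S. M c = s * M d" if s: "s = (\<Sum>i\<in>I. \<bar>c i\<bar>)" "s > 0" for c s
  proof
    define d where "d = (\<lambda>i. if i \<in> I then c i / s else 0)"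
    have "\<bar>c i\<bar> \<le> s" if "i \<in> I" for i unfolding s(1) using that finite_I by (intro member_le_sum) auto
    then have "d \<in> B" using s(2) by (auto simp: B_def d_def abs_le_iff divide_le_eq le_divide_eq minus_le_iff)
    moreover have "(\<Sum>i\<in>I. \<bar>d i\<bar>) = 1"
      using s by (simp add: d_def flip: sum_divide_distrib)
    ultimately show "d \<in> S" by (simp add: S_def)
    have "M c = M (\<lambda>i. s * d i)" using s(2) by (intro local) (simp add: d_def)
    then show "M c = s * M d" using s(2) by (simp add: scale)
  qed
  obtain i where "i \<in> I" using False by blast
  have "(\<Sum>j\<in>I. \<bar>if j = i then 1 else 0::real\<bar>) = (\<Sum>j\<in>I. if j = i then 1 else 0)"
    by (intro sum.cong) auto
  also have "\<dots> = 1" using \<open>i \<in> I\<close> finite_I by simp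
  finally have "S \<noteq> {}" using normalise[of 1 "\<lambda>j. if j = i then 1 else 0"] by auto
  then obtain d where d: "d \<in> S" "\<And>c. c \<in> S \<Longrightarrow> M d \<le> M c"
    using continuous_attains_inf[OF \<open>compact S\<close> _ continuous_on_M] by blast
  have "M d \<noteq> 0"
  proof
    assume "M d = 0"
    then have "\<And>i. i \<in> I \<Longrightarrow> d i = 0" by (rule definite)
    then show False using d(1) by (simp add: S_def)
  qed
  then have pos: "M d > 0" using nonneg[of d] by simp
  have "(\<Sum>i\<in>I. \<bar>c i\<bar>) \<le> 1 / M d * M c" for c
  proof (cases "(\<Sum>i\<in>I. \<bar>c i\<bar>) = 0")
    case True
    then show ?thesis using pos nonneg[of c] by simp
  next
    case False
    then have s: "(\<Sum>i\<in>I. \<bar>c i\<bar>) > 0" by (simp add: order_less_le sum_nonneg)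
    obtain e where e: "e \<in> S" "M c = (\<Sum>i\<in>I. \<bar>c i\<bar>) * M e" using normalise[OF refl s] by blast
    have "(\<Sum>i\<in>I. \<bar>c i\<bar>) * M d \<le> M c" unfolding e(2) using s d(2)[OF e(1)] by (intro mult_left_mono) auto
    then show ?thesis using pos by (simp add: field_simps)
  qed
  then show ?thesis using pos by (intro exI[of _ "1 / M d"]) auto
qed

end

section \<open>Sums of seminorms\<close>

lemma seminorm_on_triangle:
  "seminorm_on W N \<Longrightarrow> u \<in> W \<Longrightarrow> v \<in> W \<Longrightarrow> N (\<lambda>x. u x + v x) \<le> N u + N v"
  by (simp add: seminorm_on_def)

lemma seminorm_on_scale: "seminorm_on W N \<Longrightarrow> u \<in> W \<Longrightarrow> N (\<lambda>x. c * u x) = \<bar>c\<bar> * N u"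
  by (simp add: seminorm_on_def)

lemma seminorm_on_sum:
  assumes "\<And>k. k \<in> A \<Longrightarrow> seminorm_on W (s k)"
  shows "seminorm_on W (\<lambda>v. \<Sum>k\<in>A. s k v)"
  using assms unfolding seminorm_on_def
  by (auto simp: sum_distrib_left sum.distrib[symmetric] intro!: sum_nonneg sum_mono)

text \<open>Closure of \<open>W\<close> under addition makes the \<open>s k\<close> nonnegative at a sum, which is where monotonicity of the
  power is used.\<close>

lemma seminorm_on_power_sum:
  assumes A: "finite A" and p: "1 \<le> p" and s: "\<And>k. k \<in> A \<Longrightarrow> seminorm_on W (s k)"
    and W: "\<And>u v. u \<in> W \<Longrightarrow> v \<in> W \<Longrightarrow> (\<lambda>x. u x + v x) \<in> W"
  shows "seminorm_on W (\<lambda>v. (\<Sum>k\<in>A. s k v powr p) powr (1 / p))"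
  unfolding seminorm_on_def
proof (intro conjI ballI allI)
  have nn: "0 \<le> s k w" if "w \<in> W" "k \<in> A" for k w using s[of k] that by (simp add: seminorm_on_def)
  fix u c assume u: "u \<in> W"
  show "0 \<le> (\<Sum>k\<in>A. s k u powr p) powr (1 / p)" by simp
  have "(\<Sum>k\<in>A. s k (\<lambda>x. c * u x) powr p) = (\<Sum>k\<in>A. \<bar>c\<bar> powr p * s k u powr p)"
  proof (rule sum.cong)
    fix k assume k: "k \<in> A"
    then have "s k (\<lambda>x. c * u x) = \<bar>c\<bar> * s k u" using s[of k] u by (simp add: seminorm_on_def)
    then show "s k (\<lambda>x. c * u x) powr p = \<bar>c\<bar> powr p * s k u powr p" using nn[OF u k] by (simp add: powr_mult)
  qed simp
  then show "(\<Sum>k\<in>A. s k (\<lambda>x. c * u x) powr p) powr (1 / p) = \<bar>c\<bar> * (\<Sum>k\<in>A. s k u powr p) powr (1 / p)"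
    using p by (simp add: sum_distrib_left[symmetric] powr_mult sum_nonneg powr_powr)
  fix v assume v: "v \<in> W"
  have "s k (\<lambda>x. u x + v x) powr p \<le> \<bar>s k u + s k v\<bar> powr p" if k: "k \<in> A" for k
  proof -
    have "s k (\<lambda>x. u x + v x) \<le> \<bar>s k u + s k v\<bar>"
      using s[OF k] u v unfolding seminorm_on_def by (meson abs_ge_self order_trans)
    then show ?thesis using nn[OF W[OF u v] k] p by (intro powr_mono2) auto
  qed
  then have "(\<Sum>k\<in>A. s k (\<lambda>x. u x + v x) powr p) powr (1 / p) \<le> (\<Sum>k\<in>A. \<bar>s k u + s k v\<bar> powr p) powr (1 / p)"
    using p by (intro powr_mono2 sum_nonneg) (auto intro: sum_mono)
  also have "\<dots> \<le> (\<Sum>k\<in>A. \<bar>s k u\<bar> powr p) powr (1 / p) + (\<Sum>k\<in>A. \<bar>s k v\<bar> powr p) powr (1 / p)"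
    by (rule sum_powr_triangle[OF A p])
  also have "\<dots> = (\<Sum>k\<in>A. s k u powr p) powr (1 / p) + (\<Sum>k\<in>A. s k v powr p) powr (1 / p)"
    using nn u v by (simp add: abs_of_nonneg cong: sum.cong)
  finally show "(\<Sum>k\<in>A. s k (\<lambda>x. u x + v x) powr p) powr (1 / p)
    \<le> (\<Sum>k\<in>A. s k u powr p) powr (1 / p) + (\<Sum>k\<in>A. s k v powr p) powr (1 / p)" .
qed

lemma power_sum_bounds:
  fixes a :: "'k \<Rightarrow> real"
  assumes A: "finite A" and p: "1 \<le> p" and a: "\<And>k. k \<in> A \<Longrightarrow> 0 \<le> a k"
  shows "(\<Sum>k\<in>A. a k powr p) powr (1 / p) \<le> (\<Sum>k\<in>A. a k)"
    and "(\<Sum>k\<in>A. a k) \<le> real (card A) * (\<Sum>k\<in>A. a k powr p) powr (1 / p)"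
proof -
  have root: "(t powr p) powr (1 / p) = t" if "0 \<le> t" for t :: real
    using that p by (simp add: powr_powr)
  have "(\<Sum>k\<in>A. a k powr p) powr (1 / p) \<le> ((\<Sum>k\<in>A. a k) powr p) powr (1 / p)"
    using p a A by (intro powr_mono2 sum_powr_le_powr_sum sum_nonneg) auto
  then show "(\<Sum>k\<in>A. a k powr p) powr (1 / p) \<le> (\<Sum>k\<in>A. a k)" using a by (simp add: root sum_nonneg)
  have "a k \<le> (\<Sum>k\<in>A. a k powr p) powr (1 / p)" if "k \<in> A" for k
  proof -
    have "(a k powr p) powr (1 / p) \<le> (\<Sum>k\<in>A. a k powr p) powr (1 / p)"
      using p A that by (intro powr_mono2 member_le_sum) auto
    then show ?thesis using a[OF that] by (simp add: root)
  qed
  then show "(\<Sum>k\<in>A. a k) \<le> real (card A) * (\<Sum>k\<in>A. a k powr p) powr (1 / p)"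
    using sum_bounded_above[of A a] by simp
qed

section \<open>Equivalent norms\<close>

context bounded_open
begin

lemma sobolev_norm_eq_0_iff:
  assumes "u \<in> sobolev_space \<Omega> k p"
  shows "sobolev_norm \<Omega> k p u = 0 \<longleftrightarrow> (AE x in lebesgue_on \<Omega>. u x = 0)"
proof
  have L: "u \<in> Lp_space \<Omega> p" using assms by (simp add: sobolev_space_def)
  assume "sobolev_norm \<Omega> k p u = 0"
  then have "dnorm (\<lambda>_. 0) u = 0"
    using dnorm_sobolev_norm_bounds(1)[of "\<lambda>_. 0" k u] dnorm_nonneg[of "\<lambda>_. 0" u] by (simp add: mi_length_def)
  then show "AE x in lebesgue_on \<Omega>. u x = 0" using dnorm_zero[OF assms] Lp_norm_eq_0_iff[OF L p] by simp
next
  assume ae: "AE x in lebesgue_on \<Omega>. u x = 0"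
  have z: "(\<lambda>x. 0) \<in> sobolev_space \<Omega> k p" by (intro sobolev_smooth smooth_const)
  have "dnorm \<alpha> u = 0" if "\<alpha> \<in> Ind k" for \<alpha>
    using dnorm_cong_AE[OF assms z _ ae, of \<alpha>] dnorm_cmult[OF z, of \<alpha> 0] that by (simp add: Ind_def)
  then have "sobolev_norm \<Omega> k p u \<le> 0" using dnorm_sobolev_norm_bounds(2)[of k u] by simp
  then show "sobolev_norm \<Omega> k p u = 0" by (simp add: sobolev_norm_def)
qed

text \<open>A seminorm bounded by the Sobolev norm takes equal values on functions that agree almost
  everywhere, because it vanishes on their difference.\<close>

lemma norm_on_equivalent_on:
  assumes N: "seminorm_on (sobolev_space \<Omega> k p) N"
    and c: "0 < c" "\<And>v. v \<in> sobolev_space \<Omega> k p \<Longrightarrow> c * sobolev_norm \<Omega> k p v \<le> N v"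
    and C: "0 < C" "\<And>v. v \<in> sobolev_space \<Omega> k p \<Longrightarrow> N v \<le> C * sobolev_norm \<Omega> k p v"
  shows "norm_on \<Omega> (sobolev_space \<Omega> k p) N" "equivalent_on (sobolev_space \<Omega> k p) N (sobolev_norm \<Omega> k p)"
proof -
  let ?W = "sobolev_space \<Omega> k p"
  have nn: "0 \<le> N v" if "v \<in> ?W" for v using N that by (simp add: seminorm_on_def)
  have zero: "N u = 0 \<longleftrightarrow> (AE x in lebesgue_on \<Omega>. u x = 0)" if u: "u \<in> ?W" for u
  proof -
    have "N u = 0 \<longleftrightarrow> sobolev_norm \<Omega> k p u = 0"
    proof
      assume "N u = 0"
      then have "c * sobolev_norm \<Omega> k p u \<le> 0" using c(2)[OF u] by simp
      then have "sobolev_norm \<Omega> k p u \<le> 0" using c(1) by (simp add: mult_le_0_iff)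
      then show "sobolev_norm \<Omega> k p u = 0" by (simp add: sobolev_norm_def)
    next
      assume "sobolev_norm \<Omega> k p u = 0"
      then show "N u = 0" using C(2)[OF u] nn[OF u] by simp
    qed
    then show ?thesis using sobolev_norm_eq_0_iff[OF u] by simp
  qed
  have le: "N u \<le> N v" if u: "u \<in> ?W" and v: "v \<in> ?W" and ae: "AE x in lebesgue_on \<Omega>. u x = v x" for u v
  proof -
    have d: "(\<lambda>x. u x - v x) \<in> ?W" by (rule sobolev_diff[OF u v])
    have "N (\<lambda>x. v x + (u x - v x)) \<le> N v + N (\<lambda>x. u x - v x)"
      by (rule seminorm_on_triangle[OF N v d])
    moreover have "N (\<lambda>x. u x - v x) = 0" using zero[OF d] ae by simp
    ultimately show ?thesis by simp
  qed
  have sym: "AE x in lebesgue_on \<Omega>. v x = u x" if "AE x in lebesgue_on \<Omega>. u x = v x" for u v :: "real^'n \<Rightarrow> real"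
    using that by (auto elim: eventually_mono)
  show "norm_on \<Omega> ?W N"
    unfolding norm_on_def using N zero le sym by (meson order_antisym)
  show "equivalent_on ?W N (sobolev_norm \<Omega> k p)"
    unfolding equivalent_on_def using c C by blast
qed

end

text \<open>With \<open>v = w + q\<close> as in \<open>bramble_hilbert\<close>, the remainder satisfies \<open>\<parallel>w\<parallel> \<le> A N(v)\<close> by the choice of \<open>q\<close>,
  and therefore \<open>N(q) \<le> N(v) + N(w) \<le> (1 + B A) N(v)\<close>. Definiteness of \<open>N\<close> on polynomials turns this into a
  bound on the coefficients of \<open>q\<close>, hence on \<open>\<parallel>q\<parallel>\<close>. The sum \<open>S\<close> of the norms of all derivatives replaces the
  Sobolev norm, as it is more visibly a seminorm.\<close>

lemma (in bounded_open) sobolev_norm_le_seminorm: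
  assumes dom: "bounded_lipschitz_domain \<Omega>"
    and N: "seminorm_on (sobolev_space \<Omega> (r + 1) p) N"
    and B: "0 \<le> B" "\<And>v. v \<in> sobolev_space \<Omega> (r + 1) p \<Longrightarrow> N v \<le> B * sobolev_norm \<Omega> (r + 1) p v"
    and top: "\<And>v. v \<in> sobolev_space \<Omega> (r + 1) p \<Longrightarrow> top_dnorm (r + 1) v \<le> N v"
    and definite: "\<And>c \<gamma>. N (poly_of (Ind r) c) = 0 \<Longrightarrow> \<gamma> \<in> Ind r \<Longrightarrow> c \<gamma> = 0"
  shows "\<exists>D\<ge>0. \<forall>v\<in>sobolev_space \<Omega> (r + 1) p. sobolev_norm \<Omega> (r + 1) p v \<le> D * N v"
proof -
  let ?W = "sobolev_space \<Omega> (r + 1) p" and ?I = "Ind r :: ('n \<Rightarrow> nat) set"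
  define S where "S = (\<lambda>v. \<Sum>\<alpha>\<in>Ind (r + 1). dnorm \<alpha> v)"
  have S: "seminorm_on ?W S"
    unfolding S_def by (rule seminorm_on_sum, rule seminorm_dnorm) (simp add: Ind_def)
  have polyW: "poly_of ?I c \<in> ?W" for c by (intro sobolev_smooth smooth_poly_of finite_Ind)
  have coeff: "coefficient_seminorm ?I (\<lambda>c. N' (poly_of ?I c))" if N': "seminorm_on ?W N'" for N'
  proof
    fix c d :: "('n \<Rightarrow> nat) \<Rightarrow> real" and t
    show "0 \<le> N' (poly_of ?I c)" using N' polyW by (simp add: seminorm_on_def)
    have "poly_of ?I (\<lambda>i. c i + d i) = (\<lambda>x. poly_of ?I c x + poly_of ?I d x)"
      by (rule ext) (simp add: poly_of_def sum.distrib distrib_right)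
    then show "N' (poly_of ?I (\<lambda>i. c i + d i)) \<le> N' (poly_of ?I c) + N' (poly_of ?I d)"
      using N' polyW by (simp add: seminorm_on_def)
    have "poly_of ?I (\<lambda>i. t * c i) = (\<lambda>x. t * poly_of ?I c x)"
      by (rule ext) (simp add: poly_of_def sum_distrib_left mult.assoc)
    then show "N' (poly_of ?I (\<lambda>i. t * c i)) = \<bar>t\<bar> * N' (poly_of ?I c)"
      using N' polyW by (simp add: seminorm_on_def)
    assume "\<And>i. i \<in> ?I \<Longrightarrow> c i = d i"
    then have "poly_of ?I c = poly_of ?I d" by (intro ext) (simp add: poly_of_def cong: sum.cong)
    then show "N' (poly_of ?I c) = N' (poly_of ?I d)" by simp
  qed (rule finite_Ind)
  interpret cN: coefficient_seminorm ?I "\<lambda>c. N (poly_of ?I c)" by (rule coeff[OF N])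
  interpret cS: coefficient_seminorm ?I "\<lambda>c. S (poly_of ?I c)" by (rule coeff[OF S])
  obtain K where K: "0 \<le> K" "\<And>c. (\<Sum>i\<in>?I. \<bar>c i\<bar>) \<le> K * N (poly_of ?I c)"
    using cN.definite_imp_controls_coefficients definite by blast
  define Q where "Q = (\<Sum>i\<in>?I. S (poly_of ?I (\<lambda>j. if j = i then 1 else 0)))"
  have Q: "0 \<le> Q" unfolding Q_def by (intro sum_nonneg cS.nonneg)
  have SQ: "S (poly_of ?I c) \<le> (\<Sum>i\<in>?I. \<bar>c i\<bar>) * Q" for c
  proof -
    have "S (poly_of ?I c) \<le> (\<Sum>i\<in>?I. \<bar>c i\<bar> * S (poly_of ?I (\<lambda>j. if j = i then 1 else 0)))"
      by (rule cS.le_sum_coefficients)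
    also have "\<dots> \<le> (\<Sum>i\<in>?I. \<bar>c i\<bar> * Q)"
      unfolding Q_def by (intro sum_mono mult_left_mono member_le_sum) (auto simp: finite_Ind cS.nonneg)
    finally show ?thesis by (simp add: sum_distrib_right)
  qed
  obtain C where C: "0 \<le> C" "\<And>v. v \<in> ?W \<Longrightarrow> \<exists>c. \<forall>\<gamma>. mi_length \<gamma> \<le> r + 1 \<longrightarrow>
      dnorm \<gamma> (\<lambda>x. v x - poly_of ?I c x) \<le> C * top_dnorm (r + 1) v"
    by (rule bramble_hilbert[OF dom p, of r, folded dnorm_def]) blast
  define A where "A = real (card (Ind (r + 1) :: ('n \<Rightarrow> nat) set)) * C"
  have A: "0 \<le> A" using C(1) by (simp add: A_def)
  define D where "D = A + K * (1 + B * A) * Q"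
  have "sobolev_norm \<Omega> (r + 1) p v \<le> D * N v" if v: "v \<in> ?W" for v
  proof -
    have Nv: "0 \<le> N v" using N v by (simp add: seminorm_on_def)
    obtain c where c: "\<And>\<gamma>. mi_length \<gamma> \<le> r + 1 \<Longrightarrow>
      dnorm \<gamma> (\<lambda>x. v x - poly_of ?I c x) \<le> C * top_dnorm (r + 1) v"
      using C(2)[OF v] by blast
    define q where "q = poly_of ?I c"
    define w where "w = (\<lambda>x. v x - q x)"
    have q: "q \<in> ?W" unfolding q_def by (rule polyW)
    have w: "w \<in> ?W" unfolding w_def by (rule sobolev_diff[OF v q])
    have "S w \<le> (\<Sum>\<alpha>\<in>(Ind (r + 1) :: ('n \<Rightarrow> nat) set). C * N v)"
      unfolding S_def
    proof (rule sum_mono)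
      fix \<alpha> :: "'n \<Rightarrow> nat" assume "\<alpha> \<in> Ind (r + 1)"
      then have "dnorm \<alpha> w \<le> C * top_dnorm (r + 1) v"
        unfolding w_def q_def by (intro c) (simp add: Ind_def)
      also have "\<dots> \<le> C * N v" using top[OF v] C(1) by (rule mult_left_mono)
      finally show "dnorm \<alpha> w \<le> C * N v" .
    qed
    then have Sw: "S w \<le> A * N v" by (simp add: A_def)
    have "N w \<le> B * sobolev_norm \<Omega> (r + 1) p w" by (rule B(2)[OF w])
    also have "\<dots> \<le> B * S w" unfolding S_def using dnorm_sobolev_norm_bounds(2) B(1) by (rule mult_left_mono)
    also have "\<dots> \<le> B * (A * N v)" using Sw B(1) by (rule mult_left_mono)
    finally have Nw: "N w \<le> B * A * N v" by simp
    have "N q = N (\<lambda>x. v x + (- 1) * w x)" by (simp add: w_def)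
    also have "\<dots> \<le> N v + N (\<lambda>x. (- 1) * w x)"
      by (rule seminorm_on_triangle[OF N v sobolev_cmult[OF w]])
    also have "N (\<lambda>x. (- 1) * w x) = N w" using seminorm_on_scale[OF N w, of "- 1"] by simp
    finally have Nq: "N q \<le> (1 + B * A) * N v" using Nw by (simp add: distrib_right)
    have "S q \<le> (\<Sum>i\<in>?I. \<bar>c i\<bar>) * Q" unfolding q_def by (rule SQ)
    also have "\<dots> \<le> K * N q * Q" using K(2)[of c] Q unfolding q_def by (rule mult_right_mono)
    also have "\<dots> \<le> K * ((1 + B * A) * N v) * Q"
      using Nq K(1) Q by (intro mult_right_mono mult_left_mono)
    finally have Sq: "S q \<le> K * (1 + B * A) * Q * N v" by (simp add: mult_ac)
    have "sobolev_norm \<Omega> (r + 1) p v \<le> S v" unfolding S_def by (rule dnorm_sobolev_norm_bounds(2))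
    also have "\<dots> = S (\<lambda>x. w x + q x)" by (simp add: w_def)
    also have "\<dots> \<le> S w + S q" by (rule seminorm_on_triangle[OF S w q])
    also have "\<dots> \<le> D * N v" using Sw Sq by (simp add: D_def distrib_right)
    finally show ?thesis .
  qed
  moreover have "0 \<le> D" using A B(1) K(1) Q by (simp add: D_def)
  ultimately show ?thesis by blast
qed

theorem theorem2p1:
  fixes \<Omega> :: "(real^'n::finite) set"
    and r J :: nat
    and p :: real
    and Ind_used :: "('n \<Rightarrow> nat) set"
    and f :: "nat \<Rightarrow> (real^'n \<Rightarrow> real) \<Rightarrow> real"
  defines "W \<equiv> sobolev_space \<Omega> (r + 1) p"
    and "Ind_rest \<equiv> Ind r - Ind_used"
  defines "N1 \<equiv> \<lambda>v. (\<Sum>\<gamma>\<in>Ind_rest. Lp_norm \<Omega> p (weak_deriv \<Omega> \<gamma> v))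
                    + (\<Sum>j=1..J. f j v)
                    + (\<Sum>\<gamma> | mi_length \<gamma> = r + 1. Lp_norm \<Omega> p (weak_deriv \<Omega> \<gamma> v))"
    and "N2 \<equiv> \<lambda>v. ((\<Sum>\<gamma>\<in>Ind_rest. Lp_norm \<Omega> p (weak_deriv \<Omega> \<gamma> v) powr p)
                    + (\<Sum>j=1..J. f j v powr p)
                    + (\<Sum>\<gamma> | mi_length \<gamma> = r + 1. Lp_norm \<Omega> p (weak_deriv \<Omega> \<gamma> v) powr p))
                   powr (1 / p)"
  assumes "bounded_lipschitz_domain \<Omega>"
    and "1 \<le> r"
    and "1 \<le> p"
    and "finite Ind_used"
    and "Ind (r - 1) \<subseteq> Ind_used"
    and "\<not> Ind r \<subseteq> Ind_used"
    and "\<forall>j\<in>{1..J}. seminorm_on W (f j)"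
    and "\<exists>C. \<forall>v\<in>W. \<forall>j\<in>{1..J}. 0 \<le> f j v \<and> f j v \<le> C * sobolev_norm \<Omega> (r + 1) p v"
    and "\<forall>v\<in>polynomials Ind_used. (\<forall>j\<in>{1..J}. f j v = 0) \<longrightarrow> v = (\<lambda>x. 0)"
  shows "norm_on \<Omega> W N1 \<and> equivalent_on W N1 (sobolev_norm \<Omega> (r + 1) p) \<and>
         norm_on \<Omega> W N2 \<and> equivalent_on W N2 (sobolev_norm \<Omega> (r + 1) p)"
proof -
  note dom = assms(5) and r = assms(6) and p = assms(7) and fin = assms(8) and low = assms(9)
    and f_semi = assms(11) and f_bound = assms(12) and f_definite = assms(13)
  interpret bounded_open \<Omega> p
    using dom p by unfold_locales (auto simp: bounded_lipschitz_domain_def)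
  let ?sn = "sobolev_norm \<Omega> (r + 1) p"
  \<comment> \<open>A single index set for the three groups of summands lets Minkowski's inequality be applied once.\<close>
  define I :: "(('n \<Rightarrow> nat) + nat + ('n \<Rightarrow> nat)) set"
    where "I = Ind_rest <+> {1..J} <+> {\<gamma>. mi_length \<gamma> = r + 1}"
  define s where "s = case_sum dnorm (case_sum f dnorm)"
  have fin_rest: "finite Ind_rest" by (simp add: Ind_rest_def finite_Ind)
  have I: "finite I" by (simp add: I_def fin_rest finite_mi_length_eq)
  have N1: "N1 v = (\<Sum>k\<in>I. s k v)" for v
    by (simp add: N1_def I_def s_def sum.Plus fin_rest finite_mi_length_eq o_def dnorm_def)
  have N2: "N2 v = (\<Sum>k\<in>I. s k v powr p) powr (1 / p)" for v
    by (simp add: N2_def I_def s_def sum.Plus fin_rest finite_mi_length_eq o_def dnorm_def add.assoc)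
  obtain C0 where C0: "\<And>v j. v \<in> W \<Longrightarrow> j \<in> {1..J} \<Longrightarrow> f j v \<le> C0 * ?sn v" using f_bound by blast
  define C where "C = max 1 C0"
  have sn: "0 \<le> ?sn v" for v by (simp add: sobolev_norm_def)
  have semi: "seminorm_on W (s k)" and bound: "v \<in> W \<Longrightarrow> s k v \<le> C * ?sn v" if "k \<in> I" for k v
  proof -
    have d: "seminorm_on W (dnorm \<gamma>)" "dnorm \<gamma> v \<le> C * ?sn v" if "mi_length \<gamma> \<le> r + 1" for \<gamma>
    proof -
      show "seminorm_on W (dnorm \<gamma>)" unfolding W_def using that by (rule seminorm_dnorm)
      have "dnorm \<gamma> v \<le> 1 * ?sn v" using dnorm_sobolev_norm_bounds(1)[OF that] by simp
      also have "\<dots> \<le> C * ?sn v" using sn by (intro mult_right_mono) (auto simp: C_def)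
      finally show "dnorm \<gamma> v \<le> C * ?sn v" .
    qed
    have fj: "f j v \<le> C * ?sn v" if "v \<in> W" "j \<in> {1..J}" for j
      using C0[OF that] mult_right_mono[OF _ sn, of C0 C] by (simp add: C_def) (meson max.cobounded2 order_trans)
    show "seminorm_on W (s k)" "v \<in> W \<Longrightarrow> s k v \<le> C * ?sn v"
      using \<open>k \<in> I\<close> d f_semi fj by (auto simp: I_def s_def Ind_rest_def Ind_def)
  qed
  have nn: "0 \<le> s k v" if "k \<in> I" "v \<in> W" for k v using semi[OF that(1)] that(2) by (simp add: seminorm_on_def)
  have N1_semi: "seminorm_on W N1"
    unfolding N1[abs_def] by (rule seminorm_on_sum) (rule semi)
  have N2_semi: "seminorm_on W N2"
    unfolding N2[abs_def] by (rule seminorm_on_power_sum[OF I p semi]) (auto simp: W_def sobolev_add)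
  define B where "B = real (card I) * C + 1"
  have B: "0 < B" by (simp add: B_def C_def add_nonneg_pos)
  have N1_le: "N1 v \<le> B * ?sn v" if "v \<in> W" for v
  proof -
    have "N1 v \<le> real (card I) * (C * ?sn v)"
      unfolding N1 using sum_bounded_above[of I "\<lambda>k. s k v"] bound that by simp
    also have "\<dots> \<le> B * ?sn v" using sn[of v] by (simp add: B_def distrib_right)
    finally show ?thesis .
  qed
  have N2_le_N1: "N2 v \<le> N1 v" and N1_le_N2: "N1 v \<le> real (card I) * N2 v" if "v \<in> W" for v
    unfolding N1 N2 using power_sum_bounds[OF I p, of "\<lambda>k. s k v"] nn that by auto
  have definite: "c \<gamma> = 0" if N0: "N1 (poly_of (Ind r) c) = 0" and \<gamma>: "\<gamma> \<in> Ind r" for c \<gamma>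
  proof -
    let ?q = "poly_of (Ind r) c"
    have q: "smooth ?q" by (intro smooth_poly_of finite_Ind)
    then have qW: "?q \<in> W" unfolding W_def by (rule sobolev_smooth)
    have s0: "s k ?q = 0" if "k \<in> I" for k
      using N0 that unfolding N1 by (subst (asm) sum_nonneg_eq_0_iff) (auto simp: I nn qW)
    have rest: "c \<alpha> = 0" if \<alpha>: "\<alpha> \<in> Ind_rest" for \<alpha>
    proof -
      have "mi_length \<alpha> = r" using \<alpha> low r by (force simp: Ind_rest_def Ind_def)
      then have "mi_partial \<alpha> ?q = (\<lambda>x. c \<alpha>)"
        using \<alpha> by (subst mi_partial_poly_of_top[OF finite_Ind]) (auto simp: Ind_def Ind_rest_def)
      moreover have "Inl \<alpha> \<in> I" unfolding I_def using \<alpha> by (rule InlI)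
      ultimately have "Lp_norm \<Omega> p (\<lambda>x. c \<alpha>) = 0"
        using s0[of "Inl \<alpha>"] dnorm_smooth[OF q, of \<alpha>] by (simp add: s_def)
      then have "AE x in lebesgue_on \<Omega>. c \<alpha> = 0"
        using Lp_norm_eq_0_iff[OF Lp_space_smooth[OF smooth_const] p] by blast
      then have "AE x in lebesgue. x \<in> \<Omega> \<longrightarrow> c \<alpha> = 0" using AE_lebesgue_on_iff[OF open_\<Omega>] by simp
      show "c \<alpha> = 0"
      proof (rule ccontr)
        assume "c \<alpha> \<noteq> 0"
        then have "AE x in lebesgue. x \<notin> \<Omega>" using \<open>AE x in lebesgue. x \<in> \<Omega> \<longrightarrow> c \<alpha> = 0\<close> by simp
        then have "negligible \<Omega>"
          unfolding negligible_iff_null_sets using open_\<Omega> by (subst (asm) AE_iff_null) (auto simp: borel_open)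
        then show False using open_not_negligible[OF open_\<Omega>] dom by (auto simp: bounded_lipschitz_domain_def)
      qed
    qed
    have "?q \<in> polynomials Ind_used"
    proof -
      define a where "a = (\<lambda>\<alpha>. if \<alpha> \<in> Ind r then c \<alpha> * (\<Prod>i\<in>UNIV. 1 / fact (\<alpha> i)) else 0)"
      have "?q x = (\<Sum>\<alpha>\<in>Ind_used. a \<alpha> * (\<Prod>i\<in>UNIV. (x $ i) ^ \<alpha> i))" for x
        unfolding poly_of_def
      proof (rule sum.mono_neutral_cong)
        fix \<alpha> assume "\<alpha> \<in> Ind r \<inter> Ind_used"
        then show "c \<alpha> * divided_power \<alpha> x = a \<alpha> * (\<Prod>i\<in>UNIV. (x $ i) ^ \<alpha> i)"
          by (simp add: a_def divided_power_def mult.assoc flip: prod.distrib)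
      qed (use fin rest in \<open>auto simp: finite_Ind a_def Ind_rest_def\<close>)
      then show ?thesis unfolding polynomials_def by blast
    qed
    moreover have "\<forall>j\<in>{1..J}. f j ?q = 0"
    proof
      fix j assume "j \<in> {1..J}"
      then have "Inr (Inl j) \<in> I" unfolding I_def by (intro InrI InlI)
      from s0[OF this] show "f j ?q = 0" by (simp add: s_def)
    qed
    ultimately have "?q = (\<lambda>x. 0)" using f_definite by blast
    then show ?thesis
      using poly_of_coefficient[OF finite_Ind \<gamma>, of c] by (simp add: mi_partial_const_0)
  qed
  have top: "top_dnorm (r + 1) v \<le> N1 v" if v: "v \<in> W" for v
  proof -
    have "0 \<le> (\<Sum>\<gamma>\<in>Ind_rest. dnorm \<gamma> v)" by (intro sum_nonneg dnorm_nonneg)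
    moreover have "0 \<le> (\<Sum>j=1..J. f j v)" using f_semi v by (intro sum_nonneg) (auto simp: seminorm_on_def)
    ultimately show ?thesis by (simp add: N1_def dnorm_def)
  qed
  obtain D where D: "0 \<le> D" "\<And>v. v \<in> W \<Longrightarrow> ?sn v \<le> D * N1 v"
    using sobolev_norm_le_seminorm[OF dom N1_semi[unfolded W_def] less_imp_le[OF B]] N1_le top definite
    unfolding W_def by blast
  have lower1: "1 / (D + 1) * ?sn v \<le> N1 v" if v: "v \<in> W" for v
  proof -
    have "?sn v \<le> (D + 1) * N1 v" using D(2)[OF v] N1_semi v by (simp add: seminorm_on_def distrib_right add_increasing2)
    then show ?thesis using D(1) by (simp add: field_simps)
  qed
  have lower2: "1 / ((D + 1) * (real (card I) + 1)) * ?sn v \<le> N2 v" if v: "v \<in> W" for v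
  proof -
    have "0 \<le> N2 v" using N2_semi v by (simp add: seminorm_on_def)
    then have "N1 v \<le> (real (card I) + 1) * N2 v" using N1_le_N2[OF v] by (simp add: distrib_right)
    then have "1 / (D + 1) * ?sn v \<le> (real (card I) + 1) * N2 v" using lower1[OF v] by linarith
    then have "1 / (D + 1) * ?sn v / (real (card I) + 1) \<le> N2 v"
      by (subst pos_divide_le_eq) (simp_all add: mult.commute)
    then show ?thesis by simp
  qed
  have D1: "0 < 1 / (D + 1)" "0 < 1 / ((D + 1) * (real (card I) + 1))" using D(1) by auto
  have upper2: "N2 v \<le> B * ?sn v" if "v \<in> W" for v using N1_le[OF that] N2_le_N1[OF that] by linarith
  show ?thesis
    using norm_on_equivalent_on[OF N1_semi[unfolded W_def] D1(1) lower1[unfolded W_def] B N1_le[unfolded W_def]]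
      norm_on_equivalent_on[OF N2_semi[unfolded W_def] D1(2) lower2[unfolded W_def] B upper2[unfolded W_def]]
    unfolding W_def by blast
qed

end
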